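(* There exist $x^*\in(0,\infty)$ and $\alpha^*\in\left(0,\frac{EV(0)}{\gamma\lambda}\right]\cap\left(0,\lambda^{-1}\right)$ such that for every $\pi\in\mathbb{R}$, $$p_{\pi,\alpha^*,x^*}(s)\equiv \pi+s x^*+s^2\frac{\gamma\lambda}{2\left(1- \lambda\alpha^*\right)}+\int_0^s\xi(t)\,dt,\qquad s\geq0,$$ is an optimal price function. Moreover, when $p_{\pi,\alpha^*,x^*}(\cdot)$ is implemented, then for every $i\geq1$ the service duration of the $i$'th customer equals $$S^*_i\equiv \inf\left\{s\geq0:\ V_i(s)-\frac{\gamma\lambda}{1-\lambda\alpha^*}s\leq x^*\right\},$$ and $ES^*_1=\alpha^*$, $\phi(S_1^* )>0$ and $$x^*= \gamma\,\frac{\lambda^2E\left[(S^*_1)^2\right]}{2\left(1-\lambda E S^*_1\right)^2}.$$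
   Context: Model. All random objects live on a probability space $(\Omega,\mathcal F,P)$. Customers arrive at a single-server facility with an infinite waiting room according to a Poisson process with rate $\lambda\in(0,\infty)$. The service discipline is work-conserving and non-preemptive; customers may neither balk nor renege, and each customer determines his own service duration. $X(\cdot),X_1(\cdot),X_2(\cdot),\ldots$ is an iid sequence of stochastic processes, independent of the arrival process, where $\{X(s);s\ge0\}$ is nonincreasing and right-continuous and $X(0)$ is a positive square-integrable random variable. $C,C_1,C_2,\ldots$ are iid positive random variables with mean $\gamma\in(0,\infty)$, independent of all other random elements of the model. $\xi(\cdot)$ is a deterministic nondecreasing right-continuous nonnegative function on $[0,\infty)$ with $\xi(0)=0$. Put $V(s)=X(s)-\xi(s)$ and $V_i(s)=X_i(s)-\xi(s)$ for $s\ge0$. A price function is a deterministic function $p:[0,\infty)\to\mathbb R$; a customer who occupies the server for $s$ minutes pays $p(s)$. The utility of customer $i$ from waiting $w\ge0$ (excluding service) and receiving service of $s\ge0$ minutes is $\int_0^sX_i(t)dt-p(s)-C_iw$; the server's revenue from this service is $p(s)-\int_0^s\xi(t)dt$ (and zero for idle periods); hence the social welfare due to customer $i$ is $SW_i(s,w)=\int_0^sV_i(t)dt-C_iw$. Individual optimization. Customer $i$ observes $X_i(\cdot)$ from the initiation of his service until departure; his service duration $S_i$ is a solution of: maximize $w(S)\equiv E\left[\int_0^S X_i(s)ds-p(S)\right]$ over all stopping times $S$ with respect to the natural filtration $\mathbb F^{X_i}$ of $X_i(\cdot)$. Tie-breaking rule: if $S',S''$ are stopping times with $w(S')=w(S'')$,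 $S'\le S''$ $P$-a.s. and $P(S'<S'')>0$, then customers consider $S'$ as better than $S''$. When the solution $S_i$ is determined, $(S_i)_{i\ge1}$ is iid and independent of the arrival process, so the system is an $M/G/1$ queue with service times distributed as $S_1$. The long-run average social welfare is the long-run average, per unit of time, of $SW_i(S_i,W_i)$ accumulated over the customers, where $W_i$ is the waiting time (excluding service) of customer $i$. A price function $p$ is called optimal if: (a) there exists a unique solution of the individual optimization (with the tie-breaking rule); (b) the resulting $M/G/1$ queue is stable; (c) the mean waiting time of the resulting $M/G/1$ queue is finite; (d) the long-run average social welfare of the resulting $M/G/1$ queue is maximal over the set of all price functions satisfying (a), (b), (c). For a nonnegative random variable $S$ (distributed jointly with $V$; for $S=S_1^*$ the process $V$ is taken to be $V_1$) with $ES<\lambda^{-1}$ and $ES^2<\infty$, $$\phi(S)\equiv E\int_0^{S}V(s)ds-\frac{\gamma\lambda ES^2}{2(1-\lambda ES)}.$$ *)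

theory Defs
  imports "HOL-Probability.Probability"
begin

section \<open>The primitives of the queueing model\<close>

text \<open>
  Customers are numbered from 0 in order of arrival. \<open>gap 0\<close> is the time until the first
  arrival and \<open>gap (Suc i)\<close> the time between the arrivals of customers \<open>i\<close> and \<open>Suc i\<close>.
  \<open>marg i s\<close> is the marginal utility \<open>X\<^sub>i(s)\<close>, \<open>wcost i\<close> is \<open>C\<^sub>i\<close>, \<open>mean_wcost\<close> is
  \<open>\<gamma>\<close> and \<open>opcost\<close> is \<open>\<xi>\<close>.

  The order of service is governed by an arbitrary selection rule, possibly randomised through
  \<open>seed\<close>. The value \<open>rule r k a d\<close> is the customer whom the rule selects for the \<open>k\<close>-th service
  when \<open>a\<close> and \<open>d\<close> describe the arrival epochs and the durations of the previous services; see
  \<open>next_service\<close> for the information that is passed to it.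
\<close>

record ('a, 'r) facility =
  prob_of :: "'a measure"
  rate :: real
  gap :: "nat \<Rightarrow> 'a \<Rightarrow> real"
  marg :: "nat \<Rightarrow> real \<Rightarrow> 'a \<Rightarrow> real"
  wcost :: "nat \<Rightarrow> 'a \<Rightarrow> real"
  mean_wcost :: real
  opcost :: "real \<Rightarrow> real"
  seed :: "'a \<Rightarrow> 'r"
  seed_space :: "'r measure"
  rule :: "'r \<Rightarrow> nat \<Rightarrow> (nat \<Rightarrow> real) \<Rightarrow> (nat \<Rightarrow> real) \<Rightarrow> nat"

definition sample_path :: "('a, 'r) facility \<Rightarrow> nat \<Rightarrow> 'a \<Rightarrow> real \<Rightarrow> real" where
  "sample_path Q i \<omega> = (\<lambda>s\<in>{0..}. marg Q i s \<omega>)"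

abbreviation path_space :: "(real \<Rightarrow> real) measure" where
  "path_space \<equiv> PiM {0..} (\<lambda>_. borel)"

text \<open>The independent sources of randomness and the events that each of them determines.\<close>

datatype source = Gap nat | Marg nat | WCost nat | Seed

primrec source_events :: "('a, 'r) facility \<Rightarrow> source \<Rightarrow> 'a set set" where
  "source_events Q (Gap i) =
     {gap Q i -` B \<inter> space (prob_of Q) | B. B \<in> sets borel}"
| "source_events Q (Marg i) =
     sigma_sets (space (prob_of Q))
       {marg Q i s -` B \<inter> space (prob_of Q) | s B. 0 \<le> s \<and> B \<in> sets borel}"
| "source_events Q (WCost i) =
     {wcost Q i -` B \<inter> space (prob_of Q) | B. B \<in> sets borel}"
| "source_events Q Seed =
     {seed Q -` B \<inter> space (prob_of Q) | B. B \<in> sets (seed_space Q)}"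

text \<open>The arrivals form a Poisson process: its interarrival times are iid exponential.\<close>

locale facility_model = prob_space "prob_of Q"
  for Q :: "('a, 'r) facility" +
  assumes rate_pos: "0 < rate Q"
    and gap_exponential:
      "\<And>i. distributed (prob_of Q) lborel (gap Q i) (exponential_density (rate Q))"
    and gap_pos: "\<And>i \<omega>. \<omega> \<in> space (prob_of Q) \<Longrightarrow> 0 < gap Q i \<omega>"
    and marg_antimono:
      "\<And>i \<omega>. \<omega> \<in> space (prob_of Q) \<Longrightarrow> antimono_on {0..} (\<lambda>s. marg Q i s \<omega>)"
    and marg_right_continuous:
      "\<And>i \<omega> s. \<omega> \<in> space (prob_of Q) \<Longrightarrow> 0 \<le> s \<Longrightarrow>
         continuous (at_right s) (\<lambda>u. marg Q i u \<omega>)"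
    and marg_pos: "\<And>i \<omega>. \<omega> \<in> space (prob_of Q) \<Longrightarrow> 0 < marg Q i 0 \<omega>"
    and marg_square_integrable: "\<And>i. integrable (prob_of Q) (\<lambda>\<omega>. (marg Q i 0 \<omega>)\<^sup>2)"
    and marg_identical:
      "\<And>i. distr (prob_of Q) path_space (sample_path Q i)
          = distr (prob_of Q) path_space (sample_path Q 0)"
    and wcost_pos: "\<And>i \<omega>. \<omega> \<in> space (prob_of Q) \<Longrightarrow> 0 < wcost Q i \<omega>"
    and wcost_integrable: "\<And>i. integrable (prob_of Q) (wcost Q i)"
    and wcost_mean: "\<And>i. expectation (wcost Q i) = mean_wcost Q"
    and wcost_identical:
      "\<And>i. distr (prob_of Q) borel (wcost Q i) = distr (prob_of Q) borel (wcost Q 0)"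
    and opcost_mono: "mono_on {0..} (opcost Q)"
    and opcost_right_continuous: "\<And>s. 0 \<le> s \<Longrightarrow> continuous (at_right s) (opcost Q)"
    and opcost_nonneg: "\<And>s. 0 \<le> s \<Longrightarrow> 0 \<le> opcost Q s"
    and opcost_0: "opcost Q 0 = 0"
    and seed_measurable: "seed Q \<in> measurable (prob_of Q) (seed_space Q)"
    and rule_measurable:
      "\<And>k. (\<lambda>(r, a, d). rule Q r k a d)
         \<in> measurable (seed_space Q \<Otimes>\<^sub>M PiM UNIV (\<lambda>_. borel) \<Otimes>\<^sub>M PiM UNIV (\<lambda>_. borel))
             (count_space UNIV)"
    and independent_sources: "indep_sets (source_events Q) UNIV"

definition net_marg :: "('a, 'r) facility \<Rightarrow> nat \<Rightarrow> real \<Rightarrow> 'a \<Rightarrow> real" where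
  "net_marg Q i s \<omega> = marg Q i s \<omega> - opcost Q s"


section \<open>Expectations in the extended reals\<close>

definition expect :: "'a measure \<Rightarrow> ('a \<Rightarrow> ereal) \<Rightarrow> ereal" where
  "expect M f = enn2ereal (\<integral>\<^sup>+ \<omega>. e2ennreal (f \<omega>) \<partial>M) - enn2ereal (\<integral>\<^sup>+ \<omega>. e2ennreal (- f \<omega>) \<partial>M)"

definition has_expect :: "'a measure \<Rightarrow> ('a \<Rightarrow> ereal) \<Rightarrow> bool" where
  "has_expect M f \<longleftrightarrow> f \<in> borel_measurable M \<and>
     ((\<integral>\<^sup>+ \<omega>. e2ennreal (f \<omega>) \<partial>M) < \<infinity> \<or> (\<integral>\<^sup>+ \<omega>. e2ennreal (- f \<omega>) \<partial>M) < \<infinity>)"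


section \<open>Individual optimization\<close>

definition natural_filtration :: "'a measure \<Rightarrow> (real \<Rightarrow> 'a \<Rightarrow> real) \<Rightarrow> real \<Rightarrow> 'a measure" where
  "natural_filtration M Y t =
     sigma (space M) {Y s -` B \<inter> space M | s B. 0 \<le> s \<and> s \<le> t \<and> B \<in> sets borel}"

text \<open>The utility of customer \<open>i\<close> from a service of random duration \<open>S\<close>, without waiting costs.\<close>

definition service_utility ::
  "('a, 'r) facility \<Rightarrow> (real \<Rightarrow> real) \<Rightarrow> nat \<Rightarrow> ('a \<Rightarrow> real) \<Rightarrow> 'a \<Rightarrow> ereal" where
  "service_utility Q p i S \<omega> = ereal (integral {0..S \<omega>} (\<lambda>s. marg Q i s \<omega>) - p (S \<omega>))"

abbreviation objective ::
  "('a, 'r) facility \<Rightarrow> (real \<Rightarrow> real) \<Rightarrow> nat \<Rightarrow> ('a \<Rightarrow> real) \<Rightarrow> ereal" where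
  "objective Q p i S \<equiv> expect (prob_of Q) (service_utility Q p i S)"

text \<open>
  A price is only defined at finite durations, so stopping times are finite. As \<open>p\<close> is an
  arbitrary function, those for which the objective is undefined have to be excluded.
\<close>

definition admissible_duration ::
  "('a, 'r) facility \<Rightarrow> (real \<Rightarrow> real) \<Rightarrow> nat \<Rightarrow> ('a \<Rightarrow> real) \<Rightarrow> bool" where
  "admissible_duration Q p i S \<longleftrightarrow>
     (\<forall>\<omega>\<in>space (prob_of Q). 0 \<le> S \<omega>) \<and>
     stopping_time (natural_filtration (prob_of Q) (marg Q i)) S \<and>
     has_expect (prob_of Q) (service_utility Q p i S)"

definition individual_solution ::
  "('a, 'r) facility \<Rightarrow> (real \<Rightarrow> real) \<Rightarrow> nat \<Rightarrow> ('a \<Rightarrow> real) \<Rightarrow> bool" where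
  "individual_solution Q p i S \<longleftrightarrow>
     admissible_duration Q p i S \<and>
     (\<forall>S'. admissible_duration Q p i S' \<longrightarrow> objective Q p i S' \<le> objective Q p i S) \<and>
     (\<nexists>S'. admissible_duration Q p i S' \<and> objective Q p i S' = objective Q p i S \<and>
        (AE \<omega> in prob_of Q. S' \<omega> \<le> S \<omega>) \<and>
        0 < measure (prob_of Q) {\<omega> \<in> space (prob_of Q). S' \<omega> < S \<omega>})"

definition unique_individual_solution ::
  "('a, 'r) facility \<Rightarrow> (real \<Rightarrow> real) \<Rightarrow> nat \<Rightarrow> ('a \<Rightarrow> real) \<Rightarrow> bool" where
  "unique_individual_solution Q p i S \<longleftrightarrow>
     individual_solution Q p i S \<and>
     (\<forall>S'. individual_solution Q p i S' \<longrightarrow> (AE \<omega> in prob_of Q. S' \<omega> = S \<omega>))"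

text \<open>
  The service durations \<open>S i\<close> that result from the price \<open>p\<close>. All customers face the same problem,
  and the pairs \<open>(S i, X\<^sub>i)\<close> are copies of one another; their independence and the independence of
  the arrivals follow because \<open>S i\<close> is a stopping time of \<open>X\<^sub>i\<close>.
\<close>

definition service_profile ::
  "('a, 'r) facility \<Rightarrow> (real \<Rightarrow> real) \<Rightarrow> (nat \<Rightarrow> 'a \<Rightarrow> real) \<Rightarrow> bool" where
  "service_profile Q p S \<longleftrightarrow>
     (\<forall>i. unique_individual_solution Q p i (S i)) \<and>
     (\<forall>i. distr (prob_of Q) (borel \<Otimes>\<^sub>M path_space) (\<lambda>\<omega>. (S i \<omega>, sample_path Q i \<omega>))
        = distr (prob_of Q) (borel \<Otimes>\<^sub>M path_space) (\<lambda>\<omega>. (S 0 \<omega>, sample_path Q 0 \<omega>)))"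


section \<open>The queue\<close>

text \<open>
  A log lists the services so far, in order, as pairs of a customer and the epoch at which his
  service starts. The next service starts as soon as the server is free and an unserved customer
  is present (work conservation); services are never interrupted. The rule then selects among the
  customers who are waiting; a selection outside this set is replaced by the first arrival in it.
  The rule is passed the arrival epochs capped at the current epoch and the durations of completed
  services, so that it anticipates neither future arrivals nor the durations of services that have
  not begun.
\<close>

definition next_service ::
  "(nat \<Rightarrow> (nat \<Rightarrow> real) \<Rightarrow> (nat \<Rightarrow> real) \<Rightarrow> nat) \<Rightarrow> (nat \<Rightarrow> real) \<Rightarrow> (nat \<Rightarrow> real) \<Rightarrow>
   (nat \<times> real) list \<Rightarrow> nat \<times> real" where
  "next_service d a s hist =
     (let n = length hist;
          served = fst ` set hist;
          free = (if hist = [] then 0 else snd (last hist) + s (fst (last hist)));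
          b = max free (INF i\<in>- served. a i);
          waiting = {i. i \<notin> served \<and> a i \<le> b};
          c = d n (\<lambda>i. min (a i) b) (\<lambda>j. if j < n then s (fst (hist ! j)) else 0)
      in (if c \<in> waiting then c else (LEAST i. i \<in> waiting), b))"

primrec service_log ::
  "(nat \<Rightarrow> (nat \<Rightarrow> real) \<Rightarrow> (nat \<Rightarrow> real) \<Rightarrow> nat) \<Rightarrow> (nat \<Rightarrow> real) \<Rightarrow> (nat \<Rightarrow> real) \<Rightarrow>
   nat \<Rightarrow> (nat \<times> real) list" where
  "service_log d a s 0 = []"
| "service_log d a s (Suc k) = service_log d a s k @ [next_service d a s (service_log d a s k)]"

definition arrival :: "('a, 'r) facility \<Rightarrow> nat \<Rightarrow> 'a \<Rightarrow> real" where
  "arrival Q i \<omega> = (\<Sum>j\<le>i. gap Q j \<omega>)"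

text \<open>
  The set below has at most one element; it is empty, and the waiting time infinite, iff
  customer \<open>i\<close> is never served (which can happen in an overloaded queue).
\<close>

definition waiting_time ::
  "('a, 'r) facility \<Rightarrow> (nat \<Rightarrow> 'a \<Rightarrow> real) \<Rightarrow> nat \<Rightarrow> 'a \<Rightarrow> ennreal" where
  "waiting_time Q S i \<omega> =
     Inf {ennreal (b - arrival Q i \<omega>) | b.
            \<exists>k. (i, b) \<in> set (service_log (rule Q (seed Q \<omega>)) (\<lambda>j. arrival Q j \<omega>) (\<lambda>j. S j \<omega>) k)}"

text \<open>
  The unfinished work found by the \<open>n\<close>-th arrival. Under work conservation it satisfies Lindley's
  recursion whatever the order of service. Stability is understood as by Loynes: it converges in
  distribution to a proper limit.
\<close>

primrec workload :: "('a, 'r) facility \<Rightarrow> (nat \<Rightarrow> 'a \<Rightarrow> real) \<Rightarrow> nat \<Rightarrow> 'a \<Rightarrow> real" where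
  "workload Q S 0 \<omega> = 0"
| "workload Q S (Suc n) \<omega> = max 0 (workload Q S n \<omega> + S n \<omega> - gap Q (Suc n) \<omega>)"

definition stable_queue :: "('a, 'r) facility \<Rightarrow> (nat \<Rightarrow> 'a \<Rightarrow> real) \<Rightarrow> bool" where
  "stable_queue Q S \<longleftrightarrow>
     (\<exists>\<mu>. real_distribution \<mu> \<and> weak_conv_m (\<lambda>n. distr (prob_of Q) borel (workload Q S n)) \<mu>)"

text \<open>
  Under a general rule single waiting times need not converge in distribution, so their mean is
  the long-run average over the customers.
\<close>

definition mean_waiting_time :: "('a, 'r) facility \<Rightarrow> (nat \<Rightarrow> 'a \<Rightarrow> real) \<Rightarrow> ennreal" where
  "mean_waiting_time Q S =
     limsup (\<lambda>n. (\<Sum>i<n. \<integral>\<^sup>+ \<omega>. waiting_time Q S i \<omega> \<partial>prob_of Q) / of_nat n)"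


section \<open>Social welfare and optimal prices\<close>

definition welfare ::
  "('a, 'r) facility \<Rightarrow> (nat \<Rightarrow> 'a \<Rightarrow> real) \<Rightarrow> nat \<Rightarrow> 'a \<Rightarrow> ereal" where
  "welfare Q S i \<omega> = ereal (integral {0..S i \<omega>} (\<lambda>s. net_marg Q i s \<omega>))
     - ereal (wcost Q i \<omega>) * enn2ereal (waiting_time Q S i \<omega>)"

definition accumulated_welfare ::
  "('a, 'r) facility \<Rightarrow> (nat \<Rightarrow> 'a \<Rightarrow> real) \<Rightarrow> real \<Rightarrow> 'a \<Rightarrow> ereal" where
  "accumulated_welfare Q S t \<omega> = (\<Sum>i | arrival Q i \<omega> \<le> t. welfare Q S i \<omega>)"

definition has_average_welfare ::
  "('a, 'r) facility \<Rightarrow> (nat \<Rightarrow> 'a \<Rightarrow> real) \<Rightarrow> ereal \<Rightarrow> bool" where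
  "has_average_welfare Q S L \<longleftrightarrow>
     (\<forall>t\<ge>0. has_expect (prob_of Q) (accumulated_welfare Q S t)) \<and>
     ((\<lambda>t. expect (prob_of Q) (accumulated_welfare Q S t) / ereal t) \<longlongrightarrow> L) at_top"

definition feasible_price ::
  "('a, 'r) facility \<Rightarrow> (real \<Rightarrow> real) \<Rightarrow> (nat \<Rightarrow> 'a \<Rightarrow> real) \<Rightarrow> bool" where
  "feasible_price Q p S \<longleftrightarrow>
     service_profile Q p S \<and> stable_queue Q S \<and> mean_waiting_time Q S < \<infinity>"

definition optimal_price :: "('a, 'r) facility \<Rightarrow> (real \<Rightarrow> real) \<Rightarrow> bool" where
  "optimal_price Q p \<longleftrightarrow>
     (\<exists>S L. feasible_price Q p S \<and> has_average_welfare Q S L \<and>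
        (\<forall>p' S'. feasible_price Q p' S' \<longrightarrow> (\<exists>L'. has_average_welfare Q S' L' \<and> L' \<le> L)))"

definition phi :: "('a, 'r) facility \<Rightarrow> (real \<Rightarrow> 'a \<Rightarrow> real) \<Rightarrow> ('a \<Rightarrow> real) \<Rightarrow> real" where
  "phi Q V S =
     (\<integral>\<omega>. integral {0..S \<omega>} (\<lambda>s. V s \<omega>) \<partial>prob_of Q)
     - mean_wcost Q * rate Q * (\<integral>\<omega>. (S \<omega>)\<^sup>2 \<partial>prob_of Q)
       / (2 * (1 - rate Q * (\<integral>\<omega>. S \<omega> \<partial>prob_of Q)))"

definition quadratic_price :: "('a, 'r) facility \<Rightarrow> real \<Rightarrow> real \<Rightarrow> real \<Rightarrow> real \<Rightarrow> real" where
  "quadratic_price Q \<pi> \<alpha> x s =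
     \<pi> + s * x + s\<^sup>2 * (mean_wcost Q * rate Q / (2 * (1 - rate Q * \<alpha>))) + integral {0..s} (opcost Q)"

definition threshold_duration ::
  "('a, 'r) facility \<Rightarrow> real \<Rightarrow> real \<Rightarrow> nat \<Rightarrow> 'a \<Rightarrow> real" where
  "threshold_duration Q \<alpha> x i \<omega> =
     Inf {s. 0 \<le> s \<and> net_marg Q i s \<omega> - mean_wcost Q * rate Q / (1 - rate Q * \<alpha>) * s \<le> x}"

end

theory Submission
  imports Defs
begin

text \<open>
  Let \<open>\<phi>(S)\<close> be as in the statement. The customer's utility from a service of duration \<open>S\<close> under
  the price with slope \<open>c = \<gamma>\<lambda> / (1 - \<lambda>\<alpha>)\<close> is, up to the constant \<open>\<pi>\<close>, the integral of the strictly
  decreasing function \<open>V(s) - c s - x\<close> over \<open>[0, S]\<close>; so the first zero \<open>S\<^sub>c\<^sub>,\<^sub>x\<close> of this function is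
  optimal along every path, and the best strategy does not have to look ahead.

  A pair \<open>(c, x)\<close> solving the two fixed point equations is found by applying the intermediate value
  theorem twice, first to \<open>x = c\<^sup>2 E S\<^sub>c\<^sub>,\<^sub>x\<^sup>2 / (2\<gamma>)\<close> for given \<open>c\<close> and then to
  \<open>c (1 - \<lambda> E S\<^sub>c\<^sub>,\<^sub>x) = \<gamma>\<lambda>\<close>; \<open>S\<^sub>c\<^sub>,\<^sub>x\<close> is Lipschitz in both parameters. As \<open>(s, u) \<mapsto> s\<^sup>2 / u\<close> is convex,
  \<open>\<phi>\<close> is concave, so that its first order conditions, which are these equations, make the threshold
  time a global maximizer of \<open>\<phi>\<close>.

  The long-run average welfare is \<open>\<lambda>\<phi>(S)\<close> by the Pollaczek-Khinchine formula, for every order of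
  service: the durations listed in the order of service are again iid and independent of the
  arrivals, and with them the epochs at which services start follow Lindley's recursion, which does
  not involve the service order. The sum of the waiting times of the first \<open>n\<close> customers is at least
  the sum of the first \<open>n\<close> Lindley waiting times, and at most the sum extended to the next
  arrival that finds the system empty. Both sums are evaluated by stopping the quadratic function
  \<open>D\<^sup>2 + 2 D / \<lambda>\<close> of the unfinished work \<open>D\<close>, whose drift is exactly \<open>E S\<^sup>2 - 2 (1/\<lambda> - E S) D\<close>; for bounded
  durations the value at the stopping index is controlled by a cubic Lyapunov function, and the
  general case follows by truncation.
\<close>

section \<open>The service log\<close>

text \<open>Welfare is accumulated up to a time t, so the number of customers counted is random and
  depends on the gaps that also drive the waiting times. The estimates are therefore proved for
  arbitrary stopping indices, encoded by \<open>weight\<close>, with constants that do not depend on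
  the index. Conditional expectations are avoided: products of a weight with a factor independent of
  the past suffice. The drift is exact by memorylessness: the idle time before an arrival that finds
  the server free is again exponential, so its first two moments stand in a fixed ratio, and the
  linear term 2 D / \<lambda> cancels what reflection at 0 takes from the square. A competing price
  comes with a finite mean waiting time, not with moments of its durations. A load below 1 and a
  finite second moment are consequences, obtained by comparison with truncated and rescaled
  durations. Truncation must not move the stopping index, so the indices used there are read off the
  arrival epochs alone.\<close>

primrec lindley :: "(nat \<Rightarrow> real) \<Rightarrow> (nat \<Rightarrow> real) \<Rightarrow> nat \<Rightarrow> real" where
  "lindley t g 0 = 0"
| "lindley t g (Suc n) = max 0 (lindley t g n + t n - g (Suc n))"

lemma lindley_nonneg: "0 \<le> lindley t g n"
  by (cases n) auto

lemma lindley_mono: "(\<And>k. t k \<le> t' k) \<Longrightarrow> lindley t g n \<le> lindley t' g n"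
proof (induction n)
  case (Suc n)
  then have "lindley t g n + t n \<le> lindley t' g n + t' n"
    by (intro add_mono) auto
  then show ?case by (auto simp: max_def)
qed simp

text \<open>One sample path. The comparison of different orders of service is deterministic;
  probability enters only through the durations listed by slot.\<close>

locale service_path =
  fixes d :: "nat \<Rightarrow> (nat \<Rightarrow> real) \<Rightarrow> (nat \<Rightarrow> real) \<Rightarrow> nat" and a s :: "nat \<Rightarrow> real"
  assumes arrival_strict_mono: "strict_mono a"
    and arrival_pos: "0 < a 0"
    and duration_nonneg: "\<And>i. 0 \<le> s i"

definition slot where "slot d a s k = next_service d a s (service_log d a s k)"

abbreviation cust where "cust d a s k \<equiv> fst (slot d a s k)"
abbreviation start where "start d a s k \<equiv> snd (slot d a s k)"

definition free :: "(nat \<Rightarrow> (nat \<Rightarrow> real) \<Rightarrow> (nat \<Rightarrow> real) \<Rightarrow> nat) \<Rightarrow> (nat \<Rightarrow> real) \<Rightarrow> (nat \<Rightarrow> real) \<Rightarrow> nat \<Rightarrow> real"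
  where "free d a s k = (if k = 0 then 0 else start d a s (k - 1) + s (cust d a s (k - 1)))"

definition wait :: "(nat \<Rightarrow> (nat \<Rightarrow> real) \<Rightarrow> (nat \<Rightarrow> real) \<Rightarrow> nat) \<Rightarrow> (nat \<Rightarrow> real) \<Rightarrow> (nat \<Rightarrow> real) \<Rightarrow> nat \<Rightarrow> ennreal"
  where "wait d a s i = Inf {ennreal (b - a i) | b. \<exists>k. (i, b) \<in> set (service_log d a s k)}"

text \<open>The logs are prefixes of one infinite sequence of slots, so statements about histories
  become statements about \<open>slot\<close>.\<close>

lemma service_log_slot: "service_log d a s k = map (slot d a s) [0..<k]"
  by (induction k) (auto simp: slot_def)

lemma served_slots: "fst ` set (service_log d a s k) = cust d a s ` {..<k}"
  by (auto simp: service_log_slot)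

lemma start_Inf: "start d a s k = max (free d a s k) (INF i\<in>- cust d a s ` {..<k}. a i)"
proof -
  have *: "snd (next_service d a s hist) = max (if hist = [] then 0 else snd (last hist) + s (fst (last hist)))
      (INF i\<in>- fst ` set hist. a i)" for hist
    unfolding next_service_def Let_def snd_conv ..
  have "(if service_log d a s k = [] then 0
        else snd (last (service_log d a s k)) + s (fst (last (service_log d a s k)))) = free d a s k"
    by (cases k) (simp_all add: service_log_slot free_def)
  then show ?thesis
    using *[of "service_log d a s k", folded slot_def, unfolded served_slots] by simp
qed

definition choice where
  "choice d a s k = d k (\<lambda>i. min (a i) (start d a s k)) (\<lambda>j. if j < k then s (cust d a s j) else 0)"

lemma cust_choice:
  "cust d a s k = (let W = {i. i \<notin> cust d a s ` {..<k} \<and> a i \<le> start d a s k}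
     in if choice d a s k \<in> W then choice d a s k else (LEAST i. i \<in> W))"
proof -
  have h: "(\<lambda>j. if j < length (service_log d a s k) then s (fst (service_log d a s k ! j)) else 0)
      = (\<lambda>j. if j < k then s (cust d a s j) else 0)"
    by (auto simp: service_log_slot fun_eq_iff)
  have l: "length (service_log d a s k) = k" by (simp add: service_log_slot)
  have *: "fst (next_service d a s hist) = (let W = {i. i \<notin> fst ` set hist \<and> a i \<le> snd (next_service d a s hist)};
      c = d (length hist) (\<lambda>i. min (a i) (snd (next_service d a s hist)))
           (\<lambda>j. if j < length hist then s (fst (hist ! j)) else 0)
    in if c \<in> W then c else (LEAST i. i \<in> W))" for hist
    unfolding next_service_def Let_def fst_conv snd_conv ..
  show ?thesis
    using *[of "service_log d a s k", folded slot_def, unfolded served_slots]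
    unfolding h unfolding l by (simp only: Let_def choice_def)
qed

text \<open>Non-anticipation: slot j is decided from the durations of the customers in the slots
  before j. This will allow the duration of the customer in slot k to be replaced by 0 without
  moving any of the slots up to k.\<close>

lemma slot_cong:
  assumes "\<And>j. j < k \<Longrightarrow> s (cust d a s j) = s' (cust d a s j)" "j \<le> k"
  shows "slot d a s' j = slot d a s j"
  using assms(2)
proof (induction j rule: less_induct)
  case (less j)
  have log: "service_log d a s' j = service_log d a s j"
    using less by (auto simp: service_log_slot)
  have eq: "s (fst (service_log d a s j ! i)) = s' (fst (service_log d a s j ! i))" if "i < j" for i
    using assms(1)[of i] that less.prems by (simp add: service_log_slot)
  have fn: "(\<lambda>i. if i < length (service_log d a s j) then s (fst (service_log d a s j ! i)) else 0)
      = (\<lambda>i. if i < length (service_log d a s j) then s' (fst (service_log d a s j ! i)) else 0)"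
    using eq by (auto simp: service_log_slot fun_eq_iff)
  have "s (fst (last (service_log d a s j))) = s' (fst (last (service_log d a s j)))"
    if "service_log d a s j \<noteq> []"
    using that eq[of "j - 1"] by (simp add: last_conv_nth service_log_slot)
  then have fr: "(if service_log d a s j = [] then 0
        else snd (last (service_log d a s j)) + s (fst (last (service_log d a s j))))
      = (if service_log d a s j = [] then 0
        else snd (last (service_log d a s j)) + s' (fst (last (service_log d a s j))))"
    by simp
  show ?case
    unfolding slot_def log next_service_def Let_def fn fr ..
qed

context service_path
begin

lemma arrival_le_iff: "a i \<le> a j \<longleftrightarrow> i \<le> j"
  using arrival_strict_mono by (simp add: strict_mono_less_eq)

lemma exists_unserved: "\<exists>i\<le>k. i \<notin> cust d a s ` {..<k}"
proof (rule ccontr)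
  assume "\<not> ?thesis"
  then have "{..k} \<subseteq> cust d a s ` {..<k}" by auto
  then have "card {..k} \<le> card (cust d a s ` {..<k})" by (intro card_mono) auto
  also have "\<dots> \<le> k" using card_image_le[of "{..<k}" "cust d a s"] by simp
  finally show False by simp
qed

lemma INF_unserved:
  "(INF i\<in>- cust d a s ` {..<k}. a i) = a (LEAST i. i \<notin> cust d a s ` {..<k})"
proof (rule cInf_eq_minimum)
  show "a (LEAST i. i \<notin> cust d a s ` {..<k}) \<in> a ` (- cust d a s ` {..<k})"
    using exists_unserved[of k] by (metis (mono_tags, lifting) ComplI LeastI imageI)
qed (auto simp: arrival_le_iff intro: Least_le)

lemma cust_waiting: "cust d a s k \<notin> cust d a s ` {..<k}" "a (cust d a s k) \<le> start d a s k"
proof -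
  let ?W = "{i. i \<notin> cust d a s ` {..<k} \<and> a i \<le> start d a s k}"
  \<comment> \<open>The first unserved customer has arrived by the start epoch, so the waiting set
    is nonempty and the fallback choice is a genuine member of it.\<close>
  have "(LEAST i. i \<notin> cust d a s ` {..<k}) \<notin> cust d a s ` {..<k}"
    using exists_unserved[of k] by (metis (mono_tags, lifting) LeastI)
  then have "(LEAST i. i \<notin> cust d a s ` {..<k}) \<in> ?W"
    by (auto simp: start_Inf[of d a s k] INF_unserved)
  then have "(LEAST i. i \<in> ?W) \<in> ?W" by (rule LeastI)
  then have "cust d a s k \<in> ?W"
    by (subst cust_choice) (auto simp: Let_def)
  then show "cust d a s k \<notin> cust d a s ` {..<k}" "a (cust d a s k) \<le> start d a s k" by auto
qed

lemma cust_inj: "inj (cust d a s)"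
proof (rule linorder_injI)
  fix i j :: nat assume "i < j"
  then show "cust d a s i \<noteq> cust d a s j" using cust_waiting(1)[of j] by (metis imageI lessThan_iff)
qed

lemma free_le_start: "free d a s k \<le> start d a s k"
  by (simp add: start_Inf)

lemma start_le_free: "start d a s k \<le> free d a s (Suc k)"
  using duration_nonneg by (simp add: free_def)

lemma start_mono: "mono (start d a s)"
  unfolding mono_iff_le_Suc using free_le_start start_le_free order_trans by blast

text \<open>The start epochs do not see which customer is chosen. If the first unserved customer is
  k, this is the definition. Otherwise the k earlier slots cannot all have gone to the customers
  below k, so somebody with index at least k was already served; then customer k has also arrived
  before the server becomes free, and both maxima equal \<open>free d a s k\<close>.\<close>

lemma start_eq: "start d a s k = max (free d a s k) (a k)"
proof -
  let ?m = "LEAST i. i \<notin> cust d a s ` {..<k}"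
  have le: "?m \<le> k" using exists_unserved[of k] by (metis (mono_tags, lifting) Least_le order_trans)
  show ?thesis
  proof (cases "?m = k")
    case True
    then show ?thesis by (simp add: start_Inf[of d a s k] INF_unserved)
  next
    case False
    have "\<not> cust d a s ` {..<k} \<subseteq> {..<k}"
    proof
      assume sub: "cust d a s ` {..<k} \<subseteq> {..<k}"
      have "card (cust d a s ` {..<k}) = k"
        using cust_inj by (subst card_image) (auto intro: inj_on_subset)
      then have "cust d a s ` {..<k} = {..<k}" using sub by (intro card_subset_eq) auto
      moreover have "?m \<notin> cust d a s ` {..<k}"
        using exists_unserved[of k] by (metis (mono_tags, lifting) LeastI)
      ultimately show False using le False by auto
    qed
    then obtain j where j: "j < k" "k \<le> cust d a s j" unfolding image_subset_iff lessThan_iff by force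
    have "a k \<le> a (cust d a s j)" using j by (simp add: arrival_le_iff)
    also have "\<dots> \<le> start d a s j" by (rule cust_waiting)
    also have "\<dots> \<le> start d a s (k - 1)" using j by (intro monoD[OF start_mono]) auto
    also have "\<dots> \<le> free d a s k" using j start_le_free[of "k - 1"] by simp
    finally have "a k \<le> free d a s k" .
    moreover have "a ?m \<le> a k" using le by (simp add: arrival_le_iff)
    ultimately show ?thesis by (simp add: start_Inf[of d a s k] INF_unserved)
  qed
qed

lemma start_lindley:
  "start d a s k - a k = lindley (\<lambda>j. s (cust d a s j)) (\<lambda>j. a j - a (j - 1)) k"
proof (induction k)
  case 0
  then show ?case using arrival_pos by (simp add: start_eq free_def)
next
  case (Suc k)
  then show ?case by (simp add: start_eq[of "Suc k"] free_def)
qed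

lemma wait_cust: "wait d a s (cust d a s k) = ennreal (start d a s k - a (cust d a s k))"
proof -
  have "{b. \<exists>k'. (cust d a s k, b) \<in> set (service_log d a s k')} = {start d a s k}"
  proof -
    have "(cust d a s k, b) \<in> set (service_log d a s k') \<Longrightarrow> b = start d a s k" for b k'
    proof -
      assume "(cust d a s k, b) \<in> set (service_log d a s k')"
      then obtain j where "slot d a s j = (cust d a s k, b)" by (auto simp: service_log_slot)
      then show "b = start d a s k" using injD[OF cust_inj, of j k] by (metis fst_conv snd_conv)
    qed
    moreover have "(cust d a s k, start d a s k) \<in> set (service_log d a s (Suc k))"
      by (simp add: service_log_slot)
    ultimately show ?thesis by blast
  qed
  then have eq: "(\<exists>k'. (cust d a s k, b) \<in> set (service_log d a s k')) \<longleftrightarrow> b = start d a s k" for b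
    by (simp add: set_eq_iff)
  show ?thesis unfolding wait_def eq by simp
qed

lemma wait_unserved:
  assumes "i \<notin> range (cust d a s)"
  shows "wait d a s i = \<infinity>"
proof -
  have "{ennreal (b - a i) | b. \<exists>k. (i, b) \<in> set (service_log d a s k)} = {}"
    using assms by (auto simp: service_log_slot dest!: arg_cong[where f=fst])
  then show ?thesis unfolding wait_def by (simp add: infinity_ennreal_def)
qed

text \<open>Induction on the cardinality: \<open>Max K\<close> is at least
  \<open>card K - 1\<close>, so removing it takes at least as much from K as removing the last index
  takes from the initial segment.\<close>

lemma sum_lessThan_card_le:
  fixes f :: "nat \<Rightarrow> real"
  assumes "mono f" "finite K"
  shows "sum f {..<card K} \<le> sum f K"
  using assms(2)
proof (induction "card K" arbitrary: K)
  case (Suc n)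
  then have ne: "K \<noteq> {}" by auto
  have "n \<le> Max K"
  proof (rule ccontr)
    assume "\<not> ?thesis"
    then have "K \<subseteq> {..<n}" using Suc Max_ge by (meson lessThan_iff not_le order_le_less_trans subsetI)
    then have "card K \<le> n" using card_mono[of "{..<n}" K] by simp
    then show False using Suc by simp
  qed
  then have "f n \<le> f (Max K)" using assms(1) by (rule monoD[rotated])
  moreover have "sum f {..<n} \<le> sum f (K - {Max K})"
  proof -
    have "n = card (K - {Max K})" using Suc(2,3) ne by (simp add: card_Diff_singleton)
    from Suc(1)[OF this] this show ?thesis using Suc(3) by simp
  qed

  moreover have "sum f K = f (Max K) + sum f (K - {Max K})"
    using Suc ne by (simp add: sum.remove)
  ultimately show ?case by (simp add: Suc(2)[symmetric])
qed simp

text \<open>The n slots that serve the first n customers need not be the first n slots, but start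
  epochs increase, so their sum is at least that of the first n starts, while the sum of arrival
  epochs is the same. If one of these customers is never served, the right-hand side is
  infinite.\<close>

lemma sum_wait_ge: "(\<Sum>k<n. ennreal (start d a s k - a k)) \<le> (\<Sum>i<n. wait d a s i)"
proof (cases "{..<n} \<subseteq> range (cust d a s)")
  case False
  then obtain i where i: "i < n" "i \<notin> range (cust d a s)" by auto
  then have "(\<Sum>i<n. wait d a s i) = top"
    using wait_unserved[of i] unfolding ennreal_sum_eq_top[OF finite_lessThan] by auto
  then show ?thesis by (simp only: top_greatest)
next
  case True
  define K where "K = cust d a s -` {..<n}"
  have img: "cust d a s ` K = {..<n}" using True by (auto simp: K_def)
  have inj: "inj_on (cust d a s) K" using cust_inj by (rule inj_on_subset) auto
  have fin: "finite K" using img inj finite_imageD by (metis finite_lessThan)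
  have card: "card K = n" using card_image[OF inj] img by simp
  have nn: "0 \<le> start d a s k - a k" for k by (simp add: start_eq)
  have "(\<Sum>k<n. start d a s k) \<le> sum (start d a s) K"
    using sum_lessThan_card_le[OF start_mono fin] card by simp
  moreover have "(\<Sum>k\<in>K. a (cust d a s k)) = (\<Sum>i<n. a i)"
    using sum.reindex[OF inj, of a] img by simp
  ultimately have "(\<Sum>k<n. start d a s k - a k) \<le> (\<Sum>k\<in>K. start d a s k - a (cust d a s k))"
    by (simp add: sum_subtractf)
  then have "(\<Sum>k<n. ennreal (start d a s k - a k)) \<le> (\<Sum>k\<in>K. ennreal (start d a s k - a (cust d a s k)))"
    using nn cust_waiting(2) by (simp only: sum_ennreal diff_ge_0_iff_ge ennreal_leI)
  also have "\<dots> = (\<Sum>k\<in>K. wait d a s (cust d a s k))" by (simp add: wait_cust)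
  also have "\<dots> = (\<Sum>i<n. wait d a s i)"
    using sum.reindex[OF inj, of "wait d a s"] img by simp
  finally show ?thesis .
qed

text \<open>If arrival m finds the system empty, whoever is served in the first m slots arrived
  before m. These slots therefore permute the first m customers, and a permutation changes neither
  sum.\<close>

lemma sum_wait_le:
  assumes "free d a s m < a m" "n \<le> m"
  shows "(\<Sum>i<n. wait d a s i) \<le> (\<Sum>k<m. ennreal (start d a s k - a k))"
proof -
  have nn: "0 \<le> start d a s k - a k" for k by (simp add: start_eq)
  have inj: "inj_on (cust d a s) {..<m}" using cust_inj by (rule inj_on_subset) auto
  have "cust d a s k < m" if "k < m" for k
  proof -
    have "a (cust d a s k) \<le> start d a s k" by (rule cust_waiting)
    also have "\<dots> \<le> start d a s (m - 1)" using that by (intro monoD[OF start_mono]) auto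
    also have "\<dots> \<le> free d a s m" using that start_le_free[of "m - 1"] by simp
    finally have "a (cust d a s k) < a m" using assms by simp
    then show ?thesis using arrival_le_iff[of m "cust d a s k"] by linarith
  qed
  then have img: "cust d a s ` {..<m} = {..<m}"
    using inj by (intro card_subset_eq) (auto simp: card_image)
  have "(\<Sum>i<n. wait d a s i) \<le> (\<Sum>i<m. wait d a s i)"
    using assms(2) by (intro sum_mono2) auto
  also have "\<dots> = (\<Sum>k<m. wait d a s (cust d a s k))"
    using sum.reindex[OF inj, of "wait d a s"] img by simp
  also have "\<dots> = ennreal (\<Sum>k<m. start d a s k - a (cust d a s k))"
    using cust_waiting(2) by (simp add: wait_cust sum_ennreal)
  also have "(\<Sum>k<m. start d a s k - a (cust d a s k)) = (\<Sum>k<m. start d a s k - a k)"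
    using sum.reindex[OF inj, of a] img by (simp add: sum_subtractf)
  finally show ?thesis using nn by (simp add: sum_ennreal)
qed

end

section \<open>Independent sources of information\<close>

definition info :: "'a measure \<Rightarrow> ('i \<Rightarrow> 'a set set) \<Rightarrow> 'i set \<Rightarrow> 'a measure" where
  "info M E J = sigma (space M) (\<Union>i\<in>J. E i)"

text \<open>Used twice: for the primitive sources of the facility, and for the gaps and durations
  that drive Lindley's recursion.\<close>

locale independent_family = prob_space M for M :: "'a measure" +
  fixes E :: "'i \<Rightarrow> 'a set set"
  assumes indep_family: "indep_sets E UNIV"
    and stable_family: "\<And>i. Int_stable (E i)"
begin

lemma family_events: "E i \<subseteq> events"
  using indep_family unfolding indep_sets_def by auto

lemma family_Pow: "(\<Union>i\<in>J. E i) \<subseteq> Pow (space M)"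
  using family_events sets.space_closed by blast

lemma space_info [simp]: "space (info M E J) = space M"
  by (simp add: info_def space_measure_of_conv)

lemma sets_info: "sets (info M E J) = sigma_sets (space M) (\<Union>i\<in>J. E i)"
  unfolding info_def using family_Pow by (rule sets_measure_of)

lemma sets_info_mono: "J \<subseteq> K \<Longrightarrow> sets (info M E J) \<subseteq> sets (info M E K)"
  unfolding sets_info by (rule sigma_sets_subseteq) auto

lemma sets_info_events: "sets (info M E J) \<subseteq> events"
  unfolding sets_info by (rule sets.sigma_sets_subset) (use family_events in auto)

lemma measurable_info_mono:
  assumes "f \<in> measurable (info M E J) N" "J \<subseteq> K"
  shows "f \<in> measurable (info M E K) N"
  using assms sets_info_mono[OF assms(2)] by (auto simp: measurable_def)

lemma measurable_info_M:
  assumes "f \<in> measurable (info M E J) N"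
  shows "f \<in> measurable M N"
  using assms sets_info_events by (fastforce simp: measurable_def)

lemma measurable_infoI:
  assumes "f \<in> space M \<rightarrow> space N" "\<And>B. B \<in> sets N \<Longrightarrow> f -` B \<inter> space M \<in> E i" "i \<in> J"
  shows "f \<in> measurable (info M E J) N"
  using assms by (auto simp: measurable_def sets_info)

lemma indep_info:
  assumes "J \<inter> K = {}"
  shows "indep_set (sets (info M E J)) (sets (info M E K))"
proof -
  have "indep_sets (\<lambda>b. sigma_sets (space M) (\<Union>i\<in>(case b of True \<Rightarrow> J | False \<Rightarrow> K). E i)) UNIV"
  proof (rule indep_sets_collect_sigma)
    show "disjoint_family_on (\<lambda>b. case b of True \<Rightarrow> J | False \<Rightarrow> K) UNIV"
      using assms by (auto simp: disjoint_family_on_def split: bool.splits)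
  qed (auto intro: indep_sets_mono_index[OF _ indep_family] stable_family)
  moreover have "(\<lambda>b. sigma_sets (space M) (\<Union>i\<in>(case b of True \<Rightarrow> J | False \<Rightarrow> K). E i))
      = case_bool (sets (info M E J)) (sets (info M E K))"
    by (auto simp: fun_eq_iff sets_info split: bool.split)
  ultimately show ?thesis
    unfolding indep_set_def by simp
qed

lemma indep_var_info:
  assumes "J \<inter> K = {}" "f \<in> measurable (info M E J) N" "g \<in> measurable (info M E K) N'"
  shows "indep_var N f N' g"
  unfolding indep_var_eq
proof (intro conjI)
  have sub: "sigma_sets (space M) {f -` A \<inter> space M |A. A \<in> sets N} \<subseteq> sets (info M E J)"
    if "f \<in> measurable (info M E J) N" for f :: "'a \<Rightarrow> 'c" and N J
    using sets.sigma_sets_subset[of "{f -` A \<inter> space M |A. A \<in> sets N}" "info M E J"]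
      measurable_sets[OF that] by auto
  have sub': "sigma_sets (space M) {g -` A \<inter> space M |A. A \<in> sets N'} \<subseteq> sets (info M E K)"
    using sets.sigma_sets_subset[of "{g -` A \<inter> space M |A. A \<in> sets N'}" "info M E K"]
      measurable_sets[OF assms(3)] by auto
  show "indep_set (sigma_sets (space M) {f -` A \<inter> space M |A. A \<in> sets N})
     (sigma_sets (space M) {g -` A \<inter> space M |A. A \<in> sets N'})"
    using indep_info[OF assms(1)] sub[OF assms(2)] sub' unfolding indep_sets2_eq by blast
qed (use assms measurable_info_M in auto)

lemma distr_pair_info:
  assumes JK: "J \<inter> K = {}" and f: "f \<in> measurable (info M E J) N" and g: "g \<in> measurable (info M E K) N'"
  shows "distr M (N \<Otimes>\<^sub>M N') (\<lambda>\<omega>. (f \<omega>, g \<omega>)) = distr M N f \<Otimes>\<^sub>M distr M N' g"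
proof (rule pair_measure_eqI[symmetric])
  have [measurable]: "f \<in> measurable M N" "g \<in> measurable M N'"
    using f g measurable_info_M by auto
  interpret f: prob_space "distr M N f" by (rule prob_space_distr) simp
  interpret g: prob_space "distr M N' g" by (rule prob_space_distr) simp
  show "sigma_finite_measure (distr M N f)" "sigma_finite_measure (distr M N' g)"
    by unfold_locales
  show "sets (distr M N f \<Otimes>\<^sub>M distr M N' g) = sets (distr M (N \<Otimes>\<^sub>M N') (\<lambda>\<omega>. (f \<omega>, g \<omega>)))"
    by (simp cong: sets_pair_measure_cong)
  fix A B assume "A \<in> sets (distr M N f)" "B \<in> sets (distr M N' g)"
  then have [measurable]: "A \<in> sets N" "B \<in> sets N'" by auto
  have "prob ((f -` A \<inter> space M) \<inter> (g -` B \<inter> space M)) = prob (f -` A \<inter> space M) * prob (g -` B \<inter> space M)"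
    using measurable_sets[OF f, of A] measurable_sets[OF g, of B] by (intro indep_setD[OF indep_info[OF JK]]) auto
  moreover have "(\<lambda>\<omega>. (f \<omega>, g \<omega>)) -` (A \<times> B) \<inter> space M = (f -` A \<inter> space M) \<inter> (g -` B \<inter> space M)" by auto
  ultimately show "emeasure (distr M N f) A * emeasure (distr M N' g) B
      = emeasure (distr M (N \<Otimes>\<^sub>M N') (\<lambda>\<omega>. (f \<omega>, g \<omega>))) (A \<times> B)"
    by (simp add: emeasure_distr emeasure_eq_measure ennreal_mult)
qed

lemma nn_integral_mult_info:
  fixes f g :: "'a \<Rightarrow> ennreal"
  assumes "J \<inter> K = {}" "f \<in> borel_measurable (info M E J)" "g \<in> borel_measurable (info M E K)"
  shows "(\<integral>\<^sup>+ \<omega>. f \<omega> * g \<omega> \<partial>M) = (\<integral>\<^sup>+ \<omega>. f \<omega> \<partial>M) * (\<integral>\<^sup>+ \<omega>. g \<omega> \<partial>M)"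
proof -
  have "indep_vars (\<lambda>_. borel) (case_bool f g) UNIV"
  proof -
    have "(\<lambda>_. borel :: ennreal measure) = case_bool borel borel" by (auto simp: fun_eq_iff split: bool.split)
    then show ?thesis using indep_var_info[OF assms] by (simp only: indep_var_def)
  qed
  from indep_vars_nn_integral[OF _ this] show ?thesis
    by (simp add: UNIV_bool mult.commute)
qed

lemma
  fixes f g :: "'a \<Rightarrow> real"
  assumes "J \<inter> K = {}" "f \<in> borel_measurable (info M E J)" "g \<in> borel_measurable (info M E K)"
    and "integrable M f" "integrable M g"
  shows integral_mult_info: "(\<integral>\<omega>. f \<omega> * g \<omega> \<partial>M) = (\<integral>\<omega>. f \<omega> \<partial>M) * (\<integral>\<omega>. g \<omega> \<partial>M)"
    and integrable_mult_info: "integrable M (\<lambda>\<omega>. f \<omega> * g \<omega>)"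
  using indep_var_lebesgue_integral[OF _ assms(4,5)] indep_var_integrable[OF _ assms(4,5)] indep_var_info[OF assms(1-3)]
  by auto

end

section \<open>Lindley's recursion with exponential interarrival times\<close>

text \<open>Memorylessness: the substitution g = y + u splits off exp (- l y) and leaves the p-th
  moment of the exponential law. The ratios between different p thus do not depend on y.\<close>

lemma nn_integral_exponential_overshoot:
  fixes y l :: real
  assumes "0 < l" "0 \<le> y"
  shows "(\<integral>\<^sup>+ g. ennreal (indicator {0<..} (g - y) * (g - y) ^ p) * ennreal (exponential_density l g) \<partial>lborel)
    = ennreal (fact p / l ^ p * exp (- l * y))"
proof -
  have "(\<integral>\<^sup>+ g. ennreal (indicator {0<..} (g - y) * (g - y) ^ p) * ennreal (exponential_density l g) \<partial>lborel)
      = (\<integral>\<^sup>+ u. ennreal (indicator {0<..} u * u ^ p) * ennreal (exponential_density l (y + u)) \<partial>lborel)"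
    by (subst nn_integral_real_affine[where c=1 and t=y]) auto
  also have "\<dots> = (\<integral>\<^sup>+ u. ennreal (exp (- l * y)) * ennreal (erlang_density 0 l u * u ^ p) \<partial>lborel)"
  proof (rule nn_integral_cong_AE)
    \<comment> \<open>At u = 0 and p = 0 the Erlang density is l while the strict indicator is 0, so
      the integrands agree only almost everywhere.\<close>
    have "AE u in lborel. u \<noteq> (0::real)" by (rule AE_lborel_singleton)
    then show "AE u in lborel. ennreal (indicator {0<..} u * u ^ p) * ennreal (exponential_density l (y + u))
        = ennreal (exp (- l * y)) * ennreal (erlang_density 0 l u * u ^ p)"
    proof eventually_elim
      case (elim u)
      show ?case
      proof (cases "u > 0")
        case True
        then show ?thesis
          using assms by (simp add: exponential_density_def ennreal_mult[symmetric] erlang_density_def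
              algebra_simps exp_add[symmetric])
      next
        case False
        then show ?thesis using elim by (simp add: erlang_density_def)
      qed
    qed
  qed
  also have "\<dots> = ennreal (exp (- l * y)) * (\<integral>\<^sup>+ u. ennreal (erlang_density 0 l u * u ^ p) \<partial>lborel)"
    by (rule nn_integral_cmult) simp
  also have "\<dots> = ennreal (exp (- l * y)) * ennreal (fact p / l ^ p)"
    using nn_integral_erlang_ith_moment[OF assms(1), of 0 p] by simp
  finally show ?thesis using assms by (simp add: ennreal_mult[symmetric] mult.commute)
qed

lemma Int_stable_vimage: "Int_stable {X -` B \<inter> A | B. B \<in> sets N}"
proof (rule Int_stableI)
  fix a b assume "a \<in> {X -` B \<inter> A | B. B \<in> sets N}" "b \<in> {X -` B \<inter> A | B. B \<in> sets N}"
  then obtain B C where "a = X -` B \<inter> A" "b = X -` C \<inter> A" "B \<in> sets N" "C \<in> sets N" by auto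
  then show "a \<inter> b \<in> {X -` B \<inter> A | B. B \<in> sets N}" by (auto intro!: exI[of _ "B \<inter> C"])
qed

text \<open>Used with the durations by slot, which govern the waiting times, with the durations by
  customer, which define \<open>workload\<close>, and with truncations.\<close>

locale single_server = prob_space M for M :: "'a measure" +
  fixes l :: real and G T :: "nat \<Rightarrow> 'a \<Rightarrow> real"
  assumes l_pos: "0 < l"
    and indep_GT: "indep_vars (\<lambda>_. borel) (case_sum G T) UNIV"
    and G_exponential: "\<And>i. distributed M lborel (G i) (exponential_density l)"
    and G_pos: "\<And>i \<omega>. \<omega> \<in> space M \<Longrightarrow> 0 < G i \<omega>"
    and T_nonneg: "\<And>i \<omega>. \<omega> \<in> space M \<Longrightarrow> 0 \<le> T i \<omega>"
    and T_identical: "\<And>i. distr M borel (T i) = distr M borel (T 0)"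
begin

definition source :: "nat + nat \<Rightarrow> 'a set set" where
  "source i = {case_sum G T i -` B \<inter> space M | B. B \<in> sets borel}"

sublocale independent_family M source
proof
  show "indep_sets source UNIV"
    using indep_GT unfolding indep_vars_def2 source_def by auto
  show "Int_stable (source i)" for i
    unfolding source_def by (rule Int_stable_vimage)
qed

text \<open>Known at arrival k: his gap, but not his duration, which \<open>past'\<close> adds.
  \<open>D k\<close> is measurable for \<open>past k\<close>; the pair \<open>T k\<close>,
  \<open>G (Suc k)\<close> is independent of \<open>past k\<close>, and \<open>G (Suc k)\<close>
  alone even of \<open>past' k\<close>.\<close>

definition past :: "nat \<Rightarrow> 'a measure" where
  "past k = info M source (Inl ` {..k} \<union> Inr ` {..<k})"

definition past' :: "nat \<Rightarrow> 'a measure" where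
  "past' k = info M source (Inl ` {..k} \<union> Inr ` {..k})"

definition D :: "nat \<Rightarrow> 'a \<Rightarrow> real" where
  "D n \<omega> = lindley (\<lambda>k. T k \<omega>) (\<lambda>k. G k \<omega>) n"

lemma D_0: "D 0 \<omega> = 0" and D_Suc: "D (Suc n) \<omega> = max 0 (D n \<omega> + T n \<omega> - G (Suc n) \<omega>)"
  by (simp_all add: D_def)

lemma D_nonneg: "0 \<le> D n \<omega>"
  by (simp add: D_def lindley_nonneg)

lemma G_info: "Inl i \<in> J \<Longrightarrow> G i \<in> borel_measurable (info M source J)"
  by (rule measurable_infoI[where i="Inl i"]) (auto simp: source_def)

lemma T_info: "Inr i \<in> J \<Longrightarrow> T i \<in> borel_measurable (info M source J)"
  by (rule measurable_infoI[where i="Inr i"]) (auto simp: source_def)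

lemma space_past [simp]: "space (past k) = space M" "space (past' k) = space M"
  by (simp_all add: past_def past'_def)

lemma past_le: "f \<in> measurable (past j) N \<Longrightarrow> j \<le> k \<Longrightarrow> f \<in> measurable (past k) N"
  unfolding past_def by (rule measurable_info_mono) auto

lemma past_past': "f \<in> measurable (past k) N \<Longrightarrow> f \<in> measurable (past' k) N"
  unfolding past_def past'_def by (rule measurable_info_mono) auto

lemma past'_past: "f \<in> measurable (past' k) N \<Longrightarrow> f \<in> measurable (past (Suc k)) N"
  unfolding past_def past'_def by (rule measurable_info_mono) auto

lemma past_M: "f \<in> measurable (past k) N \<Longrightarrow> f \<in> measurable M N"
  unfolding past_def by (rule measurable_info_M)

lemma past'_M: "f \<in> measurable (past' k) N \<Longrightarrow> f \<in> measurable M N"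
  unfolding past'_def by (rule measurable_info_M)

lemma G_past: "i \<le> k \<Longrightarrow> G i \<in> borel_measurable (past k)"
  unfolding past_def by (rule G_info) auto

lemma T_past': "i \<le> k \<Longrightarrow> T i \<in> borel_measurable (past' k)"
  unfolding past'_def by (rule T_info) auto

lemma T_past: "i < k \<Longrightarrow> T i \<in> borel_measurable (past k)"
  unfolding past_def by (rule T_info) auto

lemma D_past: "D k \<in> borel_measurable (past k)"
proof (induction k)
  case 0
  show ?case unfolding D_def by simp
next
  case (Suc k)
  have [measurable]: "D k \<in> borel_measurable (past (Suc k))" "T k \<in> borel_measurable (past (Suc k))"
    "G (Suc k) \<in> borel_measurable (past (Suc k))"
    using past_le[OF Suc, of "Suc k"] T_past[of k "Suc k"] G_past[of "Suc k" "Suc k"] by auto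
  show ?case unfolding D_Suc[abs_def] by measurable
qed

lemma G_measurable [measurable]: "G i \<in> borel_measurable M"
  using past_M[OF G_past[of i i]] by simp

lemma T_measurable [measurable]: "T i \<in> borel_measurable M"
  using past'_M[OF T_past'[of i i]] by simp

lemma D_measurable [measurable]: "D i \<in> borel_measurable M"
  using past_M[OF D_past] .

text \<open>\<open>G (Suc k)\<close> is independent of \<open>past' k\<close>, so Fubini allows the
  memoryless computation to be done for fixed values of w and Y.\<close>

lemma nn_integral_overshoot:
  assumes w: "w \<in> borel_measurable (past' k)" and Y: "Y \<in> borel_measurable (past' k)"
    and Y_nonneg: "\<And>\<omega>. \<omega> \<in> space M \<Longrightarrow> 0 \<le> Y \<omega>"
  shows "(\<integral>\<^sup>+ \<omega>. ennreal (w \<omega>) * ennreal (indicator {0<..} (G (Suc k) \<omega> - Y \<omega>) * (G (Suc k) \<omega> - Y \<omega>) ^ p) \<partial>M)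
    = (\<integral>\<^sup>+ \<omega>. ennreal (w \<omega>) * ennreal (fact p / l ^ p * exp (- l * Y \<omega>)) \<partial>M)"
proof -
  have [measurable]: "w \<in> borel_measurable M" "Y \<in> borel_measurable M"
    using w Y past'_M by auto
  define X where "X \<omega> = (w \<omega>, Y \<omega>)" for \<omega>
  have X_past: "X \<in> past' k \<rightarrow>\<^sub>M borel \<Otimes>\<^sub>M borel"
    unfolding X_def using w Y by measurable
  then have [measurable]: "X \<in> M \<rightarrow>\<^sub>M borel \<Otimes>\<^sub>M borel" using past'_M by blast
  have joint: "distr M ((borel \<Otimes>\<^sub>M borel) \<Otimes>\<^sub>M borel) (\<lambda>\<omega>. (X \<omega>, G (Suc k) \<omega>))
      = distr M (borel \<Otimes>\<^sub>M borel) X \<Otimes>\<^sub>M distr M borel (G (Suc k))"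
    by (rule distr_pair_info[OF _ X_past[unfolded past'_def] G_info[of _ "{Inl (Suc k)}"]]) auto
  define f :: "(real \<times> real) \<times> real \<Rightarrow> ennreal" where "f z = ennreal (fst (fst z)) *
      ennreal (indicator {0<..} (snd z - snd (fst z)) * (snd z - snd (fst z)) ^ p)" for z
  have [measurable]: "f \<in> borel_measurable ((borel \<Otimes>\<^sub>M borel) \<Otimes>\<^sub>M borel)"
    unfolding f_def by measurable
  interpret X: prob_space "distr M (borel \<Otimes>\<^sub>M borel) X" by (rule prob_space_distr) simp
  interpret G: prob_space "distr M borel (G (Suc k))" by (rule prob_space_distr) simp
  have G_distr: "distr M borel (G (Suc k)) = density lborel (exponential_density l)"
    using distributed_distr_eq_density[OF G_exponential[of "Suc k"]] by (simp cong: distr_cong)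
  have "(\<integral>\<^sup>+ \<omega>. ennreal (w \<omega>) * ennreal (indicator {0<..} (G (Suc k) \<omega> - Y \<omega>) * (G (Suc k) \<omega> - Y \<omega>) ^ p) \<partial>M)
      = (\<integral>\<^sup>+ \<omega>. f (X \<omega>, G (Suc k) \<omega>) \<partial>M)"
    by (simp add: f_def X_def)
  also have "\<dots> = (\<integral>\<^sup>+ z. f z \<partial>(distr M (borel \<Otimes>\<^sub>M borel) X \<Otimes>\<^sub>M distr M borel (G (Suc k))))"
    unfolding joint[symmetric] by (subst nn_integral_distr) auto
  also have "\<dots> = (\<integral>\<^sup>+ x. (\<integral>\<^sup>+ g. f (x, g) \<partial>distr M borel (G (Suc k))) \<partial>distr M (borel \<Otimes>\<^sub>M borel) X)"
    by (rule G.nn_integral_fst[symmetric]) simp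
  also have "\<dots> = (\<integral>\<^sup>+ \<omega>. (\<integral>\<^sup>+ g. f (X \<omega>, g) \<partial>distr M borel (G (Suc k))) \<partial>M)"
    by (subst nn_integral_distr) auto
  also have "\<dots> = (\<integral>\<^sup>+ \<omega>. ennreal (w \<omega>) * ennreal (fact p / l ^ p * exp (- l * Y \<omega>)) \<partial>M)"
  proof (rule nn_integral_cong)
    fix \<omega> assume "\<omega> \<in> space M"
    have "(\<integral>\<^sup>+ g. f (X \<omega>, g) \<partial>distr M borel (G (Suc k)))
        = ennreal (w \<omega>) * (\<integral>\<^sup>+ g. ennreal (indicator {0<..} (g - Y \<omega>) * (g - Y \<omega>) ^ p) * ennreal (exponential_density l g) \<partial>lborel)"
      unfolding G_distr
      by (subst nn_integral_density) (auto simp: f_def X_def nn_integral_cmult[symmetric] ac_simps)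
    then show "(\<integral>\<^sup>+ g. f (X \<omega>, g) \<partial>distr M borel (G (Suc k)))
        = ennreal (w \<omega>) * ennreal (fact p / l ^ p * exp (- l * Y \<omega>))"
      using nn_integral_exponential_overshoot[OF l_pos Y_nonneg[OF \<open>\<omega> \<in> space M\<close>], of p] by simp
  qed
  finally show ?thesis .
qed

end

context single_server
begin

text \<open>Integrability is not assumed: both sides are \<open>enn2real\<close> of the same
  extended integral and agree even where the Bochner integral takes its default value.\<close>

lemma integral_overshoot:
  assumes w: "w \<in> borel_measurable (past' k)" "\<And>\<omega>. \<omega> \<in> space M \<Longrightarrow> 0 \<le> w \<omega>"
    and Y: "Y \<in> borel_measurable (past' k)" "\<And>\<omega>. \<omega> \<in> space M \<Longrightarrow> 0 \<le> Y \<omega>"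
  shows "(\<integral>\<omega>. w \<omega> * (indicator {0<..} (G (Suc k) \<omega> - Y \<omega>) * (G (Suc k) \<omega> - Y \<omega>) ^ p) \<partial>M)
    = fact p / l ^ p * (\<integral>\<omega>. w \<omega> * exp (- l * Y \<omega>) \<partial>M)"
proof -
  have [measurable]: "w \<in> borel_measurable M" "Y \<in> borel_measurable M"
    using w(1) Y(1) past'_M by auto
  have "(\<integral>\<omega>. w \<omega> * (indicator {0<..} (G (Suc k) \<omega> - Y \<omega>) * (G (Suc k) \<omega> - Y \<omega>) ^ p) \<partial>M)
      = enn2real (\<integral>\<^sup>+ \<omega>. ennreal (w \<omega>) * ennreal (indicator {0<..} (G (Suc k) \<omega> - Y \<omega>) * (G (Suc k) \<omega> - Y \<omega>) ^ p) \<partial>M)"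
    using w(2) by (subst integral_eq_nn_integral)
      (auto simp: indicator_def intro!: AE_I2 arg_cong[where f=enn2real] nn_integral_cong ennreal_mult)
  also have "\<dots> = enn2real (\<integral>\<^sup>+ \<omega>. ennreal (w \<omega>) * ennreal (fact p / l ^ p * exp (- l * Y \<omega>)) \<partial>M)"
    by (subst nn_integral_overshoot[OF w(1) Y]) auto
  also have "\<dots> = (\<integral>\<omega>. w \<omega> * (fact p / l ^ p * exp (- l * Y \<omega>)) \<partial>M)"
    using w(2) l_pos by (subst integral_eq_nn_integral)
      (auto simp del: times_divide_eq_left times_divide_eq_right
        intro!: AE_I2 arg_cong[where f=enn2real] nn_integral_cong ennreal_mult[symmetric])
  also have "\<dots> = fact p / l ^ p * (\<integral>\<omega>. w \<omega> * exp (- l * Y \<omega>) \<partial>M)"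
    by (subst Bochner_Integration.integral_mult_right_zero[symmetric]) (simp add: ac_simps)
  finally show ?thesis .
qed

lemma integrable_G_power [simp]: "integrable M (\<lambda>\<omega>. G i \<omega> ^ p)"
  and integral_G_power: "(\<integral>\<omega>. G i \<omega> ^ p \<partial>M) = fact p / l ^ p"
  using erlang_ith_moment_integrable[OF l_pos, of "G i" 0 p] erlang_ith_moment[OF l_pos, of "G i" 0 p] G_exponential[of i]
  by (simp_all add: exponential_density_def)

lemma integrable_T_iff: "f \<in> borel_measurable borel \<Longrightarrow>
    integrable M (\<lambda>\<omega>. f (T i \<omega>) :: real) \<longleftrightarrow> integrable M (\<lambda>\<omega>. f (T 0 \<omega>))"
  using integrable_distr_eq[of "T i" M borel f] integrable_distr_eq[of "T 0" M borel f] by (simp add: T_identical[of i])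

lemma integral_T_eq: "f \<in> borel_measurable borel \<Longrightarrow>
    (\<integral>\<omega>. f (T i \<omega>) \<partial>M) = (\<integral>\<omega>. f (T 0 \<omega>) \<partial>M :: real)"
  using integral_distr[of "T i" M borel f] integral_distr[of "T 0" M borel f] by (simp add: T_identical[of i])

text \<open>The process of indicators of k < \<tau> for a stopping index \<tau>. As
  \<open>h k\<close> is known at arrival k, it is independent of \<open>step k\<close>, which is all
  that the drift computations use.\<close>

definition weight :: "(nat \<Rightarrow> 'a \<Rightarrow> real) \<Rightarrow> bool" where
  "weight h \<longleftrightarrow> (\<forall>k. h k \<in> borel_measurable (past k) \<and>
     (\<forall>\<omega>\<in>space M. h k \<omega> \<in> {0, 1} \<and> h (Suc k) \<omega> \<le> h k \<omega>))"

lemma weightD: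
  assumes "weight h"
  shows "h k \<in> borel_measurable (past k)" "\<omega> \<in> space M \<Longrightarrow> h k \<omega> \<in> {0, 1}"
    "\<omega> \<in> space M \<Longrightarrow> h (Suc k) \<omega> \<le> h k \<omega>" "\<omega> \<in> space M \<Longrightarrow> 0 \<le> h k \<omega>"
    "\<omega> \<in> space M \<Longrightarrow> h k \<omega> \<le> 1" "h k \<in> borel_measurable M"
proof -
  show p: "h k \<in> borel_measurable (past k)" and z: "\<omega> \<in> space M \<Longrightarrow> h k \<omega> \<in> {0, 1}"
    and "\<omega> \<in> space M \<Longrightarrow> h (Suc k) \<omega> \<le> h k \<omega>"
    using assms unfolding weight_def by blast+
  show "\<omega> \<in> space M \<Longrightarrow> 0 \<le> h k \<omega>" "\<omega> \<in> space M \<Longrightarrow> h k \<omega> \<le> 1" using z by auto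
  show "h k \<in> borel_measurable M" using past_M[OF p] .
qed

text \<open>
  With \<open>h k = 1\<close> iff \<open>k < \<tau>\<close> for a stopping index \<open>\<tau>\<close>, this is \<open>\<Psi> (D (min \<tau> n))\<close>, provided that
  \<open>\<Psi> 0 = 0\<close>.
\<close>

definition stopped :: "(nat \<Rightarrow> 'a \<Rightarrow> real) \<Rightarrow> (real \<Rightarrow> real) \<Rightarrow> nat \<Rightarrow> 'a \<Rightarrow> real" where
  "stopped h \<Psi> n \<omega> = h n \<omega> * \<Psi> (D n \<omega>) + (\<Sum>k<n. (h k \<omega> - h (Suc k) \<omega>) * \<Psi> (D (Suc k) \<omega>))"

lemma sum_increments:
  assumes "\<Psi> 0 = 0"
  shows "(\<Sum>k<n. h k \<omega> * (\<Psi> (D (Suc k) \<omega>) - \<Psi> (D k \<omega>))) = stopped h \<Psi> n \<omega>"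
  by (induction n) (auto simp: stopped_def D_0 assms algebra_simps)

text \<open>\<open>stopped\<close> is a combination of values of the function with nonnegative
  coefficients of total \<open>h 0 \<omega>\<close>, which is at most 1. A pointwise bound therefore
  carries over, and a nonnegative constant contributes at most itself.\<close>

lemma stopped_le:
  assumes "weight h" "\<omega> \<in> space M" "\<And>x. 0 \<le> x \<Longrightarrow> \<Psi> x \<le> c * \<Phi> x + e" "0 \<le> e"
  shows "stopped h \<Psi> n \<omega> \<le> c * stopped h \<Phi> n \<omega> + e"
proof -
  have "stopped h \<Psi> n \<omega> \<le> h n \<omega> * (c * \<Phi> (D n \<omega>) + e)
      + (\<Sum>k<n. (h k \<omega> - h (Suc k) \<omega>) * (c * \<Phi> (D (Suc k) \<omega>) + e))"
    unfolding stopped_def using weightD[OF assms(1)] assms(2,3) D_nonneg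
    by (intro add_mono sum_mono mult_left_mono) auto
  also have "\<dots> = c * stopped h \<Phi> n \<omega> + e * (h n \<omega> + (\<Sum>k<n. h k \<omega> - h (Suc k) \<omega>))"
    by (simp add: stopped_def algebra_simps sum.distrib sum_distrib_left sum_subtractf)
  also have "h n \<omega> + (\<Sum>k<n. h k \<omega> - h (Suc k) \<omega>) = h 0 \<omega>"
    by (induction n) auto
  also have "e * h 0 \<omega> \<le> e" using assms weightD(5)[OF assms(1,2)] by (simp add: mult_left_le)
  finally show ?thesis by simp
qed

lemma stopped_nonneg:
  assumes "weight h" "\<omega> \<in> space M" "\<And>x. 0 \<le> x \<Longrightarrow> 0 \<le> \<Psi> x"
  shows "0 \<le> stopped h \<Psi> n \<omega>"
  unfolding stopped_def using weightD[OF assms(1)] assms(2,3) D_nonneg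
  by (auto intro!: add_nonneg_nonneg sum_nonneg mult_nonneg_nonneg)

definition load :: "nat \<Rightarrow> 'a \<Rightarrow> real" where "load k \<omega> = D k \<omega> + T k \<omega>"
definition step :: "nat \<Rightarrow> 'a \<Rightarrow> real" where "step k \<omega> = T k \<omega> - G (Suc k) \<omega>"
text \<open>The time during which the server idles before arrival \<open>Suc k\<close>; it is the
  correction made by reflection at 0.\<close>

definition excess :: "nat \<Rightarrow> 'a \<Rightarrow> real" where
  "excess k \<omega> = indicator {0<..} (G (Suc k) \<omega> - load k \<omega>) * (G (Suc k) \<omega> - load k \<omega>)"
definition idle :: "nat \<Rightarrow> 'a \<Rightarrow> real" where
  "idle k \<omega> = indicator {0<..} (G (Suc k) \<omega> - load k \<omega>)"

lemma load_past': "load k \<in> borel_measurable (past' k)"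
  unfolding load_def using past_past'[OF D_past[of k]] T_past'[of k k] by measurable

lemma load_nonneg: "\<omega> \<in> space M \<Longrightarrow> 0 \<le> load k \<omega>"
  unfolding load_def using D_nonneg T_nonneg by auto

lemma measurable_step [measurable]:
  "load k \<in> borel_measurable M" "step k \<in> borel_measurable M" "excess k \<in> borel_measurable M"
  "idle k \<in> borel_measurable M"
  unfolding load_def step_def excess_def idle_def by measurable

lemma D_Suc_excess: "D (Suc k) \<omega> = D k \<omega> + step k \<omega> + excess k \<omega>"
  by (simp add: D_Suc step_def excess_def load_def indicator_def max_def)

text \<open>\<open>D (Suc k)\<close> and \<open>excess k\<close> are never both nonzero, and their
  difference is \<open>D k + step k\<close>; so the squares add up without a cross term.\<close>

lemma D_Suc_square: "(D (Suc k) \<omega>)\<^sup>2 = (D k \<omega> + step k \<omega>)\<^sup>2 - (excess k \<omega>)\<^sup>2"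
  by (auto simp: D_Suc step_def excess_def load_def indicator_def max_def power2_eq_square algebra_simps)

lemma D_Suc_le: "\<omega> \<in> space M \<Longrightarrow> D (Suc k) \<omega> \<le> D k \<omega> + T k \<omega>"
  using G_pos[of \<omega> "Suc k"] D_nonneg[of k \<omega>] T_nonneg[of \<omega> k] by (simp add: D_Suc)

lemma excess_le: "\<omega> \<in> space M \<Longrightarrow> 0 \<le> excess k \<omega> \<and> excess k \<omega> \<le> G (Suc k) \<omega>"
  using load_nonneg[of \<omega> k] G_pos[of \<omega> "Suc k"] by (auto simp: excess_def indicator_def)

lemma step_info: "step k \<in> borel_measurable (info M source {Inl (Suc k), Inr k})"
  unfolding step_def using G_info[of "Suc k" "{Inl (Suc k), Inr k}"] T_info[of k "{Inl (Suc k), Inr k}"] by measurable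

lemma
  assumes "f \<in> borel_measurable (past k)" "integrable M f"
    "p \<in> borel_measurable borel" "integrable M (\<lambda>\<omega>. p (step k \<omega>) :: real)"
  shows integral_mult_step: "(\<integral>\<omega>. f \<omega> * p (step k \<omega>) \<partial>M) = (\<integral>\<omega>. f \<omega> \<partial>M) * (\<integral>\<omega>. p (step k \<omega>) \<partial>M)"
    and integrable_mult_step: "integrable M (\<lambda>\<omega>. f \<omega> * p (step k \<omega>))"
proof -
  have m: "(\<lambda>\<omega>. p (step k \<omega>)) \<in> borel_measurable (info M source {Inl (Suc k), Inr k})"
    using measurable_compose[OF step_info assms(3)] .
  have d: "(Inl ` {..k} \<union> Inr ` {..<k}) \<inter> {Inl (Suc k), Inr k} = {}" by auto
  show "(\<integral>\<omega>. f \<omega> * p (step k \<omega>) \<partial>M) = (\<integral>\<omega>. f \<omega> \<partial>M) * (\<integral>\<omega>. p (step k \<omega>) \<partial>M)"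
    "integrable M (\<lambda>\<omega>. f \<omega> * p (step k \<omega>))"
    using integral_mult_info[OF d assms(1)[unfolded past_def] m assms(2,4)]
      integrable_mult_info[OF d assms(1)[unfolded past_def] m assms(2,4)] by auto
qed

lemma integrable_weight:
  assumes "weight h" "integrable M f"
  shows "integrable M (\<lambda>\<omega>. h k \<omega> * f \<omega>)"
proof (rule Bochner_Integration.integrable_bound[OF assms(2)])
  show "(\<lambda>\<omega>. h k \<omega> * f \<omega>) \<in> borel_measurable M"
    using weightD(6)[OF assms(1)] assms(2) by measurable
  show "AE \<omega> in M. norm (h k \<omega> * f \<omega>) \<le> norm (f \<omega>)"
  proof (rule AE_I2)
    fix \<omega> assume "\<omega> \<in> space M"
    then show "norm (h k \<omega> * f \<omega>) \<le> norm (f \<omega>)"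
      using weightD(2)[OF assms(1), of \<omega> k] by auto
  qed
qed

lemma weight_past:
  assumes "weight h" "f \<in> borel_measurable (past k)"
  shows "(\<lambda>\<omega>. h k \<omega> * f \<omega> :: real) \<in> borel_measurable (past k)"
  using weightD(1)[OF assms(1), of k] assms(2) by measurable

text \<open>An idle period, given that it occurs, is exponential with rate l whatever the load was.
  All its moments are multiples of the same expectation of exp (- l load), with ratios 1 / l and 2 /
  l.\<close>

lemma excess_past:
  assumes "weight h"
  shows "(\<integral>\<omega>. h k \<omega> * excess k \<omega> \<partial>M) = 1 / l * (\<integral>\<omega>. h k \<omega> * idle k \<omega> \<partial>M)"
    and "(\<integral>\<omega>. h k \<omega> * (excess k \<omega>)\<^sup>2 \<partial>M) = 2 / l * (\<integral>\<omega>. h k \<omega> * excess k \<omega> \<partial>M)"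
proof -
  have *: "(\<integral>\<omega>. h k \<omega> * (indicator {0<..} (G (Suc k) \<omega> - load k \<omega>) * (G (Suc k) \<omega> - load k \<omega>) ^ p) \<partial>M)
    = fact p / l ^ p * (\<integral>\<omega>. h k \<omega> * exp (- l * load k \<omega>) \<partial>M)" for p
    by (rule integral_overshoot[OF past_past'[OF weightD(1)] _ load_past' load_nonneg])
      (use assms weightD(4)[OF assms] in auto)
  have sq: "(excess k \<omega>)\<^sup>2 = indicator {0<..} (G (Suc k) \<omega> - load k \<omega>) * (G (Suc k) \<omega> - load k \<omega>)\<^sup>2" for \<omega>
    by (simp add: excess_def power_mult_distrib indicator_def)
  show "(\<integral>\<omega>. h k \<omega> * excess k \<omega> \<partial>M) = 1 / l * (\<integral>\<omega>. h k \<omega> * idle k \<omega> \<partial>M)"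
    using *[of 0] *[of 1] unfolding excess_def idle_def power_0 power_one_right mult_1_right fact_0 fact_1 div_by_1 mult_1_left
    by (simp only:)
  show "(\<integral>\<omega>. h k \<omega> * (excess k \<omega>)\<^sup>2 \<partial>M) = 2 / l * (\<integral>\<omega>. h k \<omega> * excess k \<omega> \<partial>M)"
    unfolding sq *[of 2] unfolding excess_def using *[of 1, unfolded power_one_right]
    by (simp only: fact_2 fact_1) (simp add: power2_eq_square)
qed

end

section \<open>Drift of the unfinished work for square integrable durations\<close>

locale single_server_L2 = single_server +
  assumes T_square_integrable: "integrable M (\<lambda>\<omega>. (T 0 \<omega>)\<^sup>2)"
begin

definition m1 where "m1 = (\<integral>\<omega>. T 0 \<omega> \<partial>M)"
definition m2 where "m2 = (\<integral>\<omega>. (T 0 \<omega>)\<^sup>2 \<partial>M)"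

lemma m2_nonneg: "0 \<le> m2"
  unfolding m2_def by (rule integral_nonneg_AE) simp

lemma T_integrable2 [simp]: "integrable M (\<lambda>\<omega>. (T i \<omega>)\<^sup>2)"
  using integrable_T_iff[of "\<lambda>x. x\<^sup>2" i] T_square_integrable by simp

lemma T_integrable [simp]: "integrable M (T i)"
  by (rule square_integrable_imp_integrable) auto

lemma T_moments: "(\<integral>\<omega>. T i \<omega> \<partial>M) = m1" "(\<integral>\<omega>. (T i \<omega>)\<^sup>2 \<partial>M) = m2"
  unfolding m1_def m2_def using integral_T_eq[of "\<lambda>x. x" i] integral_T_eq[of "\<lambda>x. x\<^sup>2" i] by auto

lemma G_integrable [simp]: "integrable M (G i)" "integrable M (\<lambda>\<omega>. (G i \<omega>)\<^sup>2)"
  using integrable_G_power[of i 1] integrable_G_power[of i 2] by auto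

lemma G_moments: "(\<integral>\<omega>. G i \<omega> \<partial>M) = 1 / l" "(\<integral>\<omega>. (G i \<omega>)\<^sup>2 \<partial>M) = 2 / l\<^sup>2"
  using integral_G_power[of i 1] integral_G_power[of i 2] by (auto simp: fact_2)

lemma D_square_integrable [simp]: "integrable M (\<lambda>\<omega>. (D n \<omega>)\<^sup>2)"
proof (induction n)
  case (Suc n)
  show ?case
  proof (rule Bochner_Integration.integrable_bound)
    show "integrable M (\<lambda>\<omega>. 2 * (D n \<omega>)\<^sup>2 + 2 * (T n \<omega>)\<^sup>2)" using Suc by simp
    show "AE \<omega> in M. norm ((D (Suc n) \<omega>)\<^sup>2) \<le> norm (2 * (D n \<omega>)\<^sup>2 + 2 * (T n \<omega>)\<^sup>2)"
    proof (rule AE_I2)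
      fix \<omega> assume "\<omega> \<in> space M"
      then have "(D (Suc n) \<omega>)\<^sup>2 \<le> (D n \<omega> + T n \<omega>)\<^sup>2"
        using D_Suc_le D_nonneg by (intro power_mono) auto
      also have "\<dots> \<le> 2 * (D n \<omega>)\<^sup>2 + 2 * (T n \<omega>)\<^sup>2"
        using zero_le_power2[of "D n \<omega> - T n \<omega>"] by (simp add: power2_eq_square algebra_simps)
      finally show "norm ((D (Suc n) \<omega>)\<^sup>2) \<le> norm (2 * (D n \<omega>)\<^sup>2 + 2 * (T n \<omega>)\<^sup>2)" by simp
    qed
  qed simp
qed (simp add: D_0)

lemma D_integrable [simp]: "integrable M (D n)"
  by (rule square_integrable_imp_integrable) auto

lemma step_integrable [simp]: "integrable M (step k)" "integrable M (\<lambda>\<omega>. (step k \<omega>)\<^sup>2)"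
proof -
  show "integrable M (step k)" unfolding step_def by auto
  have "integrable M (\<lambda>\<omega>. T k \<omega> * G (Suc k) \<omega>)"
    by (rule integrable_mult_info[of "{Inr k}" "{Inl (Suc k)}"]) (auto intro: G_info T_info)
  then show "integrable M (\<lambda>\<omega>. (step k \<omega>)\<^sup>2)" unfolding step_def by (simp add: power2_diff algebra_simps)
qed

lemma step_moments: "(\<integral>\<omega>. step k \<omega> \<partial>M) = m1 - 1 / l"
  "(\<integral>\<omega>. (step k \<omega>)\<^sup>2 \<partial>M) = m2 - 2 * m1 / l + 2 / l\<^sup>2"
proof -
  show "(\<integral>\<omega>. step k \<omega> \<partial>M) = m1 - 1 / l" unfolding step_def by (simp add: T_moments G_moments)
  have "integrable M (\<lambda>\<omega>. T k \<omega> * G (Suc k) \<omega>)" "(\<integral>\<omega>. T k \<omega> * G (Suc k) \<omega> \<partial>M) = m1 * (1 / l)"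
    using integrable_mult_info[of "{Inr k}" "{Inl (Suc k)}" "T k" "G (Suc k)"]
      integral_mult_info[of "{Inr k}" "{Inl (Suc k)}" "T k" "G (Suc k)"]
    by (auto simp: G_info T_info T_moments G_moments)
  moreover have "(\<lambda>\<omega>. (step k \<omega>)\<^sup>2) = (\<lambda>\<omega>. (T k \<omega>)\<^sup>2 + (G (Suc k) \<omega>)\<^sup>2 - 2 * (T k \<omega> * G (Suc k) \<omega>))"
    by (auto simp: step_def power2_diff)
  ultimately show "(\<integral>\<omega>. (step k \<omega>)\<^sup>2 \<partial>M) = m2 - 2 * m1 / l + 2 / l\<^sup>2"
    by (simp add: T_moments G_moments)
qed

lemma excess_integrable [simp]: "integrable M (excess k)" "integrable M (\<lambda>\<omega>. (excess k \<omega>)\<^sup>2)"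
proof -
  have "excess k \<omega> \<le> \<bar>G (Suc k) \<omega>\<bar>" if "\<omega> \<in> space M" for \<omega>
    using excess_le[OF that, of k] by auto
  then show "integrable M (excess k)"
    by (intro Bochner_Integration.integrable_bound[OF G_integrable(1)[of "Suc k"]]) (use excess_le[of _ k] in auto)
  have "(excess k \<omega>)\<^sup>2 \<le> (G (Suc k) \<omega>)\<^sup>2" if "\<omega> \<in> space M" for \<omega>
    using excess_le[OF that, of k] by (intro power_mono) auto
  then show "integrable M (\<lambda>\<omega>. (excess k \<omega>)\<^sup>2)"
    by (intro Bochner_Integration.integrable_bound[OF G_integrable(2)[of "Suc k"]]) auto
qed

lemma stopped_integrable:
  assumes "weight h" "\<And>n. integrable M (\<lambda>\<omega>. \<Psi> (D n \<omega>))"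
  shows "integrable M (stopped h \<Psi> n)"
proof -
  have "integrable M (\<lambda>\<omega>. h k \<omega> * \<Psi> (D n \<omega>))" for k n by (rule integrable_weight) fact+
  then show ?thesis unfolding stopped_def by (auto simp: left_diff_distrib)
qed

text \<open>In terms of the stopping index \<tau>, \<open>count\<close> is the expectation of min
  \<tau> n, and \<open>total\<close> the expected sum of D over the indices below min \<tau>
  n.\<close>

definition count :: "(nat \<Rightarrow> 'a \<Rightarrow> real) \<Rightarrow> nat \<Rightarrow> real" where
  "count h n = (\<Sum>k<n. \<integral>\<omega>. h k \<omega> \<partial>M)"
definition total :: "(nat \<Rightarrow> 'a \<Rightarrow> real) \<Rightarrow> nat \<Rightarrow> real" where
  "total h n = (\<Sum>k<n. \<integral>\<omega>. h k \<omega> * D k \<omega> \<partial>M)"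

lemma weight_integrable [simp]: "weight h \<Longrightarrow> integrable M (h k)"
  using integrable_weight[of h "\<lambda>_. 1" k] by simp

lemma integral_stopped:
  assumes "weight h" "\<Psi> 0 = 0" "\<And>n. integrable M (\<lambda>\<omega>. \<Psi> (D n \<omega>))"
  shows "(\<integral>\<omega>. stopped h \<Psi> n \<omega> \<partial>M)
    = (\<Sum>k<n. (\<integral>\<omega>. h k \<omega> * \<Psi> (D (Suc k) \<omega>) \<partial>M) - (\<integral>\<omega>. h k \<omega> * \<Psi> (D k \<omega>) \<partial>M))"
proof -
  have [simp]: "integrable M (\<lambda>\<omega>. h k \<omega> * \<Psi> (D n \<omega>))" for k n by (rule integrable_weight) fact+
  show ?thesis
    unfolding sum_increments[of \<Psi>, OF assms(2), symmetric] by (simp add: right_diff_distrib)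
qed

lemma linear_increment:
  assumes "weight h"
  shows "(\<integral>\<omega>. h k \<omega> * D (Suc k) \<omega> \<partial>M) = (\<integral>\<omega>. h k \<omega> * D k \<omega> \<partial>M) + (m1 - 1 / l) * (\<integral>\<omega>. h k \<omega> \<partial>M)
    + (\<integral>\<omega>. h k \<omega> * excess k \<omega> \<partial>M)"
proof -
  note [simp] = integrable_weight[OF assms]
  have "(\<integral>\<omega>. h k \<omega> * step k \<omega> \<partial>M) = (m1 - 1 / l) * (\<integral>\<omega>. h k \<omega> \<partial>M)"
    using integral_mult_step[OF weightD(1)[OF assms, of k], of "\<lambda>x. x"] assms by (simp add: step_moments)
  then show ?thesis by (simp add: D_Suc_excess distrib_left)
qed

lemma square_increment:
  assumes "weight h"
  shows "(\<integral>\<omega>. h k \<omega> * (D (Suc k) \<omega>)\<^sup>2 \<partial>M) = (\<integral>\<omega>. h k \<omega> * (D k \<omega>)\<^sup>2 \<partial>M)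
    + 2 * (m1 - 1 / l) * (\<integral>\<omega>. h k \<omega> * D k \<omega> \<partial>M) + (m2 - 2 * m1 / l + 2 / l\<^sup>2) * (\<integral>\<omega>. h k \<omega> \<partial>M)
    - (\<integral>\<omega>. h k \<omega> * (excess k \<omega>)\<^sup>2 \<partial>M)"
proof -
  note [simp] = integrable_weight[OF assms]
  have 1: "(\<integral>\<omega>. h k \<omega> * (step k \<omega>)\<^sup>2 \<partial>M) = (m2 - 2 * m1 / l + 2 / l\<^sup>2) * (\<integral>\<omega>. h k \<omega> \<partial>M)"
    using integral_mult_step[OF weightD(1)[OF assms, of k], of "\<lambda>x. x\<^sup>2"] assms by (simp add: step_moments)
  have 2: "(\<integral>\<omega>. h k \<omega> * D k \<omega> * step k \<omega> \<partial>M) = (m1 - 1 / l) * (\<integral>\<omega>. h k \<omega> * D k \<omega> \<partial>M)"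
    "integrable M (\<lambda>\<omega>. h k \<omega> * D k \<omega> * step k \<omega>)"
    using integral_mult_step[OF weight_past[OF assms D_past[of k]], of "\<lambda>x. x"]
      integrable_mult_step[OF weight_past[OF assms D_past[of k]], of "\<lambda>x. x"] by (simp_all add: step_moments)
  have "(\<lambda>\<omega>. h k \<omega> * (D (Suc k) \<omega>)\<^sup>2) = (\<lambda>\<omega>. h k \<omega> * (D k \<omega>)\<^sup>2 + 2 * (h k \<omega> * D k \<omega> * step k \<omega>)
      + h k \<omega> * (step k \<omega>)\<^sup>2 - h k \<omega> * (excess k \<omega>)\<^sup>2)"
    unfolding D_Suc_square by (auto simp: power2_eq_square algebra_simps)
  then show ?thesis using 2 by (simp add: 1)
qed

text \<open>The coefficient 2 / l is chosen so that the linear gain from \<open>excess\<close>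
  cancels the quadratic loss, by \<open>excess_past\<close>. The remaining constants collapse, since
  (2 / l) (m1 - 1 / l) cancels everything but m2 in the second moment of
  \<open>step\<close>.\<close>

lemma stopped_quadratic:
  assumes "weight h"
  shows "(\<integral>\<omega>. stopped h (\<lambda>x. x\<^sup>2 + 2 / l * x) n \<omega> \<partial>M) = m2 * count h n - 2 * (1 / l - m1) * total h n"
proof -
  note [simp] = integrable_weight[OF assms]
  have "(\<integral>\<omega>. h k \<omega> * ((D (Suc k) \<omega>)\<^sup>2 + 2 / l * D (Suc k) \<omega>) \<partial>M) - (\<integral>\<omega>. h k \<omega> * ((D k \<omega>)\<^sup>2 + 2 / l * D k \<omega>) \<partial>M)
     = m2 * (\<integral>\<omega>. h k \<omega> \<partial>M) - 2 * (1 / l - m1) * (\<integral>\<omega>. h k \<omega> * D k \<omega> \<partial>M)" for k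
  proof -
    have s: "(\<lambda>\<omega>. h k \<omega> * ((D n \<omega>)\<^sup>2 + 2 / l * D n \<omega>)) = (\<lambda>\<omega>. h k \<omega> * (D n \<omega>)\<^sup>2 + 2 / l * (h k \<omega> * D n \<omega>))" for n
      by (auto simp: algebra_simps)
    show ?thesis unfolding s
      using l_pos by (simp add: square_increment[OF assms] linear_increment[OF assms] excess_past(2)[OF assms])
        (simp add: field_simps power2_eq_square)
  qed
  then show ?thesis
    by (subst integral_stopped[OF assms]) (simp_all add: count_def total_def sum_subtractf sum_distrib_left)
qed

text \<open>Wald's identity. It exchanges the expected number of indices for the expected number of
  idle steps, up to the unfinished work at the stopping index.\<close>

lemma stopped_linear:
  assumes "weight h"
  shows "(\<integral>\<omega>. stopped h (\<lambda>x. x) n \<omega> \<partial>M)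
    = 1 / l * (\<Sum>k<n. \<integral>\<omega>. h k \<omega> * idle k \<omega> \<partial>M) - (1 / l - m1) * count h n"
  by (subst integral_stopped[OF assms])
    (simp_all add: linear_increment[OF assms] excess_past(1)[OF assms] count_def sum.distrib
      sum_distrib_left sum_subtractf algebra_simps)

text \<open>The Pollaczek-Khinchine mean waiting time l E T^2 / (2 (1 - l E T)).\<close>

definition mean_delay where "mean_delay = m2 / (2 * (1 / l - m1))"

text \<open>The stopped value of the quadratic function is nonnegative.\<close>

lemma total_le:
  assumes "weight h" "m1 < 1 / l"
  shows "total h n \<le> mean_delay * count h n"
proof -
  have "0 \<le> (\<integral>\<omega>. stopped h (\<lambda>x. x\<^sup>2 + 2 / l * x) n \<omega> \<partial>M)"
    using l_pos by (intro integral_nonneg_AE AE_I2 stopped_nonneg[OF assms(1)]) auto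
  then show ?thesis
    using assms(2) unfolding stopped_quadratic[OF assms(1)] mean_delay_def
    by (simp add: field_simps)
qed

end

section \<open>A cubic Lyapunov bound for bounded durations\<close>

lemma cube_max_le:
  fixes d x :: real
  assumes "0 \<le> d"
  shows "(max 0 (d + x)) ^ 3 \<le> d ^ 3 + 3 * d\<^sup>2 * x + 3 * d * x\<^sup>2 + \<bar>x\<bar> ^ 3"
proof (cases "0 \<le> d + x")
  case True
  have "(d + x) ^ 3 = d ^ 3 + 3 * d\<^sup>2 * x + 3 * d * x\<^sup>2 + x ^ 3"
    by (simp add: power3_eq_cube power2_eq_square algebra_simps)
  moreover have "x ^ 3 \<le> \<bar>x\<bar> ^ 3" by (metis abs_ge_self power_abs)
  ultimately show ?thesis using True by simp
next
  case False
  \<comment> \<open>In the reflected case d < z, and the right-hand side becomes a sum of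
    nonnegative terms.\<close>
  define z where "z = - x"
  have z: "d < z" "x = - z" using False by (auto simp: z_def)
  have "0 \<le> d ^ 3 + 3 * d * z * (z - d) + z ^ 3" using z assms by simp
  then show ?thesis using z assms False by (simp add: power2_eq_square algebra_simps)
qed

text \<open>The left-hand side is at most (1 + b) x^2 + b. Beyond x = (1 + b) / e the cube dominates
  the quadratic term; up to there the term is bounded by its value at that point, which is the
  constant.\<close>

lemma linear_plus_square_le_cube:
  fixes b e x :: real
  assumes "0 < e" "0 \<le> b" "0 \<le> x"
  shows "x\<^sup>2 + b * x \<le> e * x ^ 3 + ((1 + b) * ((1 + b) / e)\<^sup>2 + b)"
proof -
  have "b * x \<le> b * (1 + x\<^sup>2)"
  proof (intro mult_left_mono)
    show "x \<le> 1 + x\<^sup>2" using zero_le_power2[of "x - 1/2"] by (simp add: power2_eq_square algebra_simps)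
  qed (use assms in auto)
  then have "x\<^sup>2 + b * x \<le> (1 + b) * x\<^sup>2 + b" by (simp add: algebra_simps)
  also have "(1 + b) * x\<^sup>2 \<le> e * x ^ 3 + (1 + b) * ((1 + b) / e)\<^sup>2"
  proof (cases "x \<le> (1 + b) / e")
    case True
    then have "(1 + b) * x\<^sup>2 \<le> (1 + b) * ((1 + b) / e)\<^sup>2" using assms by (intro mult_left_mono power_mono) auto
    moreover have "0 \<le> e * x ^ 3" using assms by simp
    ultimately show ?thesis by simp
  next
    case False
    then have "1 + b \<le> e * x" using assms by (simp add: field_simps)
    then have "(1 + b) * x\<^sup>2 \<le> e * x * x\<^sup>2" by (intro mult_right_mono) auto
    also have "\<dots> = e * x ^ 3" by (simp add: power2_eq_square power3_eq_cube)
    finally show ?thesis using assms by (simp add: add_increasing2)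
  qed
  finally show ?thesis by simp
qed

lemma linear_le_square:
  fixes e x :: real
  assumes "0 < e" "0 \<le> x" "0 \<le> b"
  shows "x \<le> e * (x\<^sup>2 + b * x) + 1 / e"
proof -
  have "0 \<le> e * (x - 1 / (2 * e))\<^sup>2" using assms by simp
  also have "e * (x - 1 / (2 * e))\<^sup>2 = e * x\<^sup>2 - x + 1 / (4 * e)"
    using assms by (simp add: power2_eq_square field_simps)
  also have "1 / (4 * e) \<le> 1 / e" using assms by (simp add: field_simps)
  finally have "x \<le> e * x\<^sup>2 + 1 / e" by simp
  moreover have "0 \<le> e * (b * x)" using assms by simp
  ultimately show ?thesis by (simp add: distrib_left)
qed

context single_server_L2
begin

lemma total_ge_stopped:
  assumes "weight h" "m1 < 1 / l"
  shows "mean_delay * count h n - total h n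
    = (\<integral>\<omega>. stopped h (\<lambda>x. x\<^sup>2 + 2 / l * x) n \<omega> \<partial>M) / (2 * (1 / l - m1))"
  using assms(2) unfolding stopped_quadratic[OF assms(1)] mean_delay_def by (simp add: field_simps)

lemma count_nonneg: "weight h \<Longrightarrow> 0 \<le> count h n"
  unfolding count_def using weightD(4) by (intro sum_nonneg integral_nonneg_AE) auto

lemma mean_delay_nonneg: "m1 < 1 / l \<Longrightarrow> 0 \<le> mean_delay"
  unfolding mean_delay_def using m2_nonneg by simp

text \<open>The stopped quadratic value is at most \<open>m2 * count h n\<close>. As e is arbitrary,
  the expected unfinished work at the stopping index is of smaller order than the expected
  index.\<close>

lemma stopped_linear_le:
  assumes "weight h" "m1 < 1 / l" "0 < e"
  shows "(\<integral>\<omega>. stopped h (\<lambda>x. x) n \<omega> \<partial>M) \<le> e * m2 * count h n + 1 / e"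
proof -
  have int: "integrable M (stopped h (\<lambda>x. x\<^sup>2 + 2 / l * x) n)" "integrable M (stopped h (\<lambda>x. x) n)"
    using assms(1) by (auto intro!: stopped_integrable)
  have "(\<integral>\<omega>. stopped h (\<lambda>x. x) n \<omega> \<partial>M) \<le> (\<integral>\<omega>. e * stopped h (\<lambda>x. x\<^sup>2 + 2 / l * x) n \<omega> + 1 / e \<partial>M)"
    using int assms l_pos
    by (intro integral_mono_AE AE_I2 stopped_le[OF assms(1)] linear_le_square) auto
  also have "\<dots> = e * (m2 * count h n - 2 * (1 / l - m1) * total h n) + 1 / e"
    using int stopped_quadratic[OF assms(1), of n] by (simp add: prob_space del: times_divide_eq_left)
  also have "\<dots> \<le> e * m2 * count h n + 1 / e"
  proof -
    have "0 \<le> total h n" unfolding total_def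
      using weightD(4)[OF assms(1)] D_nonneg by (intro sum_nonneg integral_nonneg_AE AE_I2 mult_nonneg_nonneg) auto
    then have "0 \<le> e * (2 * (1 / l - m1) * total h n)" using assms by simp
    then show ?thesis by (simp add: right_diff_distrib)
  qed
  finally show ?thesis .
qed

text \<open>By \<open>total_ge_stopped\<close> the deficit of \<open>total\<close> is a multiple of
  the stopped quadratic value, which has to be of smaller order than \<open>count\<close>. The cube
  does this: its stopped value grows at most linearly in \<open>count\<close>, because the leading
  drift term 3 D^2 (m1 - 1 / l) is negative and the next one is controlled by
  \<open>total_le\<close>. The constant C is uniform over all stopping indices.\<close>

lemma total_ge_bounded:
  assumes T_bounded: "\<And>i \<omega>. \<omega> \<in> space M \<Longrightarrow> T i \<omega> \<le> K" and m1: "m1 < 1 / l" and e: "0 < e"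
  shows "\<exists>C. \<forall>h n. weight h \<longrightarrow> (mean_delay - e) * count h n - C \<le> total h n"
proof -
  have D_le: "D n \<omega> \<le> real n * K" if "\<omega> \<in> space M" for n \<omega>
  proof (induction n)
    case (Suc n)
    have "D (Suc n) \<omega> \<le> D n \<omega> + T n \<omega>" by (rule D_Suc_le[OF that])
    also have "\<dots> \<le> real n * K + K" using Suc T_bounded[OF that] by (rule add_mono)
    finally show ?case by (simp add: algebra_simps)
  qed (simp add: D_0)
  have D_cube: "integrable M (\<lambda>\<omega>. (D n \<omega>) ^ 3)" for n
    by (rule integrable_const_bound[of _ "(real n * K) ^ 3"])
      (use D_le D_nonneg in \<open>auto intro!: AE_I2 power_mono\<close>)
  \<comment> \<open>A bound for the third absolute moment of \<open>step\<close>, from (K + G)^3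
    \<le> 4 K^3 + 4 G^3 and the third moment 6 / l^3 of a gap.\<close>
  define c3 where "c3 = 4 * K ^ 3 + 4 * (6 / l ^ 3)"
  have K0: "0 \<le> K" using T_bounded T_nonneg not_empty by (meson ex_in_conv order_trans)
  have cube_le: "\<bar>step k \<omega>\<bar> ^ 3 \<le> 4 * K ^ 3 + 4 * G (Suc k) \<omega> ^ 3" if \<omega>: "\<omega> \<in> space M" for k \<omega>
  proof -
    have g: "0 \<le> G (Suc k) \<omega>" using G_pos[OF \<omega>, of "Suc k"] by simp
    have "\<bar>step k \<omega>\<bar> \<le> K + G (Suc k) \<omega>"
      using T_bounded[OF \<omega>, of k] T_nonneg[OF \<omega>, of k] g K0 unfolding step_def by linarith
    then have "\<bar>step k \<omega>\<bar> ^ 3 \<le> (K + G (Suc k) \<omega>) ^ 3" by (intro power_mono) auto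
    also have "\<dots> \<le> 4 * K ^ 3 + 4 * G (Suc k) \<omega> ^ 3"
    proof -
      have "0 \<le> 3 * (K + G (Suc k) \<omega>) * (K - G (Suc k) \<omega>)\<^sup>2" using g K0 by simp
      then show ?thesis by (simp add: power2_eq_square power3_eq_cube algebra_simps)
    qed
    finally show ?thesis .
  qed
  have step3: "integrable M (\<lambda>\<omega>. \<bar>step k \<omega>\<bar> ^ 3)" for k
    by (rule Bochner_Integration.integrable_bound[of M "\<lambda>\<omega>. 4 * K ^ 3 + 4 * G (Suc k) \<omega> ^ 3"])
      (use cube_le in \<open>auto intro!: AE_I2 simp: order_trans[OF cube_le abs_ge_self]\<close>)
  have step3_le: "(\<integral>\<omega>. \<bar>step k \<omega>\<bar> ^ 3 \<partial>M) \<le> c3" for k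
  proof -
    have "(\<integral>\<omega>. \<bar>step k \<omega>\<bar> ^ 3 \<partial>M) \<le> (\<integral>\<omega>. 4 * K ^ 3 + 4 * G (Suc k) \<omega> ^ 3 \<partial>M)"
      using step3 cube_le by (intro integral_mono_AE) auto
    also have "\<dots> = c3"
      unfolding c3_def using integral_G_power[of "Suc k" 3] by (simp add: prob_space fact_numeral)
    finally show ?thesis .
  qed
  define v where "v = m2 - 2 * m1 / l + 2 / l\<^sup>2"
  have v_nonneg: "0 \<le> v" unfolding v_def step_moments(2)[of 0, symmetric] by (rule integral_nonneg_AE) auto
  \<comment> \<open>The drift 3 v D + c3 of the cube, summed up to the stopping index, with the sum
    of D bounded by \<open>mean_delay * count\<close>.\<close>
  define c where "c = 3 * v * mean_delay + c3"
  have cubic: "(\<integral>\<omega>. stopped h (\<lambda>x. x ^ 3) n \<omega> \<partial>M) \<le> c * count h n" if h: "weight h" for h n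
  proof -
    note [simp] = integrable_weight[OF h] D_cube step3
    have "(\<integral>\<omega>. h k \<omega> * D (Suc k) \<omega> ^ 3 \<partial>M) - (\<integral>\<omega>. h k \<omega> * D k \<omega> ^ 3 \<partial>M)
        \<le> 3 * v * (\<integral>\<omega>. h k \<omega> * D k \<omega> \<partial>M) + c3 * (\<integral>\<omega>. h k \<omega> \<partial>M)" for k
    proof -
      have i1: "(\<integral>\<omega>. h k \<omega> * (D k \<omega>)\<^sup>2 * step k \<omega> \<partial>M) = (\<integral>\<omega>. h k \<omega> * (D k \<omega>)\<^sup>2 \<partial>M) * (m1 - 1 / l)"
        "integrable M (\<lambda>\<omega>. h k \<omega> * (D k \<omega>)\<^sup>2 * step k \<omega>)"
      proof -
        have m: "(\<lambda>\<omega>. (D k \<omega>)\<^sup>2) \<in> borel_measurable (past k)" using D_past[of k] by measurable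
        have i: "integrable M (\<lambda>\<omega>. h k \<omega> * (D k \<omega>)\<^sup>2)" by (rule integrable_weight[OF h]) simp
        show "(\<integral>\<omega>. h k \<omega> * (D k \<omega>)\<^sup>2 * step k \<omega> \<partial>M) = (\<integral>\<omega>. h k \<omega> * (D k \<omega>)\<^sup>2 \<partial>M) * (m1 - 1 / l)"
          "integrable M (\<lambda>\<omega>. h k \<omega> * (D k \<omega>)\<^sup>2 * step k \<omega>)"
          using integral_mult_step[OF weight_past[OF h m] i, of "\<lambda>x. x"]
            integrable_mult_step[OF weight_past[OF h m] i, of "\<lambda>x. x"]
          by (simp_all add: step_moments)
      qed
      have i2: "(\<integral>\<omega>. h k \<omega> * D k \<omega> * (step k \<omega>)\<^sup>2 \<partial>M) = (\<integral>\<omega>. h k \<omega> * D k \<omega> \<partial>M) * v"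
        "integrable M (\<lambda>\<omega>. h k \<omega> * D k \<omega> * (step k \<omega>)\<^sup>2)"
        using integral_mult_step[OF weight_past[OF h D_past[of k]], of "\<lambda>x. x\<^sup>2"]
          integrable_mult_step[OF weight_past[OF h D_past[of k]], of "\<lambda>x. x\<^sup>2"]
        by (simp_all add: step_moments v_def)
      have i3: "(\<integral>\<omega>. h k \<omega> * \<bar>step k \<omega>\<bar> ^ 3 \<partial>M) = (\<integral>\<omega>. h k \<omega> \<partial>M) * (\<integral>\<omega>. \<bar>step k \<omega>\<bar> ^ 3 \<partial>M)"
        using integral_mult_step[OF weightD(1)[OF h, of k], of "\<lambda>x. \<bar>x\<bar> ^ 3"] h by simp
      have "(\<integral>\<omega>. h k \<omega> * D (Suc k) \<omega> ^ 3 \<partial>M)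
          \<le> (\<integral>\<omega>. h k \<omega> * D k \<omega> ^ 3 + 3 * (h k \<omega> * (D k \<omega>)\<^sup>2 * step k \<omega>)
            + 3 * (h k \<omega> * D k \<omega> * (step k \<omega>)\<^sup>2) + h k \<omega> * \<bar>step k \<omega>\<bar> ^ 3 \<partial>M)"
      proof (rule integral_mono_AE)
        show "AE \<omega> in M. h k \<omega> * D (Suc k) \<omega> ^ 3 \<le> h k \<omega> * D k \<omega> ^ 3 + 3 * (h k \<omega> * (D k \<omega>)\<^sup>2 * step k \<omega>)
            + 3 * (h k \<omega> * D k \<omega> * (step k \<omega>)\<^sup>2) + h k \<omega> * \<bar>step k \<omega>\<bar> ^ 3"
        proof (rule AE_I2)
          fix \<omega> assume \<omega>: "\<omega> \<in> space M"
          have "D (Suc k) \<omega> ^ 3 \<le> D k \<omega> ^ 3 + 3 * (D k \<omega>)\<^sup>2 * step k \<omega> + 3 * D k \<omega> * (step k \<omega>)\<^sup>2 + \<bar>step k \<omega>\<bar> ^ 3"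
            using cube_max_le[OF D_nonneg[of k \<omega>], of "step k \<omega>"] by (simp add: D_Suc step_def add_diff_eq)
          from mult_left_mono[OF this weightD(4)[OF h \<omega>, of k]]
          show "h k \<omega> * D (Suc k) \<omega> ^ 3 \<le> h k \<omega> * D k \<omega> ^ 3 + 3 * (h k \<omega> * (D k \<omega>)\<^sup>2 * step k \<omega>)
            + 3 * (h k \<omega> * D k \<omega> * (step k \<omega>)\<^sup>2) + h k \<omega> * \<bar>step k \<omega>\<bar> ^ 3"
            by (simp add: algebra_simps)
        qed
      qed (use i1 i2 in simp_all)
      also have "\<dots> = (\<integral>\<omega>. h k \<omega> * D k \<omega> ^ 3 \<partial>M) + 3 * ((\<integral>\<omega>. h k \<omega> * (D k \<omega>)\<^sup>2 \<partial>M) * (m1 - 1 / l))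
          + 3 * ((\<integral>\<omega>. h k \<omega> * D k \<omega> \<partial>M) * v) + (\<integral>\<omega>. h k \<omega> \<partial>M) * (\<integral>\<omega>. \<bar>step k \<omega>\<bar> ^ 3 \<partial>M)"
        using i1 i2 by (simp add: i3)
      also have "\<dots> \<le> (\<integral>\<omega>. h k \<omega> * D k \<omega> ^ 3 \<partial>M) + 0 + 3 * ((\<integral>\<omega>. h k \<omega> * D k \<omega> \<partial>M) * v) + (\<integral>\<omega>. h k \<omega> \<partial>M) * c3"
      proof -
        have "(\<integral>\<omega>. h k \<omega> * (D k \<omega>)\<^sup>2 \<partial>M) * (m1 - 1 / l) \<le> 0"
          using m1 weightD(4)[OF h] by (intro mult_nonneg_nonpos integral_nonneg_AE AE_I2 mult_nonneg_nonneg) auto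
        moreover have "(\<integral>\<omega>. h k \<omega> \<partial>M) * (\<integral>\<omega>. \<bar>step k \<omega>\<bar> ^ 3 \<partial>M) \<le> (\<integral>\<omega>. h k \<omega> \<partial>M) * c3"
          using weightD(4)[OF h] step3_le by (intro mult_left_mono integral_nonneg_AE) auto
        ultimately show ?thesis by simp
      qed
      finally show ?thesis by (simp add: algebra_simps)
    qed
    then have "(\<integral>\<omega>. stopped h (\<lambda>x. x ^ 3) n \<omega> \<partial>M)
        \<le> (\<Sum>k<n. 3 * v * (\<integral>\<omega>. h k \<omega> * D k \<omega> \<partial>M) + c3 * (\<integral>\<omega>. h k \<omega> \<partial>M))"
      by (subst integral_stopped[OF h]) (auto intro!: sum_mono)
    also have "\<dots> = 3 * v * total h n + c3 * count h n"
      by (simp add: total_def count_def sum.distrib sum_distrib_left)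
    also have "\<dots> \<le> 3 * v * (mean_delay * count h n) + c3 * count h n"
      using mult_left_mono[OF total_le[OF h m1, of n], of "3 * v"] v_nonneg by simp
    finally show ?thesis by (simp add: c_def algebra_simps)
  qed
  have c3_nonneg: "0 \<le> c3" unfolding c3_def using K0 l_pos by simp
  have c_nonneg: "0 \<le> c" unfolding c_def using v_nonneg mean_delay_nonneg[OF m1] c3_nonneg by simp
  define \<delta> where "\<delta> = 2 * (1 / l - m1)"
  have \<delta>: "0 < \<delta>" using m1 by (simp add: \<delta>_def)
  \<comment> \<open>Small enough for the cubic part, \<eta> c times \<open>count\<close>, to stay
    below \<delta> e times \<open>count\<close>.\<close>
  define \<eta> where "\<eta> = \<delta> * e / (c + 1)"
  have \<eta>: "0 < \<eta>" using \<delta> e c_nonneg by (simp add: \<eta>_def)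
  define C where "C = (1 + 2 / l) * ((1 + 2 / l) / \<eta>)\<^sup>2 + 2 / l"
  have C: "0 \<le> C" using l_pos by (simp add: C_def)
  have "(mean_delay - e) * count h n - C / \<delta> \<le> total h n" if h: "weight h" for h n
  proof -
    have int: "integrable M (stopped h (\<lambda>x. x\<^sup>2 + 2 / l * x) n)" "integrable M (stopped h (\<lambda>x. x ^ 3) n)"
      using h D_cube by (auto intro!: stopped_integrable)
    have "(\<integral>\<omega>. stopped h (\<lambda>x. x\<^sup>2 + 2 / l * x) n \<omega> \<partial>M) \<le> (\<integral>\<omega>. \<eta> * stopped h (\<lambda>x. x ^ 3) n \<omega> + C \<partial>M)"
      using int l_pos \<eta> C
      by (intro integral_mono_AE AE_I2 stopped_le[OF h] linear_plus_square_le_cube[of \<eta> "2 / l", folded C_def]) auto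
    also have "\<dots> = \<eta> * (\<integral>\<omega>. stopped h (\<lambda>x. x ^ 3) n \<omega> \<partial>M) + C"
      using int by (simp add: prob_space)
    also have "\<dots> \<le> \<eta> * (c * count h n) + C"
      using cubic[OF h] \<eta> by (intro add_right_mono mult_left_mono) auto
    also have "\<dots> \<le> \<delta> * e * count h n + C"
    proof -
      have "\<eta> * c \<le> \<delta> * e" using \<delta> e c_nonneg by (simp add: \<eta>_def field_simps)
      from mult_right_mono[OF this count_nonneg[OF h, of n]] show ?thesis by (simp add: algebra_simps)
    qed
    finally have "(mean_delay * count h n - total h n) * \<delta> \<le> \<delta> * e * count h n + C"
      using \<delta> unfolding total_ge_stopped[OF h m1, of n] \<delta>_def[symmetric] by simp
    then show ?thesis using \<delta> by (simp add: field_simps)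
  qed
  then show ?thesis by blast
qed

end

section \<open>Stopping indices read off the arrival epochs, and their extension to the next empty
  system\<close>

definition clock :: "(nat \<Rightarrow> 'a \<Rightarrow> real) \<Rightarrow> (nat \<Rightarrow> real \<Rightarrow> bool) \<Rightarrow> nat \<Rightarrow> 'a \<Rightarrow> real" where
  "clock g P k \<omega> = (if P k (\<Sum>j\<le>k. g j \<omega>) then 1 else 0)"

text \<open>The second condition makes \<open>clock g P\<close> nonincreasing along increasing
  epochs. Both a fixed number of customers and the customers arriving by a time t are of this form.
  Clocks do not involve the durations, so one weight serves the original and the truncated queue
  alike.\<close>

definition clock_pred :: "(nat \<Rightarrow> real \<Rightarrow> bool) \<Rightarrow> bool" where
  "clock_pred P \<longleftrightarrow> (\<forall>k. {x. P k x} \<in> sets borel \<and> (\<forall>x y. x \<le> y \<longrightarrow> P (Suc k) y \<longrightarrow> P k x))"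

context single_server
begin

lemma weight_clock:
  assumes "clock_pred P"
  shows "weight (clock G P)"
  unfolding weight_def
proof (intro allI conjI ballI)
  fix k
  have [measurable]: "Measurable.pred borel (P k)" using assms by (auto simp: clock_pred_def pred_def)
  have [measurable]: "(\<lambda>\<omega>. \<Sum>j\<le>k. G j \<omega>) \<in> borel_measurable (past k)"
    by (rule borel_measurable_sum) (auto intro: G_past)
  show "clock G P k \<in> borel_measurable (past k)" unfolding clock_def[abs_def] by measurable
  fix \<omega> assume \<omega>: "\<omega> \<in> space M"
  have "(\<Sum>j\<le>k. G j \<omega>) \<le> (\<Sum>j\<le>Suc k. G j \<omega>)" using G_pos[OF \<omega>, of "Suc k"] by simp
  then have "P (Suc k) (\<Sum>j\<le>Suc k. G j \<omega>) \<Longrightarrow> P k (\<Sum>j\<le>k. G j \<omega>)"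
    using assms unfolding clock_pred_def by blast
  then show "clock G P (Suc k) \<omega> \<le> clock G P k \<omega>" unfolding clock_def by auto
qed (auto simp: clock_def)

definition empty :: "nat \<Rightarrow> 'a \<Rightarrow> bool" where
  "empty k \<omega> \<longleftrightarrow> k = 0 \<or> load (k - 1) \<omega> < G k \<omega>"

text \<open>If f stands for the stopping index \<tau>, this stands for the first index at or after
  \<tau> whose arrival finds the system empty.\<close>

definition busy :: "(nat \<Rightarrow> 'a \<Rightarrow> real) \<Rightarrow> nat \<Rightarrow> 'a \<Rightarrow> real" where
  "busy f k \<omega> = (if \<exists>j\<le>k. f j \<omega> = 0 \<and> empty j \<omega> then 0 else 1)"

lemma idle_empty: "idle k \<omega> = (if empty (Suc k) \<omega> then 1 else 0)"
  by (simp add: idle_def empty_def)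

lemma empty_past: "Measurable.pred (past k) (empty k)"
proof (cases k)
  case 0
  then show ?thesis by (simp add: empty_def[abs_def])
next
  case (Suc i)
  have [measurable]: "load i \<in> borel_measurable (past (Suc i))" "G (Suc i) \<in> borel_measurable (past (Suc i))"
    using past'_past[OF load_past'[of i]] G_past[of "Suc i" "Suc i"] by auto
  have "Measurable.pred (past (Suc i)) (\<lambda>\<omega>. load i \<omega> < G (Suc i) \<omega>)" by measurable
  then show ?thesis using Suc unfolding empty_def[abs_def] by simp
qed

lemma weight_busy:
  assumes "weight f"
  shows "weight (busy f)"
  unfolding weight_def
proof (intro allI conjI ballI)
  fix k
  have "Measurable.pred (past k) (\<lambda>\<omega>. f j \<omega> = 0 \<and> empty j \<omega>)" if "j \<le> k" for j
  proof -
    have 1: "f j \<in> borel_measurable (past k)" and 2: "Measurable.pred (past k) (empty j)"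
      using past_le[OF weightD(1)[OF assms, of j] that] past_le[OF empty_past[of j] that] by auto
    have "Measurable.pred (past k) (\<lambda>\<omega>. f j \<omega> = 0)" using 1 by measurable
    then show ?thesis using 2 by (rule pred_intros_logic)
  qed
  then have "{\<omega> \<in> space (past k). \<exists>j\<in>{..k}. f j \<omega> = 0 \<and> empty j \<omega>} \<in> sets (past k)"
    by (intro sets.sets_Collect_finite_Ex) (auto simp: pred_def)
  then have "{\<omega> \<in> space (past k). \<exists>j\<le>k. f j \<omega> = 0 \<and> empty j \<omega>} \<in> sets (past k)"
    by (simp only: Bex_def atMost_iff)
  then show "busy f k \<in> borel_measurable (past k)"
    unfolding busy_def[abs_def] by (rule measurable_If[OF measurable_const measurable_const, rotated 2]) auto
  fix \<omega>
  show "busy f (Suc k) \<omega> \<le> busy f k \<omega>" by (auto simp: busy_def intro: le_SucI)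
qed (auto simp: busy_def)

lemma weight_antimono: "weight f \<Longrightarrow> \<omega> \<in> space M \<Longrightarrow> j \<le> k \<Longrightarrow> f k \<omega> \<le> f j \<omega>"
  using lift_Suc_antimono_le[of "\<lambda>k. f k \<omega>" j k] weightD(3) by blast

lemma busy_ge:
  assumes "weight f" "\<omega> \<in> space M"
  shows "f k \<omega> \<le> busy f k \<omega>"
  using weight_antimono[OF assms, of _ k] weightD(5)[OF assms, of k] by (fastforce simp: busy_def)

text \<open>Once f has stopped, an idle step leads to an arrival that finds the system empty and
  thereby ends \<open>busy f\<close>. The right-hand side telescopes, so at most one idle step lies
  in the extension.\<close>

lemma busy_idle_le:
  assumes "weight f" "\<omega> \<in> space M"
  shows "(busy f k \<omega> - f k \<omega>) * idle k \<omega> \<le> busy f k \<omega> - busy f (Suc k) \<omega>"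
proof (cases "busy f k \<omega> = 1 \<and> f k \<omega> = 0 \<and> empty (Suc k) \<omega>")
  case True
  then have "f (Suc k) \<omega> = 0" using weightD(3,4)[OF assms, of k] weightD(4)[OF assms, of "Suc k"] by simp
  then have "busy f (Suc k) \<omega> = 0" using True by (auto simp: busy_def)
  then show ?thesis using True by (simp add: idle_empty)
next
  case False
  then have "(busy f k \<omega> - f k \<omega>) * idle k \<omega> = 0"
    using weightD(2)[OF assms, of k] busy_ge[OF assms, of k] weightD(2)[OF weight_busy[OF assms(1)] assms(2), of k]
    by (auto simp: idle_empty)
  then show ?thesis using weightD(3)[OF weight_busy[OF assms(1)] assms(2), of k] by linarith
qed

end

context single_server_L2
begin

lemma idle_integrable [simp]: "integrable M (idle k)"
  by (rule integrable_const_bound[of _ 1]) (auto simp: idle_empty)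

lemma sum_nn_integral_total:
  assumes h: "weight h"
  shows "(\<Sum>k<n. \<integral>\<^sup>+ \<omega>. ennreal (h k \<omega> * D k \<omega>) \<partial>M) = ennreal (total h n)"
proof -
  have nn: "0 \<le> h k \<omega> * D k \<omega>" if "\<omega> \<in> space M" for k \<omega> using weightD(4)[OF h that] D_nonneg by simp
  then have "(\<integral>\<^sup>+ \<omega>. ennreal (h k \<omega> * D k \<omega>) \<partial>M) = ennreal (\<integral>\<omega>. h k \<omega> * D k \<omega> \<partial>M)" for k
    by (intro nn_integral_eq_integral integrable_weight[OF h] AE_I2) auto
  then show ?thesis
    unfolding total_def using nn by (simp add: sum_ennreal integral_nonneg_AE AE_I2)
qed

lemma sum_nn_integral_count:
  assumes h: "weight h"
  shows "(\<Sum>k<n. \<integral>\<^sup>+ \<omega>. ennreal (h k \<omega>) \<partial>M) = ennreal (count h n)"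
proof -
  have "(\<integral>\<^sup>+ \<omega>. ennreal (h k \<omega>) \<partial>M) = ennreal (\<integral>\<omega>. h k \<omega> \<partial>M)" for k
    using weightD(4)[OF h] h by (intro nn_integral_eq_integral AE_I2) auto
  then show ?thesis
    unfolding count_def using weightD(4)[OF h] by (simp add: sum_ennreal integral_nonneg_AE AE_I2)
qed

text \<open>\<open>stopped_linear\<close> bounds the length of the extended index by its idle steps.
  At most one of them lies in the extension; the others are turned back, by
  \<open>stopped_linear\<close> for f, into \<open>count f\<close> plus the unfinished work when f
  stops, which \<open>stopped_linear_le\<close> controls.\<close>

lemma count_busy_le:
  assumes f: "weight f" and m1: "m1 < 1 / l" and e: "0 < e"
  shows "count (busy f) n \<le> (1 + e * m2 / (1 / l - m1)) * count f n + (1 / e + 1 / l) / (1 / l - m1)"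
proof -
  define \<delta> where "\<delta> = 1 / l - m1"
  have \<delta>: "0 < \<delta>" using m1 by (simp add: \<delta>_def)
  note h = weight_busy[OF f]
  note [simp] = integrable_weight[OF f] integrable_weight[OF h]
  have "(\<Sum>k<n. \<integral>\<omega>. busy f k \<omega> * idle k \<omega> \<partial>M) - (\<Sum>k<n. \<integral>\<omega>. f k \<omega> * idle k \<omega> \<partial>M)
      = (\<integral>\<omega>. (\<Sum>k<n. (busy f k \<omega> - f k \<omega>) * idle k \<omega>) \<partial>M)"
    by (simp add: left_diff_distrib sum_subtractf)
  also have "\<dots> \<le> (\<integral>\<omega>. 1 \<partial>M)"
  proof (intro integral_mono_AE AE_I2)
    fix \<omega> assume \<omega>: "\<omega> \<in> space M"
    have "(\<Sum>k<n. (busy f k \<omega> - f k \<omega>) * idle k \<omega>) \<le> (\<Sum>k<n. busy f k \<omega> - busy f (Suc k) \<omega>)"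
      using busy_idle_le[OF f \<omega>] by (rule sum_mono)
    also have "\<dots> = busy f 0 \<omega> - busy f n \<omega>" by (rule sum_lessThan_telescope')
    also have "\<dots> \<le> 1" using weightD(4)[OF h \<omega>, of n] weightD(5)[OF h \<omega>, of 0] by simp
    finally show "(\<Sum>k<n. (busy f k \<omega> - f k \<omega>) * idle k \<omega>) \<le> 1" .
  qed (auto simp: left_diff_distrib)
  finally have i: "(\<Sum>k<n. \<integral>\<omega>. busy f k \<omega> * idle k \<omega> \<partial>M) \<le> (\<Sum>k<n. \<integral>\<omega>. f k \<omega> * idle k \<omega> \<partial>M) + 1"
    by (simp add: prob_space)
  have "0 \<le> (\<integral>\<omega>. stopped (busy f) (\<lambda>x. x) n \<omega> \<partial>M)"
    by (intro integral_nonneg_AE AE_I2 stopped_nonneg[OF h]) auto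
  then have "\<delta> * count (busy f) n \<le> 1 / l * (\<Sum>k<n. \<integral>\<omega>. busy f k \<omega> * idle k \<omega> \<partial>M)"
    unfolding stopped_linear[OF h] \<delta>_def by simp
  also have "\<dots> \<le> 1 / l * ((\<Sum>k<n. \<integral>\<omega>. f k \<omega> * idle k \<omega> \<partial>M) + 1)"
    using i l_pos by (intro mult_left_mono) auto
  also have "\<dots> = (\<integral>\<omega>. stopped f (\<lambda>x. x) n \<omega> \<partial>M) + \<delta> * count f n + 1 / l"
    unfolding stopped_linear[OF f] \<delta>_def by (simp add: algebra_simps)
  also have "\<dots> \<le> (e * m2 * count f n + 1 / e) + \<delta> * count f n + 1 / l"
    using stopped_linear_le[OF f m1 e] by simp
  finally have "\<delta> * count (busy f) n \<le> \<delta> * ((1 + e * m2 / \<delta>) * count f n + (1 / e + 1 / l) / \<delta>)"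
  proof -
    have "\<delta> * ((1 + e * m2 / \<delta>) * c + b / \<delta>) = \<delta> * c + e * m2 * c + b" for b c
      using \<delta> by (simp add: field_simps)
    moreover assume "\<delta> * count (busy f) n \<le> (e * m2 * count f n + 1 / e) + \<delta> * count f n + 1 / l"
    ultimately show ?thesis by simp
  qed
  then show ?thesis using \<delta> unfolding \<delta>_def[symmetric] by (simp only: mult_le_cancel_left_pos)
qed

lemma busy_total_le:
  assumes f: "weight f" and m1: "m1 < 1 / l" and e: "0 < e" and \<nu>: "\<And>n. count f n \<le> \<nu>"
  shows "(\<Sum>k. \<integral>\<^sup>+ \<omega>. ennreal (busy f k \<omega> * D k \<omega>) \<partial>M)
    \<le> ennreal (mean_delay * ((1 + e * m2 / (1 / l - m1)) * \<nu> + (1 / e + 1 / l) / (1 / l - m1)))"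
proof (rule suminf_le_const)
  fix n
  note h = weight_busy[OF f]
  have "(\<Sum>k<n. \<integral>\<^sup>+ \<omega>. ennreal (busy f k \<omega> * D k \<omega>) \<partial>M) = ennreal (total (busy f) n)"
    using h by (rule sum_nn_integral_total)
  also have "total (busy f) n \<le> mean_delay * ((1 + e * m2 / (1 / l - m1)) * \<nu> + (1 / e + 1 / l) / (1 / l - m1))"
  proof -
    have "(1 + e * m2 / (1 / l - m1)) * count f n \<le> (1 + e * m2 / (1 / l - m1)) * \<nu>"
      using \<nu> e m1 m2_nonneg by (intro mult_left_mono) auto
    with count_busy_le[OF f m1 e, of n]
    have "count (busy f) n \<le> (1 + e * m2 / (1 / l - m1)) * \<nu> + (1 / e + 1 / l) / (1 / l - m1)" by linarith
    from mult_left_mono[OF this mean_delay_nonneg[OF m1]] total_le[OF h m1, of n] show ?thesis by linarith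
  qed
  finally show "(\<Sum>k<n. \<integral>\<^sup>+ \<omega>. ennreal (busy f k \<omega> * D k \<omega>) \<partial>M)
    \<le> ennreal (mean_delay * ((1 + e * m2 / (1 / l - m1)) * \<nu> + (1 / e + 1 / l) / (1 / l - m1)))"
    by (simp add: ennreal_leI)
qed simp

text \<open>The extended index has a finite expectation, hence is finite almost surely.\<close>

lemma AE_empty:
  assumes f: "weight f" and m1: "m1 < 1 / l" and \<nu>: "\<And>n. count f n \<le> \<nu>"
  shows "AE \<omega> in M. \<exists>m. f m \<omega> = 0 \<and> empty m \<omega>"
proof -
  note h = weight_busy[OF f]
  have [measurable]: "busy f k \<in> borel_measurable M" for k using weightD(6)[OF h] .
  have "(\<Sum>k. \<integral>\<^sup>+ \<omega>. ennreal (busy f k \<omega>) \<partial>M) \<le> ennreal ((1 + 1 * m2 / (1 / l - m1)) * \<nu> + (1 / 1 + 1 / l) / (1 / l - m1))"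
  proof (rule suminf_le_const)
    fix n
    have "(\<Sum>k<n. \<integral>\<^sup>+ \<omega>. ennreal (busy f k \<omega>) \<partial>M) = ennreal (count (busy f) n)"
      using h by (rule sum_nn_integral_count)
    also have "(1 + 1 * m2 / (1 / l - m1)) * count f n \<le> (1 + 1 * m2 / (1 / l - m1)) * \<nu>"
      using \<nu> m1 m2_nonneg by (intro mult_left_mono) auto
    with count_busy_le[OF f m1, of 1 n]
    have "ennreal (count (busy f) n) \<le> ennreal ((1 + 1 * m2 / (1 / l - m1)) * \<nu> + (1 / 1 + 1 / l) / (1 / l - m1))"
      by (intro ennreal_leI) linarith
    finally show "(\<Sum>k<n. \<integral>\<^sup>+ \<omega>. ennreal (busy f k \<omega>) \<partial>M) \<le> ennreal ((1 + 1 * m2 / (1 / l - m1)) * \<nu> + (1 / 1 + 1 / l) / (1 / l - m1))" .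
  qed simp
  also have "\<dots> < \<infinity>" by simp
  finally have "(\<integral>\<^sup>+ \<omega>. (\<Sum>k. ennreal (busy f k \<omega>)) \<partial>M) \<noteq> \<infinity>"
    by (subst nn_integral_suminf) (auto simp: less_top)
  then have "AE \<omega> in M. (\<Sum>k. ennreal (busy f k \<omega>)) \<noteq> \<infinity>"
    by (intro nn_integral_noteq_infinite) auto
  then show ?thesis
  proof eventually_elim
    case (elim \<omega>)
    show ?case
    proof (rule ccontr)
      assume "\<not> ?case"
      then have "busy f k \<omega> = 1" for k unfolding busy_def by metis
      moreover have "summable (\<lambda>k. busy f k \<omega>)"
      proof (rule summable_suminf_not_top)
        show "0 \<le> busy f k \<omega>" for k by (simp add: busy_def)
        show "(\<Sum>k. ennreal (busy f k \<omega>)) \<noteq> top" using elim by (simp only: infinity_ennreal_def not_False_eq_True)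
      qed
      ultimately show False by (simp add: summable_const_iff)
    qed
  qed
qed

end

section \<open>Truncated durations, and moments deduced from a finite mean waiting time\<close>

context single_server
begin

lemma single_server_compose:
  assumes [measurable]: "g \<in> borel_measurable borel" and g_nonneg: "\<And>x. 0 \<le> x \<Longrightarrow> 0 \<le> g x"
  shows "single_server M l G (\<lambda>i \<omega>. g (T i \<omega>))"
proof
  have "indep_vars (\<lambda>_. borel) (\<lambda>i \<omega>. case_sum (\<lambda>_ x. x) (\<lambda>_. g) i (case_sum G T i \<omega>)) UNIV"
    by (rule indep_vars_compose2[OF indep_GT]) (auto split: sum.split)
  moreover have "(\<lambda>i \<omega>. case_sum (\<lambda>_ x. x) (\<lambda>_. g) i (case_sum G T i \<omega>)) = case_sum G (\<lambda>i \<omega>. g (T i \<omega>))"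
    by (auto simp: fun_eq_iff split: sum.split)
  ultimately show "indep_vars (\<lambda>_. borel) (case_sum G (\<lambda>i \<omega>. g (T i \<omega>))) UNIV" by simp
  show "distr M borel (\<lambda>\<omega>. g (T i \<omega>)) = distr M borel (\<lambda>\<omega>. g (T 0 \<omega>))" for i
    using arg_cong[OF T_identical[of i], of "\<lambda>N. distr N borel g"] by (simp add: distr_distr comp_def)
qed (use l_pos G_exponential G_pos T_nonneg g_nonneg in auto)

text \<open>The cap K makes the cubic argument available; the factor \<theta> adjusts the load, and
  is 1 except when the load is to be brought just below 1.\<close>

definition cut :: "real \<Rightarrow> real \<Rightarrow> real \<Rightarrow> real" where "cut \<theta> K x = \<theta> * min x K"

lemma cut_bounds:
  assumes "0 \<le> \<theta>" "\<theta> \<le> 1" "0 \<le> K" "0 \<le> x"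
  shows "0 \<le> cut \<theta> K x" "cut \<theta> K x \<le> x" "cut \<theta> K x \<le> K"
proof -
  have "\<theta> * min x K \<le> 1 * min x K" using assms by (intro mult_right_mono) auto
  then show "0 \<le> cut \<theta> K x" "cut \<theta> K x \<le> x" "cut \<theta> K x \<le> K" using assms by (auto simp: cut_def)
qed

lemma cut_measurable [measurable]: "cut \<theta> K \<in> borel_measurable borel"
  unfolding cut_def[abs_def] by measurable

lemma single_server_cut:
  assumes "0 \<le> \<theta>" "\<theta> \<le> 1" "0 \<le> K"
  shows "single_server_L2 M l G (\<lambda>i \<omega>. cut \<theta> K (T i \<omega>))"
proof -
  interpret c: single_server M l G "\<lambda>i \<omega>. cut \<theta> K (T i \<omega>)"
    using cut_bounds[OF assms] by (intro single_server_compose) auto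
  show ?thesis
  proof
    show "integrable M (\<lambda>\<omega>. (cut \<theta> K (T 0 \<omega>))\<^sup>2)"
    proof (rule integrable_const_bound[of _ "K\<^sup>2"])
      show "AE \<omega> in M. norm ((cut \<theta> K (T 0 \<omega>))\<^sup>2) \<le> K\<^sup>2"
      proof (rule AE_I2)
        fix \<omega> assume "\<omega> \<in> space M"
        then show "norm ((cut \<theta> K (T 0 \<omega>))\<^sup>2) \<le> K\<^sup>2"
          using cut_bounds[OF assms T_nonneg[of \<omega> 0]] by (auto intro!: power_mono)
      qed
    qed simp
  qed
qed

text \<open>Shorter durations give a smaller recursion (\<open>lindley_mono\<close>), and clock
  weights are unaffected by the truncation. No moment of the original durations is assumed.\<close>

lemma cut_lower_bound:
  assumes \<theta>: "0 \<le> \<theta>" "\<theta> \<le> 1" "0 \<le> K" and m1: "(\<integral>\<omega>. cut \<theta> K (T 0 \<omega>) \<partial>M) < 1 / l" and e: "0 < e"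
  defines "p \<equiv> (\<integral>\<omega>. (cut \<theta> K (T 0 \<omega>))\<^sup>2 \<partial>M) / (2 * (1 / l - (\<integral>\<omega>. cut \<theta> K (T 0 \<omega>) \<partial>M)))"
  shows "\<exists>C. \<forall>P n. clock_pred P \<longrightarrow>
    ennreal ((p - e) * (\<Sum>k<n. \<integral>\<omega>. clock G P k \<omega> \<partial>M) - C) \<le> (\<Sum>k<n. \<integral>\<^sup>+ \<omega>. ennreal (clock G P k \<omega> * D k \<omega>) \<partial>M)"
proof -
  interpret c: single_server_L2 M l G "\<lambda>i \<omega>. cut \<theta> K (T i \<omega>)"
    using \<theta> by (rule single_server_cut)
  have p: "c.mean_delay = p" unfolding c.mean_delay_def c.m1_def c.m2_def p_def ..
  obtain C where C: "\<And>h n. c.weight h \<Longrightarrow> (p - e) * c.count h n - C \<le> c.total h n"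
    using c.total_ge_bounded[of K e] cut_bounds[OF \<theta> T_nonneg] m1 e unfolding p c.m1_def by blast
  have le: "c.D k \<omega> \<le> D k \<omega>" if "\<omega> \<in> space M" for k \<omega>
    unfolding D_def c.D_def using cut_bounds(2)[OF \<theta> T_nonneg[OF that]] by (intro lindley_mono) auto
  have "ennreal ((p - e) * c.count (clock G P) n - C) \<le> (\<Sum>k<n. \<integral>\<^sup>+ \<omega>. ennreal (clock G P k \<omega> * D k \<omega>) \<partial>M)"
    if P: "clock_pred P" for P n
  proof -
    note w = c.weight_clock[OF P]
    have "ennreal ((p - e) * c.count (clock G P) n - C) \<le> ennreal (c.total (clock G P) n)"
      using C[OF w] by (intro ennreal_leI)
    also have "\<dots> = (\<Sum>k<n. \<integral>\<^sup>+ \<omega>. ennreal (clock G P k \<omega> * c.D k \<omega>) \<partial>M)"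
      by (rule c.sum_nn_integral_total[OF w, symmetric])
    also have "\<dots> \<le> (\<Sum>k<n. \<integral>\<^sup>+ \<omega>. ennreal (clock G P k \<omega> * D k \<omega>) \<partial>M)"
      using le by (intro sum_mono nn_integral_mono ennreal_leI mult_left_mono) (auto simp: clock_def)
    finally show ?thesis .
  qed
  then show ?thesis unfolding c.count_def by blast
qed

lemma clock_pred_less: "clock_pred (\<lambda>k _. k < n)"
  unfolding clock_pred_def by auto

lemma clock_pred_le: "clock_pred (\<lambda>_ x. x \<le> t)"
  unfolding clock_pred_def by auto

text \<open>Every truncated queue with load below 1 has a Pollaczek-Khinchine mean of at most B,
  since its waiting times are below the original ones. The denominator is multiplied out.\<close>

lemma mean_waiting_bound:
  assumes \<theta>: "0 \<le> \<theta>" "\<theta> \<le> 1" "0 \<le> K" and m1: "(\<integral>\<omega>. cut \<theta> K (T 0 \<omega>) \<partial>M) < 1 / l"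
    and B: "\<And>n. N \<le> n \<Longrightarrow> (\<Sum>k<n. \<integral>\<^sup>+ \<omega>. ennreal (D k \<omega>) \<partial>M) \<le> ennreal (B * real n)" "0 \<le> B"
  shows "(\<integral>\<omega>. (cut \<theta> K (T 0 \<omega>))\<^sup>2 \<partial>M) \<le> 2 * B * (1 / l - (\<integral>\<omega>. cut \<theta> K (T 0 \<omega>) \<partial>M))"
proof -
  define p where "p = (\<integral>\<omega>. (cut \<theta> K (T 0 \<omega>))\<^sup>2 \<partial>M) / (2 * (1 / l - (\<integral>\<omega>. cut \<theta> K (T 0 \<omega>) \<partial>M)))"
  have "p \<le> B + e" if e: "0 < e" for e
  proof -
    obtain C where C: "\<And>P n. clock_pred P \<Longrightarrow>
        ennreal ((p - e / 2) * (\<Sum>k<n. \<integral>\<omega>. clock G P k \<omega> \<partial>M) - C) \<le> (\<Sum>k<n. \<integral>\<^sup>+ \<omega>. ennreal (clock G P k \<omega> * D k \<omega>) \<partial>M)"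
      using cut_lower_bound[OF \<theta> m1, of "e / 2"] e unfolding p_def by auto
    have bound: "(p - e / 2) * real n - C \<le> B * real n" if "N \<le> n" for n
    proof -
      have c1: "clock G (\<lambda>k _. k < n) k = (\<lambda>_. 1)" if "k < n" for k using that by (auto simp: clock_def)
      have "ennreal ((p - e / 2) * real n - C) \<le> (\<Sum>k<n. \<integral>\<^sup>+ \<omega>. ennreal (D k \<omega>) \<partial>M)"
        using C[OF clock_pred_less[of n], of n] by (simp add: c1 prob_space)
      also have "\<dots> \<le> ennreal (B * real n)" by (rule B(1)[OF that])
      finally show ?thesis using B(2) by (simp add: ennreal_le_iff)
    qed
    show ?thesis
    proof (rule ccontr)
      assume "\<not> ?thesis"
      then have gap: "e / 2 \<le> p - e / 2 - B" by simp
      obtain n :: nat where n: "2 * (\<bar>C\<bar> + 1) / e < real n" using reals_Archimedean2 by blast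
      define k where "k = max n N"
      have "2 * (\<bar>C\<bar> + 1) / e < real k" using n by (simp add: k_def)
      then have "\<bar>C\<bar> + 1 < e / 2 * real k" using e by (simp add: field_simps)
      also have "\<dots> \<le> (p - e / 2 - B) * real k" using gap by (intro mult_right_mono) auto
      also have "\<dots> \<le> C" using bound[of k] by (simp add: k_def algebra_simps)
      finally show False by simp
    qed
  qed
  then have "p \<le> B" by (rule field_le_epsilon)
  then show ?thesis using m1 unfolding p_def by (simp add: field_simps)
qed

lemma SUP_cut:
  fixes g :: "real \<Rightarrow> real"
  assumes "mono_on {0..} g" "g \<in> borel_measurable borel"
  shows "(SUP K. \<integral>\<^sup>+ \<omega>. ennreal (g (cut 1 (real K) (T 0 \<omega>))) \<partial>M) = (\<integral>\<^sup>+ \<omega>. ennreal (g (T 0 \<omega>)) \<partial>M)"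
proof -
  have nn: "0 \<le> cut 1 (real K) (T 0 \<omega>)" if "\<omega> \<in> space M" for K \<omega>
    using T_nonneg[OF that] by (simp add: cut_def)
  have "(\<integral>\<^sup>+ \<omega>. ennreal (g (T 0 \<omega>)) \<partial>M) = (\<integral>\<^sup>+ \<omega>. (SUP K. ennreal (g (cut 1 (real K) (T 0 \<omega>)))) \<partial>M)"
  proof (rule nn_integral_cong)
    fix \<omega> assume \<omega>: "\<omega> \<in> space M"
    obtain N :: nat where N: "T 0 \<omega> \<le> real N" using real_arch_simple by blast
    show "ennreal (g (T 0 \<omega>)) = (SUP K. ennreal (g (cut 1 (real K) (T 0 \<omega>))))"
    proof (rule antisym)
      show "ennreal (g (T 0 \<omega>)) \<le> (SUP K. ennreal (g (cut 1 (real K) (T 0 \<omega>))))"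
        using N by (intro SUP_upper2[of N]) (auto simp: cut_def)
      show "(SUP K. ennreal (g (cut 1 (real K) (T 0 \<omega>)))) \<le> ennreal (g (T 0 \<omega>))"
        using nn[OF \<omega>] T_nonneg[OF \<omega>, of 0]
        by (intro SUP_least ennreal_leI mono_onD[OF assms(1)]) (auto simp: cut_def)
    qed
  qed
  also have "\<dots> = (SUP K. \<integral>\<^sup>+ \<omega>. ennreal (g (cut 1 (real K) (T 0 \<omega>))) \<partial>M)"
  proof (rule nn_integral_monotone_convergence_SUP_AE)
    show "AE \<omega> in M. ennreal (g (cut 1 (real K) (T 0 \<omega>))) \<le> ennreal (g (cut 1 (real (Suc K)) (T 0 \<omega>)))" for K
    proof (rule AE_I2)
      fix \<omega> assume "\<omega> \<in> space M"
      then show "ennreal (g (cut 1 (real K) (T 0 \<omega>))) \<le> ennreal (g (cut 1 (real (Suc K)) (T 0 \<omega>)))"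
        using nn by (intro ennreal_leI mono_onD[OF assms(1)]) (auto simp: cut_def)
    qed
    have [measurable]: "g \<in> borel_measurable borel" by fact
    show "(\<lambda>\<omega>. ennreal (g (cut 1 (real K) (T 0 \<omega>)))) \<in> borel_measurable M" for K by measurable
  qed
  finally show ?thesis ..
qed

lemma cut_integrable:
  assumes "0 \<le> \<theta>" "\<theta> \<le> 1" "0 \<le> K"
  shows "integrable M (\<lambda>\<omega>. cut \<theta> K (T 0 \<omega>))" "integrable M (\<lambda>\<omega>. (cut \<theta> K (T 0 \<omega>))\<^sup>2)"
proof -
  interpret c: single_server_L2 M l G "\<lambda>i \<omega>. cut \<theta> K (T i \<omega>)"
    using assms by (rule single_server_cut)
  show "integrable M (\<lambda>\<omega>. cut \<theta> K (T 0 \<omega>))" "integrable M (\<lambda>\<omega>. (cut \<theta> K (T 0 \<omega>))\<^sup>2)"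
    using c.T_integrable[of 0] c.T_integrable2[of 0] by auto
qed

lemma nn_integral_cut:
  assumes "0 \<le> K"
  shows "(\<integral>\<^sup>+ \<omega>. ennreal (cut 1 K (T 0 \<omega>)) \<partial>M) = ennreal (\<integral>\<omega>. cut 1 K (T 0 \<omega>) \<partial>M)"
    "(\<integral>\<^sup>+ \<omega>. ennreal ((cut 1 K (T 0 \<omega>))\<^sup>2) \<partial>M) = ennreal (\<integral>\<omega>. (cut 1 K (T 0 \<omega>))\<^sup>2 \<partial>M)"
  using cut_integrable[of 1 K] cut_bounds(1)[of 1 K, OF _ _ _ T_nonneg[of _ 0]] assms
  by (auto intro!: nn_integral_eq_integral AE_I2)

lemma SUP_cut_moments:
  "(SUP K. ennreal (\<integral>\<omega>. cut 1 (real K) (T 0 \<omega>) \<partial>M)) = (\<integral>\<^sup>+ \<omega>. ennreal (T 0 \<omega>) \<partial>M)"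
  "(SUP K. ennreal (\<integral>\<omega>. (cut 1 (real K) (T 0 \<omega>))\<^sup>2 \<partial>M)) = (\<integral>\<^sup>+ \<omega>. ennreal ((T 0 \<omega>)\<^sup>2) \<partial>M)"
  using SUP_cut[of "\<lambda>x. x"] SUP_cut[of "\<lambda>x. x\<^sup>2"]
  by (auto simp: nn_integral_cut mono_on_def power_mono)

text \<open>
  If the load were at least 1, a suitable fraction of truncated service times would have load
  just below 1 and hence an arbitrarily large mean waiting time.
\<close>

lemma load_less_one:
  assumes B: "\<And>n. N \<le> n \<Longrightarrow> (\<Sum>k<n. \<integral>\<^sup>+ \<omega>. ennreal (D k \<omega>) \<partial>M) \<le> ennreal (B * real n)" "0 \<le> B"
  shows "(\<integral>\<^sup>+ \<omega>. ennreal (T 0 \<omega>) \<partial>M) < ennreal (1 / l)"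
proof (rule ccontr)
  assume "\<not> ?thesis"
  then have ge: "ennreal (1 / l) \<le> (\<integral>\<^sup>+ \<omega>. ennreal (T 0 \<omega>) \<partial>M)" by simp
  \<comment> \<open>With this choice r = (1 - e) / l is at least 1 / (2 l), while r^2 \<le> 2 B e /
    l would require 1 \<le> 8 l B e; but 8 l (B + 1) e is at most 1 / 2.\<close>
  define e where "e = min (1 / 2) (1 / (16 * l * (B + 1)))"
  have e: "0 < e" "e \<le> 1 / 2" "e * (16 * l * (B + 1)) \<le> 1"
  proof -
    have q: "0 < 16 * l * (B + 1)" using l_pos B(2) by simp
    show "0 < e" "e \<le> 1 / 2" using q unfolding e_def by auto
    have "e * (16 * l * (B + 1)) \<le> 1 / (16 * l * (B + 1)) * (16 * l * (B + 1))"
      using q unfolding e_def by (intro mult_right_mono) auto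
    also have "\<dots> = 1"
    proof -
      have "1 / x * x = 1" if "0 < x" for x :: real using that by simp
      from this[OF q] show ?thesis .
    qed
    finally show "e * (16 * l * (B + 1)) \<le> 1" .
  qed
  define r where "r = (1 - e) / l"
  have r: "0 < r" "r < 1 / l" using e l_pos by (auto simp: r_def field_simps)
  have "ennreal r < ennreal (1 / l)" using r by (simp add: ennreal_less_iff)
  also have "\<dots> \<le> (SUP K. ennreal (\<integral>\<omega>. cut 1 (real K) (T 0 \<omega>) \<partial>M))" unfolding SUP_cut_moments by (rule ge)
  finally obtain K :: nat where K: "ennreal r < ennreal (\<integral>\<omega>. cut 1 (real K) (T 0 \<omega>) \<partial>M)" by (auto simp: less_SUP_iff)
  define s where "s = (\<integral>\<omega>. cut 1 (real K) (T 0 \<omega>) \<partial>M)"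
  have s: "r < s" using K r by (simp add: s_def ennreal_less_iff)
  \<comment> \<open>The factor r / s gives the truncated durations the mean r exactly.\<close>
  have \<theta>: "0 \<le> r / s" "r / s \<le> 1" "0 \<le> real K" using r s by auto
  have "(\<integral>\<omega>. cut (r / s) (real K) (T 0 \<omega>) \<partial>M) = r / s * s"
    unfolding s_def by (simp add: cut_def)
  then have m: "(\<integral>\<omega>. cut (r / s) (real K) (T 0 \<omega>) \<partial>M) = r" using r s by simp
  \<comment> \<open>The variance is nonnegative, so the second moment cannot vanish as the load
    approaches 1.\<close>
  have "r\<^sup>2 \<le> (\<integral>\<omega>. (cut (r / s) (real K) (T 0 \<omega>))\<^sup>2 \<partial>M)"
  proof -
    have "0 \<le> (\<integral>\<omega>. (cut (r / s) (real K) (T 0 \<omega>) - r)\<^sup>2 \<partial>M)" by (rule integral_nonneg_AE) auto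
    with variance_eq[OF cut_integrable[OF \<theta>], unfolded m] show ?thesis by linarith
  qed
  also have "\<dots> \<le> 2 * B * (1 / l - r)"
    using mean_waiting_bound[OF \<theta> _ B] r by (simp add: m)
  also have "1 / l - r = e / l" by (simp add: r_def diff_divide_distrib)
  finally have "r\<^sup>2 \<le> 2 * B * (e / l)" .
  moreover have "(1 / (2 * l))\<^sup>2 \<le> r\<^sup>2" using e l_pos by (intro power_mono) (auto simp: r_def field_simps)
  ultimately have "(1 / (2 * l))\<^sup>2 \<le> 2 * B * (e / l)" by linarith
  then have "1 \<le> 8 * l * B * e" using l_pos by (simp add: power2_eq_square field_simps)
  also have "8 * l * B * e \<le> e * (16 * l * (B + 1)) / 2" using e l_pos by (simp add: field_simps)
  also have "\<dots> < 1" using e by simp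
  finally show False by simp
qed

text \<open>With the load below 1, every cap K with \<theta> = 1 is covered by
  \<open>mean_waiting_bound\<close>, which bounds the truncated second moments by 2 B / l uniformly
  in K; monotone convergence does the rest.\<close>

lemma second_moment_finite:
  assumes B: "\<And>n. N \<le> n \<Longrightarrow> (\<Sum>k<n. \<integral>\<^sup>+ \<omega>. ennreal (D k \<omega>) \<partial>M) \<le> ennreal (B * real n)" "0 \<le> B"
  shows "integrable M (\<lambda>\<omega>. (T 0 \<omega>)\<^sup>2)" "integrable M (T 0)" "(\<integral>\<omega>. T 0 \<omega> \<partial>M) < 1 / l"
proof -
  note l1 = load_less_one[OF B]
  have "(\<integral>\<^sup>+ \<omega>. ennreal ((T 0 \<omega>)\<^sup>2) \<partial>M) \<le> ennreal (2 * B * (1 / l))"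
    unfolding SUP_cut_moments[symmetric]
  proof (rule SUP_least, rule ennreal_leI)
    fix K :: nat
    have "ennreal (\<integral>\<omega>. cut 1 (real K) (T 0 \<omega>) \<partial>M) < ennreal (1 / l)"
      using l1 SUP_upper[of K UNIV "\<lambda>K. ennreal (\<integral>\<omega>. cut 1 (real K) (T 0 \<omega>) \<partial>M)"]
      unfolding SUP_cut_moments[symmetric] by (simp add: le_less_trans)
    then have "(\<integral>\<omega>. cut 1 (real K) (T 0 \<omega>) \<partial>M) < 1 / l"
      by (rule contrapos_pp) (auto simp: not_less ennreal_leI)
    from mean_waiting_bound[OF _ _ _ this B]
    have "(\<integral>\<omega>. (cut 1 (real K) (T 0 \<omega>))\<^sup>2 \<partial>M) \<le> 2 * B * (1 / l - (\<integral>\<omega>. cut 1 (real K) (T 0 \<omega>) \<partial>M))" by simp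
    also have "\<dots> \<le> 2 * B * (1 / l)"
      using B(2) cut_bounds(1)[of 1 "real K", OF _ _ _ T_nonneg[of _ 0]]
      by (intro mult_left_mono) (auto intro!: integral_nonneg_AE AE_I2)
    finally show "(\<integral>\<omega>. (cut 1 (real K) (T 0 \<omega>))\<^sup>2 \<partial>M) \<le> 2 * B * (1 / l)" .
  qed
  then have "(\<integral>\<^sup>+ \<omega>. ennreal ((T 0 \<omega>)\<^sup>2) \<partial>M) < \<infinity>" by (rule le_less_trans) simp
  then show "integrable M (\<lambda>\<omega>. (T 0 \<omega>)\<^sup>2)" by (intro integrableI_bounded) auto
  then show "integrable M (T 0)" by (rule square_integrable_imp_integrable[OF T_measurable])
  then have "(\<integral>\<^sup>+ \<omega>. ennreal (T 0 \<omega>) \<partial>M) = ennreal (\<integral>\<omega>. T 0 \<omega> \<partial>M)"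
    using T_nonneg by (intro nn_integral_eq_integral) auto
  with l1 show "(\<integral>\<omega>. T 0 \<omega> \<partial>M) < 1 / l"
    using ennreal_leI[of "1 / l" "\<integral>\<omega>. T 0 \<omega> \<partial>M"] by (metis not_less)
qed

end

context single_server_L2
begin

lemma cut_moments_tendsto:
  "(\<lambda>K. \<integral>\<omega>. cut 1 (real K) (T 0 \<omega>) \<partial>M) \<longlonglongrightarrow> m1"
  "(\<lambda>K. \<integral>\<omega>. (cut 1 (real K) (T 0 \<omega>))\<^sup>2 \<partial>M) \<longlonglongrightarrow> m2"
proof -
  have lim: "(\<lambda>K. cut 1 (real K) x) \<longlonglongrightarrow> x" for x
  proof (rule tendsto_eventually)
    obtain N :: nat where "x \<le> real N" using real_arch_simple by blast
    then show "\<forall>\<^sub>F K in sequentially. cut 1 (real K) x = x"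
      by (intro eventually_sequentiallyI[of N]) (auto simp: cut_def)
  qed
  have b: "\<bar>cut 1 (real K) (T 0 \<omega>)\<bar> \<le> T 0 \<omega>" if "\<omega> \<in> space M" for \<omega> K
    using T_nonneg[OF that, of 0] by (simp add: cut_def)
  show "(\<lambda>K. \<integral>\<omega>. cut 1 (real K) (T 0 \<omega>) \<partial>M) \<longlonglongrightarrow> m1"
    unfolding m1_def
    by (rule integral_dominated_convergence[where w="T 0"]) (use lim b in auto)
  show "(\<lambda>K. \<integral>\<omega>. (cut 1 (real K) (T 0 \<omega>))\<^sup>2 \<partial>M) \<longlonglongrightarrow> m2"
    unfolding m2_def
  proof (rule integral_dominated_convergence[where w="\<lambda>\<omega>. (T 0 \<omega>)\<^sup>2"])
    show "AE \<omega> in M. norm ((cut 1 (real K) (T 0 \<omega>))\<^sup>2) \<le> (T 0 \<omega>)\<^sup>2" for K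
      using b T_nonneg by (auto intro!: AE_I2 simp: abs_le_square_iff[symmetric])
    show "AE \<omega> in M. (\<lambda>K. (cut 1 (real K) (T 0 \<omega>))\<^sup>2) \<longlonglongrightarrow> (T 0 \<omega>)\<^sup>2"
      using lim by (auto intro!: AE_I2 tendsto_power)
  qed auto
qed

text \<open>The bounded case, with K so large that truncation costs at most e / 2 of the mean delay;
  the other e / 2 is spent in \<open>cut_lower_bound\<close>.\<close>

lemma total_ge:
  assumes m1: "m1 < 1 / l" and e: "0 < e"
  shows "\<exists>C. \<forall>P n. clock_pred P \<longrightarrow>
    ennreal ((mean_delay - e) * count (clock G P) n - C) \<le> (\<Sum>k<n. \<integral>\<^sup>+ \<omega>. ennreal (clock G P k \<omega> * D k \<omega>) \<partial>M)"
proof -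
  define p where "p K = (\<integral>\<omega>. (cut 1 (real K) (T 0 \<omega>))\<^sup>2 \<partial>M) / (2 * (1 / l - (\<integral>\<omega>. cut 1 (real K) (T 0 \<omega>) \<partial>M)))" for K :: nat
  have "p \<longlonglongrightarrow> mean_delay"
    unfolding mean_delay_def p_def[abs_def] using m1 by (intro tendsto_intros cut_moments_tendsto) auto
  from order_tendstoD(1)[OF this, of "mean_delay - e / 2"]
  have "\<forall>\<^sub>F K in sequentially. mean_delay - e / 2 < p K" using e by simp
  moreover have "\<forall>\<^sub>F K in sequentially. (\<integral>\<omega>. cut 1 (real K) (T 0 \<omega>) \<partial>M) < 1 / l"
    using order_tendstoD(2)[OF cut_moments_tendsto(1) m1] .
  ultimately have "\<forall>\<^sub>F K in sequentially. mean_delay - e / 2 < p K \<and> (\<integral>\<omega>. cut 1 (real K) (T 0 \<omega>) \<partial>M) < 1 / l"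
    by (rule eventually_conj)
  then obtain K where K: "mean_delay - e / 2 < p K" "(\<integral>\<omega>. cut 1 (real K) (T 0 \<omega>) \<partial>M) < 1 / l"
    by (auto simp: eventually_sequentially)
  obtain C where C: "\<And>P n. clock_pred P \<Longrightarrow>
      ennreal ((p K - e / 2) * count (clock G P) n - C) \<le> (\<Sum>k<n. \<integral>\<^sup>+ \<omega>. ennreal (clock G P k \<omega> * D k \<omega>) \<partial>M)"
    using cut_lower_bound[OF _ _ _ K(2), of "e / 2"] e unfolding p_def count_def by auto
  have "ennreal ((mean_delay - e) * count (clock G P) n - C) \<le> ennreal ((p K - e / 2) * count (clock G P) n - C)"
    if "clock_pred P" for P n
    using K(1) count_nonneg[OF weight_clock[OF that], of n]
    by (intro ennreal_leI diff_right_mono mult_right_mono) auto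
  then show ?thesis using C order_trans by blast
qed

end

section \<open>Convergence in distribution of the unfinished work\<close>

context single_server
begin

lemma step_identical: "distr M borel (step k) = distr M borel (step 0)"
proof -
  have joint: "distr M (borel \<Otimes>\<^sub>M borel) (\<lambda>\<omega>. (T k \<omega>, G (Suc k) \<omega>)) = distr M borel (T 0) \<Otimes>\<^sub>M density lborel (exponential_density l)" for k
  proof -
    have "distr M (borel \<Otimes>\<^sub>M borel) (\<lambda>\<omega>. (T k \<omega>, G (Suc k) \<omega>)) = distr M borel (T k) \<Otimes>\<^sub>M distr M borel (G (Suc k))"
      by (rule distr_pair_info[of "{Inr k}" "{Inl (Suc k)}"]) (auto intro: T_info G_info)
    moreover have "distr M borel (G (Suc k)) = density lborel (exponential_density l)"
      using distributed_distr_eq_density[OF G_exponential[of "Suc k"]] by (simp cong: distr_cong)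
    ultimately show ?thesis by (simp add: T_identical[of k])
  qed
  have "distr M borel (step k) = distr (distr M (borel \<Otimes>\<^sub>M borel) (\<lambda>\<omega>. (T k \<omega>, G (Suc k) \<omega>))) borel (\<lambda>z. fst z - snd z)" for k
    by (subst distr_distr) (auto simp: comp_def step_def[abs_def])
  then show ?thesis unfolding joint by metis
qed

text \<open>For x at least 0 the reflection does not affect the event, which gives Lindley's
  integral equation.\<close>

lemma emeasure_D_Suc:
  assumes "0 \<le> x"
  shows "emeasure M {\<omega> \<in> space M. D (Suc n) \<omega> \<le> x}
    = (\<integral>\<^sup>+ u. emeasure M {\<omega> \<in> space M. D n \<omega> \<le> x - u} \<partial>distr M borel (step 0))"
proof -
  have joint: "distr M (borel \<Otimes>\<^sub>M borel) (\<lambda>\<omega>. (D n \<omega>, step n \<omega>)) = distr M borel (D n) \<Otimes>\<^sub>M distr M borel (step n)"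
    by (rule distr_pair_info[OF _ D_past[unfolded past_def] step_info]) auto
  interpret D: prob_space "distr M borel (D n)" by (rule prob_space_distr) simp
  interpret S: prob_space "distr M borel (step n)" by (rule prob_space_distr) simp
  interpret pair_sigma_finite "distr M borel (D n)" "distr M borel (step n)" ..
  define A where "A = {z :: real \<times> real. fst z + snd z \<le> x}"
  have "A = {z \<in> space (borel \<Otimes>\<^sub>M borel). fst z + snd z \<le> x}" by (simp add: A_def space_pair_measure)
  then have A: "A \<in> sets (borel \<Otimes>\<^sub>M borel)" by simp
  have "{\<omega> \<in> space M. D (Suc n) \<omega> \<le> x} = (\<lambda>\<omega>. (D n \<omega>, step n \<omega>)) -` A \<inter> space M"
    using assms by (auto simp: D_Suc step_def A_def)
  then have "emeasure M {\<omega> \<in> space M. D (Suc n) \<omega> \<le> x}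
      = emeasure (distr M (borel \<Otimes>\<^sub>M borel) (\<lambda>\<omega>. (D n \<omega>, step n \<omega>))) A"
    using A by (simp add: emeasure_distr)
  also have "\<dots> = (\<integral>\<^sup>+ u. emeasure (distr M borel (D n)) ((\<lambda>x. (x, u)) -` A) \<partial>distr M borel (step n))"
    unfolding joint using A by (intro emeasure_pair_measure_alt2) simp
  also have "\<dots> = (\<integral>\<^sup>+ u. emeasure M {\<omega> \<in> space M. D n \<omega> \<le> x - u} \<partial>distr M borel (step n))"
  proof (rule nn_integral_cong)
    fix u
    have "(\<lambda>x. (x, u)) -` A = {..x - u}" by (auto simp: A_def)
    then show "emeasure (distr M borel (D n)) ((\<lambda>x. (x, u)) -` A) = emeasure M {\<omega> \<in> space M. D n \<omega> \<le> x - u}"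
      by (simp add: emeasure_distr vimage_def Int_def conj_commute)
  qed
  finally show ?thesis by (simp add: step_identical[of n])
qed

lemma D_less_0: "x < 0 \<Longrightarrow> {\<omega> \<in> space M. D n \<omega> \<le> x} = {}"
  using D_nonneg[of n] by (auto simp: not_le intro: less_le_trans)

text \<open>The queue starts empty, which gives the largest distribution function, and the integral
  equation preserves the order.\<close>

lemma emeasure_D_antimono:
  "emeasure M {\<omega> \<in> space M. D (Suc n) \<omega> \<le> x} \<le> emeasure M {\<omega> \<in> space M. D n \<omega> \<le> x}"
proof (induction n arbitrary: x)
  case 0
  show ?case
  proof (cases "0 \<le> x")
    case True
    then have "{\<omega> \<in> space M. D 0 \<omega> \<le> x} = space M" by (auto simp: D_0)
    then show ?thesis by (simp add: emeasure_space_1 measure_le_1 emeasure_le_1)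
  next
    case False
    then show ?thesis by (simp add: D_less_0)
  qed
next
  case (Suc n)
  show ?case
  proof (cases "0 \<le> x")
    case True
    then show ?thesis unfolding emeasure_D_Suc[OF True] by (intro nn_integral_mono Suc)
  next
    case False
    then show ?thesis by (simp add: D_less_0)
  qed
qed

definition F :: "nat \<Rightarrow> real \<Rightarrow> real" where "F n x = prob {\<omega> \<in> space M. D n \<omega> \<le> x}"

lemma cdf_D: "cdf (distr M borel (D n)) = F n"
  by (auto simp: cdf_def F_def fun_eq_iff measure_distr vimage_def Int_def conj_commute)

lemma F_antimono: "F (Suc n) x \<le> F n x"
  using emeasure_D_antimono[of n x] by (simp add: F_def emeasure_eq_measure)

lemma F_decseq: "decseq (\<lambda>n. F n x)"
  by (simp add: decseq_Suc_iff F_antimono)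

lemma F_mono: "x \<le> y \<Longrightarrow> F n x \<le> F n y"
  unfolding F_def by (intro finite_measure_mono) auto

lemma F_right_continuous: "continuous (at_right x) (F n)"
proof -
  interpret d: real_distribution "distr M borel (D n)" by (rule real_distribution_distr) simp
  show ?thesis using d.cdf_is_right_cont[of x] by (simp add: cdf_D)
qed

end

context single_server_L2
begin

text \<open>Tightness. \<open>total_le\<close> bounds only the averages of the means of D; but by
  monotonicity a tail exceeding the bound at n would persist at all later indices and spoil the
  averages.\<close>

lemma F_tail:
  assumes m1: "m1 < 1 / l" and x: "0 < x"
  shows "1 - mean_delay / x \<le> F n x"
proof (rule ccontr)
  assume neg: "\<not> ?thesis"
  define e where "e = (1 - F n x) - mean_delay / x"
  have e: "0 < e" using neg by (simp add: e_def)
  have markov: "1 - F k x \<le> (\<integral>\<omega>. D k \<omega> \<partial>M) / x" for k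
  proof -
    have "1 - F k x = prob (space M - {\<omega> \<in> space M. D k \<omega> \<le> x})"
      unfolding F_def by (subst prob_compl) auto
    also have "\<dots> \<le> prob {\<omega> \<in> space M. x \<le> D k \<omega>}" by (intro finite_measure_mono) auto
    also have "\<dots> \<le> (\<integral>\<omega>. D k \<omega> \<partial>M) / x"
      using D_nonneg x by (intro integral_Markov_inequality_measure[where A="space M"]) auto
    finally show ?thesis .
  qed
  have w: "weight (\<lambda>_ _. 1)" by (simp add: weight_def)
  obtain N :: nat where N: "real n / e < real N" using reals_Archimedean2 by blast
  define k where "k = max n N"
  have Nk: "real n < e * real k"
  proof -
    have "real n / e < real k" using N by (simp add: k_def)
    then show ?thesis using e by (simp add: field_simps)
  qed
  have "(real k - real n) * (1 - F n x) = (\<Sum>j\<in>{n..<k}. 1 - F n x)" by (simp add: k_def of_nat_diff)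
  also have "\<dots> \<le> (\<Sum>j\<in>{n..<k}. 1 - F j x)" using F_decseq[of x] by (intro sum_mono) (auto simp: decseq_def)
  also have "\<dots> \<le> (\<Sum>j<k. 1 - F j x)" by (intro sum_mono2) (auto simp: F_def)
  also have "\<dots> \<le> (\<Sum>j<k. (\<integral>\<omega>. D j \<omega> \<partial>M) / x)" by (intro sum_mono markov)
  also have "\<dots> = total (\<lambda>_ _. 1) k / x" by (simp add: total_def sum_divide_distrib)
  also have "\<dots> \<le> mean_delay * real k / x"
    using total_le[OF w m1, of k] x by (intro divide_right_mono) (auto simp: count_def prob_space)
  finally have "(real k - real n) * (1 - F n x) \<le> mean_delay / x * real k" by simp
  then have "e * real k \<le> real n * (1 - F n x)" by (simp add: e_def algebra_simps)
  also have "\<dots> \<le> real n" by (simp add: F_def mult_left_le)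
  finally show False using Nk by simp
qed

lemma stable:
  assumes m1: "m1 < 1 / l"
  shows "\<exists>\<mu>. real_distribution \<mu> \<and> weak_conv_m (\<lambda>n. distr M borel (D n)) \<mu>"
proof -
  have bdd: "bdd_below (range (\<lambda>n. F n x))" for x by (rule bdd_belowI[of _ 0]) (auto simp: F_def)
  define L where "L x = (INF n. F n x)" for x
  have lim: "(\<lambda>n. F n x) \<longlonglongrightarrow> L x" for x
    unfolding L_def using F_decseq bdd by (intro LIMSEQ_decseq_INF) auto
  have le: "L x \<le> F n x" for n x unfolding L_def using bdd by (intro cINF_lower) auto
  have mono: "L x \<le> L y" if "x \<le> y" for x y
    using lim[of x] lim[of y] F_mono[OF that] by (intro LIMSEQ_le) auto
  \<comment> \<open>An infimum of right-continuous nondecreasing functions is right-continuous: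
    close to the right of a, L lies below a single F n and above L a.\<close>
  have rc: "continuous (at_right a) L" for a
    unfolding continuous_within tendsto_iff
  proof (intro allI impI)
    fix e :: real assume e: "0 < e"
    obtain n where n: "F n a < L a + e / 2"
      using order_tendstoD(2)[OF lim[of a], of "L a + e / 2"] e by (auto simp: eventually_sequentially)
    have "\<forall>\<^sub>F x in at_right a. dist (F n x) (F n a) < e / 2"
      using F_right_continuous[of a n] e unfolding continuous_within tendsto_iff by (meson half_gt_zero)
    moreover have "\<forall>\<^sub>F x in at_right a. a < x" by (simp add: eventually_at_filter)
    ultimately show "\<forall>\<^sub>F x in at_right a. dist (L x) (L a) < e"
    proof eventually_elim
      case (elim x)
      have "L x < L a + e" using le[of x n] n elim(1) unfolding dist_real_def by linarith
      then show ?case using mono[of a x] elim(2) by (simp add: dist_real_def)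
    qed
  qed
  have bot: "(L \<longlongrightarrow> 0) at_bot"
  proof (rule tendsto_eventually)
    have "L x = 0" if "x < 0" for x
    proof -
      show ?thesis using that by (simp add: L_def F_def D_less_0)
    qed
    then show "\<forall>\<^sub>F x in at_bot. L x = 0"
      using eventually_at_bot_dense by blast
  qed
  have top: "(L \<longlongrightarrow> 1) at_top"
  proof (rule tendsto_sandwich)
    show "\<forall>\<^sub>F x in at_top. 1 - mean_delay / x \<le> L x"
      using eventually_gt_at_top[of 0]
    proof eventually_elim
      case (elim x)
      show ?case unfolding L_def using F_tail[OF m1 elim] by (intro cINF_greatest) auto
    qed
    show "\<forall>\<^sub>F x in at_top. L x \<le> 1"
      using order_trans[OF le[of _ 0]] by (simp add: F_def)
    have "((\<lambda>x. 1 - mean_delay / x) \<longlongrightarrow> 1 - 0) at_top"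
      by (intro tendsto_intros tendsto_divide_0[OF tendsto_const] filterlim_at_top_imp_at_infinity filterlim_ident)
    then show "((\<lambda>x. 1 - mean_delay / x) \<longlongrightarrow> 1) at_top" by simp
  qed auto
  have "real_distribution (interval_measure L)"
    using mono rc bot top by (rule real_distribution_interval_measure)
  moreover have "weak_conv_m (\<lambda>n. distr M borel (D n)) (interval_measure L)"
  proof -
    have "cdf (interval_measure L) = L" using mono rc bot by (rule cdf_interval_measure)
    then show ?thesis unfolding weak_conv_m_def weak_conv_def cdf_D using lim by simp
  qed
  ultimately show ?thesis by blast
qed

end

section \<open>Durations by order of service\<close>

definition slot_customer :: "('a, 'r) facility \<Rightarrow> (nat \<Rightarrow> 'a \<Rightarrow> real) \<Rightarrow> nat \<Rightarrow> 'a \<Rightarrow> nat" where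
  "slot_customer Q S k \<omega> = cust (rule Q (seed Q \<omega>)) (\<lambda>j. arrival Q j \<omega>) (\<lambda>j. S j \<omega>) k"

definition slot_start :: "('a, 'r) facility \<Rightarrow> (nat \<Rightarrow> 'a \<Rightarrow> real) \<Rightarrow> nat \<Rightarrow> 'a \<Rightarrow> real" where
  "slot_start Q S k \<omega> = start (rule Q (seed Q \<omega>)) (\<lambda>j. arrival Q j \<omega>) (\<lambda>j. S j \<omega>) k"

definition slot_duration :: "('a, 'r) facility \<Rightarrow> (nat \<Rightarrow> 'a \<Rightarrow> real) \<Rightarrow> nat \<Rightarrow> 'a \<Rightarrow> real" where
  "slot_duration Q S k \<omega> = S (slot_customer Q S k \<omega>) \<omega>"

lemma waiting_time_wait:
  "waiting_time Q S i \<omega> = wait (rule Q (seed Q \<omega>)) (\<lambda>j. arrival Q j \<omega>) (\<lambda>j. S j \<omega>) i"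
  by (simp add: waiting_time_def wait_def)

context facility_model
begin

sublocale independent_family "prob_of Q" "source_events Q"
proof
  show "indep_sets (source_events Q) UNIV" by (rule independent_sources)
  show "Int_stable (source_events Q i)" for i
  proof (cases i)
    case (Marg j)
    have "algebra (space (prob_of Q)) (source_events Q i)"
      unfolding Marg source_events.simps
      by (intro sigma_algebra.axioms(1) sigma_algebra_sigma_sets) auto
    then show ?thesis by (auto simp: Int_stable_def algebra_iff_Int)
  qed (simp_all only: source_events.simps Int_stable_vimage)
qed

abbreviation "knowledge \<equiv> info (prob_of Q) (source_events Q)"

lemma gap_knowledge: "Gap i \<in> J \<Longrightarrow> gap Q i \<in> borel_measurable (knowledge J)"
  by (rule measurable_infoI[where i="Gap i"]) auto

lemma wcost_knowledge: "WCost i \<in> J \<Longrightarrow> wcost Q i \<in> borel_measurable (knowledge J)"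
  by (rule measurable_infoI[where i="WCost i"]) auto

lemma seed_knowledge: "Seed \<in> J \<Longrightarrow> seed Q \<in> measurable (knowledge J) (seed_space Q)"
  using measurable_space[OF seed_measurable] by (intro measurable_infoI[where i=Seed]) auto

lemma marg_knowledge: "Marg i \<in> J \<Longrightarrow> 0 \<le> s \<Longrightarrow> marg Q i s \<in> borel_measurable (knowledge J)"
  by (rule measurable_infoI[where i="Marg i"]) (auto intro: sigma_sets.Basic)

lemma gap_measurable [measurable]: "gap Q i \<in> borel_measurable (prob_of Q)"
  by (rule measurable_info_M[OF gap_knowledge[of i UNIV]]) simp

lemma wcost_measurable [measurable]: "wcost Q i \<in> borel_measurable (prob_of Q)"
  by (rule measurable_info_M[OF wcost_knowledge[of i UNIV]]) simp

lemma marg_measurable: "0 \<le> s \<Longrightarrow> marg Q i s \<in> borel_measurable (prob_of Q)"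
  by (rule measurable_info_M[OF marg_knowledge[of i UNIV]]) simp_all

lemma arrival_diff: "arrival Q (Suc j) \<omega> - arrival Q j \<omega> = gap Q (Suc j) \<omega>"
  by (simp add: arrival_def)

lemma arrival_strict: "\<omega> \<in> space (prob_of Q) \<Longrightarrow> strict_mono (\<lambda>j. arrival Q j \<omega>)"
  using gap_pos by (auto simp: strict_mono_Suc_iff arrival_def)

lemma service_path:
  assumes "\<omega> \<in> space (prob_of Q)" "\<And>i. 0 \<le> S i \<omega>"
  shows "service_path (\<lambda>j. arrival Q j \<omega>) (\<lambda>j. S j \<omega>)"
  using assms arrival_strict gap_pos by unfold_locales (auto simp: arrival_def)

text \<open>The sigma-algebra N is kept general because it will also be the one that omits
  \<open>Marg i\<close>, with the duration of customer i replaced by 0.\<close>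

lemma slots_measurable:
  fixes N :: "'a measure"
  assumes N: "space N = space (prob_of Q)"
    and gap: "\<And>i. gap Q i \<in> borel_measurable N" and seed: "seed Q \<in> measurable N (seed_space Q)"
    and S: "\<And>i. S i \<in> borel_measurable N" and S_nonneg: "\<And>i \<omega>. \<omega> \<in> space (prob_of Q) \<Longrightarrow> 0 \<le> S i \<omega>"
  shows "slot_customer Q S k \<in> measurable N (count_space UNIV) \<and> slot_start Q S k \<in> borel_measurable N"
proof (induction k rule: less_induct)
  case (less k)
  note [measurable] = gap S seed
  have [measurable]: "arrival Q i \<in> borel_measurable N" for i unfolding arrival_def[abs_def] by measurable
  have c: "slot_customer Q S j \<in> measurable N (count_space UNIV)" if "j < k" for j using less that by auto
  have dur: "slot_duration Q S j \<in> borel_measurable N" if "j < k" for j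
    unfolding slot_duration_def[abs_def] by (rule measurable_compose_countable[OF S c[OF that]])
  \<comment> \<open>This form of the start epoch avoids the infimum over the random set of unserved
    customers.\<close>
  have start_eq: "slot_start Q S k \<omega> = max (if k = 0 then 0 else slot_start Q S (k - 1) \<omega> + slot_duration Q S (k - 1) \<omega>) (arrival Q k \<omega>)"
    if "\<omega> \<in> space N" for \<omega>
  proof -
    interpret s: service_path "rule Q (seed Q \<omega>)" "\<lambda>j. arrival Q j \<omega>" "\<lambda>j. S j \<omega>"
      using S_nonneg that N by (intro service_path) auto
    show ?thesis
      using s.start_eq[of k] by (simp only: slot_start_def slot_duration_def slot_customer_def free_def)
  qed
  have "(\<lambda>\<omega>. max (if k = 0 then 0 else slot_start Q S (k - 1) \<omega> + slot_duration Q S (k - 1) \<omega>) (arrival Q k \<omega>)) \<in> borel_measurable N"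
    using less[of "k - 1"] dur[of "k - 1"] by (cases "k = 0") auto
  then have st: "slot_start Q S k \<in> borel_measurable N"
    using start_eq by (subst measurable_cong[where g="\<lambda>\<omega>. max (if k = 0 then 0 else slot_start Q S (k - 1) \<omega> + slot_duration Q S (k - 1) \<omega>) (arrival Q k \<omega>)"]) auto
  note [measurable] = st
  define ch where "ch \<omega> = rule Q (seed Q \<omega>) k (\<lambda>i. min (arrival Q i \<omega>) (slot_start Q S k \<omega>))
      (\<lambda>j. if j < k then slot_duration Q S j \<omega> else 0)" for \<omega>
  have "(\<lambda>\<omega>. (seed Q \<omega>, (\<lambda>i. min (arrival Q i \<omega>) (slot_start Q S k \<omega>)), (\<lambda>j. if j < k then slot_duration Q S j \<omega> else 0)))
      \<in> measurable N (seed_space Q \<Otimes>\<^sub>M PiM UNIV (\<lambda>_. borel) \<Otimes>\<^sub>M PiM UNIV (\<lambda>_. borel))"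
  proof (intro measurable_Pair seed)
    show "(\<lambda>\<omega> i. min (arrival Q i \<omega>) (slot_start Q S k \<omega>)) \<in> measurable N (PiM UNIV (\<lambda>_. borel))"
      by (rule measurable_PiM_single') auto
    show "(\<lambda>\<omega> j. if j < k then slot_duration Q S j \<omega> else 0) \<in> measurable N (PiM UNIV (\<lambda>_. borel))"
    proof (rule measurable_PiM_single')
      show "(\<lambda>\<omega>. if j < k then slot_duration Q S j \<omega> else 0) \<in> borel_measurable N" for j
        using dur[of j] by (cases "j < k") auto
    qed auto
  qed
  from measurable_compose[OF this rule_measurable[of k]]
  have ch: "ch \<in> measurable N (count_space UNIV)"
    unfolding ch_def[abs_def] by simp
  define W where "W i \<omega> \<longleftrightarrow> (\<forall>j\<in>{..<k}. slot_customer Q S j \<omega> \<noteq> i) \<and> arrival Q i \<omega> \<le> slot_start Q S k \<omega>" for i \<omega>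
  have W: "Measurable.pred N (W i)" for i
  proof -
    have "Measurable.pred N (\<lambda>\<omega>. \<forall>j\<in>{..<k}. slot_customer Q S j \<omega> \<noteq> i)"
    proof (rule pred_intros_finite)
      show "Measurable.pred N (\<lambda>\<omega>. slot_customer Q S j \<omega> \<noteq> i)" if "j \<in> {..<k}" for j
        using measurable_compose[OF c[of j], of "\<lambda>x. x \<noteq> i" "count_space UNIV"] that by simp
    qed simp
    moreover have "Measurable.pred N (\<lambda>\<omega>. arrival Q i \<omega> \<le> slot_start Q S k \<omega>)" by measurable
    ultimately show ?thesis unfolding W_def[abs_def] pred_def by (rule sets.sets_Collect_conj[rotated])
  qed
  have Wc: "Measurable.pred N (\<lambda>\<omega>. W (ch \<omega>) \<omega>)"
    using W by (rule measurable_compose_countable[OF _ ch])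
  have Wl: "(\<lambda>\<omega>. LEAST i. W i \<omega>) \<in> measurable N (count_space UNIV)"
    using W by (rule measurable_Least)
  have eq: "slot_customer Q S k = (\<lambda>\<omega>. if W (ch \<omega>) \<omega> then ch \<omega> else (LEAST i. W i \<omega>))"
  proof
    fix \<omega>
    have "choice (rule Q (seed Q \<omega>)) (\<lambda>j. arrival Q j \<omega>) (\<lambda>j. S j \<omega>) k = ch \<omega>"
      unfolding choice_def ch_def slot_start_def slot_duration_def slot_customer_def ..
    moreover have "{i. i \<notin> cust (rule Q (seed Q \<omega>)) (\<lambda>j. arrival Q j \<omega>) (\<lambda>j. S j \<omega>) ` {..<k}
        \<and> arrival Q i \<omega> \<le> start (rule Q (seed Q \<omega>)) (\<lambda>j. arrival Q j \<omega>) (\<lambda>j. S j \<omega>) k} = {i. W i \<omega>}"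
      by (auto simp: W_def slot_start_def slot_customer_def)
    ultimately show "slot_customer Q S k \<omega> = (if W (ch \<omega>) \<omega> then ch \<omega> else (LEAST i. W i \<omega>))"
      unfolding slot_customer_def by (subst cust_choice) (simp add: Let_def)
  qed
  have "slot_customer Q S k \<in> measurable N (count_space UNIV)"
    unfolding eq using Wc by (intro measurable_If[OF ch Wl]) (simp add: pred_def)
  with st show ?case by simp
qed

end

locale service_durations = facility_model Q for Q :: "('a, 'r) facility" +
  fixes S :: "nat \<Rightarrow> 'a \<Rightarrow> real"
  assumes S_nonneg: "\<And>i \<omega>. \<omega> \<in> space (prob_of Q) \<Longrightarrow> 0 \<le> S i \<omega>"
    and S_knowledge: "\<And>i. S i \<in> borel_measurable (knowledge {Marg i})"
    and S_identical: "\<And>i. distr (prob_of Q) borel (S i) = distr (prob_of Q) borel (S 0)"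
begin

lemma S_measurable [measurable]: "S i \<in> borel_measurable (prob_of Q)"
  using S_knowledge by (rule measurable_info_M)

abbreviation "\<sigma> \<equiv> slot_duration Q S"

lemma slot_customer_measurable [measurable]:
  "slot_customer Q S k \<in> measurable (prob_of Q) (count_space UNIV)"
  and slot_start_measurable [measurable]: "slot_start Q S k \<in> borel_measurable (prob_of Q)"
  using slots_measurable[of "prob_of Q" S k] S_nonneg seed_measurable by auto

lemma slot_duration_measurable [measurable]: "\<sigma> k \<in> borel_measurable (prob_of Q)"
  unfolding slot_duration_def[abs_def] by (rule measurable_compose_countable[OF S_measurable slot_customer_measurable])

text \<open>
  On the event that slot \<open>k\<close> is given to customer \<open>i\<close>, the first \<open>k\<close> slots do not involve his
  service duration, which may therefore be replaced by 0.
\<close>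

lemma slot_event_knowledge:
  assumes A: "A \<in> sets (knowledge (range Gap))" and B: "\<And>j. B j \<in> sets borel"
  shows "A \<inter> {\<omega> \<in> space (prob_of Q). (\<forall>j\<in>{..<k}. \<sigma> j \<omega> \<in> B j) \<and> slot_customer Q S k \<omega> = i}
    \<in> sets (knowledge (UNIV - {Marg i}))"
proof -
  let ?N = "knowledge (UNIV - {Marg i})"
  define S' where "S' = S(i := (\<lambda>_. 0))"
  have S': "S' j \<in> borel_measurable ?N" for j
    using measurable_info_mono[OF S_knowledge[of j], of "UNIV - {Marg i}"] by (cases "j = i") (auto simp: S'_def)
  have S'_nonneg: "0 \<le> S' j \<omega>" if "\<omega> \<in> space (prob_of Q)" for j \<omega> using S_nonneg[OF that] by (simp add: S'_def)
  have c': "slot_customer Q S' j \<in> measurable ?N (count_space UNIV)" for j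
    using slots_measurable[of ?N S' j] S' S'_nonneg gap_knowledge seed_knowledge by auto
  have \<sigma>': "slot_duration Q S' j \<in> borel_measurable ?N" for j
    unfolding slot_duration_def[abs_def] by (rule measurable_compose_countable[OF S' c'])
  \<comment> \<open>Either hypothesis must suffice, because the events for S and for S' are to be
    shown equal, not merely nested.\<close>
  have same: "slot_customer Q S' j \<omega> = slot_customer Q S j \<omega>"
    if c: "slot_customer Q S k \<omega> = i \<or> slot_customer Q S' k \<omega> = i" and j: "j \<le> k" and \<omega>: "\<omega> \<in> space (prob_of Q)" for j \<omega>
  proof -
    let ?d = "rule Q (seed Q \<omega>)" and ?a = "\<lambda>j. arrival Q j \<omega>"
    interpret s: service_path ?d ?a "\<lambda>j. S j \<omega>" using \<omega> S_nonneg by (intro service_path)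
    interpret s': service_path ?d ?a "\<lambda>j. S' j \<omega>" using \<omega> S'_nonneg by (intro service_path)
    from c show ?thesis
    proof
      assume "slot_customer Q S k \<omega> = i"
      then have "cust ?d ?a (\<lambda>j. S j \<omega>) j \<noteq> i" if "j < k" for j
        using injD[OF s.cust_inj, of j k] that by (auto simp: slot_customer_def)
      then have "slot ?d ?a (\<lambda>j. S' j \<omega>) j = slot ?d ?a (\<lambda>j. S j \<omega>) j"
        using j by (intro slot_cong[of k]) (auto simp: S'_def)
      then show ?thesis by (simp add: slot_customer_def)
    next
      assume "slot_customer Q S' k \<omega> = i"
      then have "cust ?d ?a (\<lambda>j. S' j \<omega>) j \<noteq> i" if "j < k" for j
        using injD[OF s'.cust_inj, of j k] that by (auto simp: slot_customer_def)
      then have "slot ?d ?a (\<lambda>j. S j \<omega>) j = slot ?d ?a (\<lambda>j. S' j \<omega>) j"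
        using j by (intro slot_cong[of k]) (auto simp: S'_def)
      then show ?thesis by (simp add: slot_customer_def)
    qed
  qed
  have same': "slot_duration Q S' j \<omega> = \<sigma> j \<omega>"
    if c: "slot_customer Q S k \<omega> = i" and j: "j < k" and \<omega>: "\<omega> \<in> space (prob_of Q)" for j \<omega>
  proof -
    interpret s: service_path "rule Q (seed Q \<omega>)" "\<lambda>j. arrival Q j \<omega>" "\<lambda>j. S j \<omega>" using \<omega> S_nonneg by (intro service_path)
    have "slot_customer Q S j \<omega> \<noteq> i"
      using injD[OF s.cust_inj, of j k] c j by (auto simp: slot_customer_def)
    then show ?thesis using same[OF disjI1[OF c] _ \<omega>, of j] j by (simp add: slot_duration_def S'_def)
  qed
  have eq: "{\<omega> \<in> space (prob_of Q). (\<forall>j\<in>{..<k}. \<sigma> j \<omega> \<in> B j) \<and> slot_customer Q S k \<omega> = i}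
    = {\<omega> \<in> space ?N. (\<forall>j\<in>{..<k}. slot_duration Q S' j \<omega> \<in> B j) \<and> slot_customer Q S' k \<omega> = i}"
  proof (intro set_eqI iffI)
    fix \<omega> assume *: "\<omega> \<in> {\<omega> \<in> space (prob_of Q). (\<forall>j\<in>{..<k}. \<sigma> j \<omega> \<in> B j) \<and> slot_customer Q S k \<omega> = i}"
    then have "slot_customer Q S' k \<omega> = i" using same[of \<omega> k] by auto
    then show "\<omega> \<in> {\<omega> \<in> space ?N. (\<forall>j\<in>{..<k}. slot_duration Q S' j \<omega> \<in> B j) \<and> slot_customer Q S' k \<omega> = i}"
      using * same'[of \<omega>] by auto
  next
    fix \<omega> assume *: "\<omega> \<in> {\<omega> \<in> space ?N. (\<forall>j\<in>{..<k}. slot_duration Q S' j \<omega> \<in> B j) \<and> slot_customer Q S' k \<omega> = i}"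
    then have "slot_customer Q S k \<omega> = i" using same[of \<omega> k] by auto
    then show "\<omega> \<in> {\<omega> \<in> space (prob_of Q). (\<forall>j\<in>{..<k}. \<sigma> j \<omega> \<in> B j) \<and> slot_customer Q S k \<omega> = i}"
      using * same'[of \<omega>] by auto
  qed
  have "{\<omega> \<in> space ?N. slot_duration Q S' j \<omega> \<in> B j} \<in> sets ?N" for j
    using measurable_sets[OF \<sigma>'[of j] B[of j]] by (simp add: vimage_def Int_def conj_commute)
  then have "{\<omega> \<in> space ?N. \<forall>j\<in>{..<k}. slot_duration Q S' j \<omega> \<in> B j} \<in> sets ?N"
    by (intro sets.sets_Collect_finite_All) auto
  moreover have "{\<omega> \<in> space ?N. slot_customer Q S' k \<omega> = i} \<in> sets ?N"
    using measurable_sets[OF c'[of k], of "{i}"] by (simp add: vimage_def Int_def conj_commute)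
  ultimately have "{\<omega> \<in> space (prob_of Q). (\<forall>j\<in>{..<k}. \<sigma> j \<omega> \<in> B j) \<and> slot_customer Q S k \<omega> = i} \<in> sets ?N"
    unfolding eq by (rule sets.sets_Collect_conj[rotated])
  moreover have "A \<in> sets ?N" using A sets_info_mono[of "range Gap" "UNIV - {Marg i}"] by auto
  ultimately show ?thesis by (rule sets.Int[rotated])
qed

lemma prob_S: "B \<in> sets borel \<Longrightarrow> prob {\<omega> \<in> space (prob_of Q). S i \<omega> \<in> B} = prob {\<omega> \<in> space (prob_of Q). S 0 \<omega> \<in> B}"
  using arg_cong[OF S_identical[of i], of "\<lambda>N. measure N B"] by (simp add: measure_distr vimage_def Int_def conj_commute)

text \<open>Induction on k, splitting by the customer i in slot k. On this event the history is
  independent of \<open>S i\<close> by \<open>slot_event_knowledge\<close>, and the law of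
  \<open>S i\<close> does not depend on i, so the factor for slot k comes out of the sum over
  i.\<close>

lemma prob_slots:
  assumes A: "A \<in> sets (knowledge (range Gap))" and B: "\<And>j. B j \<in> sets borel"
  shows "prob (A \<inter> {\<omega> \<in> space (prob_of Q). \<forall>j\<in>{..<k}. \<sigma> j \<omega> \<in> B j})
    = prob A * (\<Prod>j<k. prob {\<omega> \<in> space (prob_of Q). S 0 \<omega> \<in> B j})"
proof (induction k)
  case 0
  have "A \<subseteq> space (prob_of Q)" using A sets.sets_into_space by fastforce
  then show ?case by (simp add: Int_absorb2)
next
  case (Suc k)
  let ?M = "prob_of Q"
  have A': "A \<in> events" using A sets_info_events by blast
  note [measurable] = B A'
  define E where "E = A \<inter> {\<omega> \<in> space ?M. \<forall>j\<in>{..<k}. \<sigma> j \<omega> \<in> B j}"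
  define c where "c i = {\<omega> \<in> space ?M. slot_customer Q S k \<omega> = i}" for i
  define s where "s i = {\<omega> \<in> space ?M. S i \<omega> \<in> B k}" for i
  have [measurable]: "{\<omega> \<in> space ?M. \<forall>j\<in>{..<k}. \<sigma> j \<omega> \<in> B j} \<in> events"
    by (intro sets.sets_Collect_finite_All) measurable
  have [measurable]: "E \<in> events" "c i \<in> events" "s i \<in> events" for i unfolding E_def c_def s_def by measurable
  have part: "(\<Union>i. X \<inter> c i) = X" "disjoint_family (\<lambda>i. X \<inter> c i)" if "X \<in> events" for X
    using sets.sets_into_space[OF that] by (auto simp: c_def disjoint_family_on_def)
  have sum: "(\<lambda>i. prob (X \<inter> c i)) sums prob X" if "X \<in> events" for X
  proof -
    have "range (\<lambda>i. X \<inter> c i) \<subseteq> events" using that by auto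
    from finite_measure_UNION[OF this part(2)[OF that]] show ?thesis unfolding part(1)[OF that] .
  qed
  have indep: "prob ((E \<inter> c i) \<inter> s i) = prob (E \<inter> c i) * prob (s i)" for i
  proof (rule indep_setD[OF indep_info[of "UNIV - {Marg i}" "{Marg i}"]])
    have "E \<inter> c i = A \<inter> {\<omega> \<in> space ?M. (\<forall>j\<in>{..<k}. \<sigma> j \<omega> \<in> B j) \<and> slot_customer Q S k \<omega> = i}"
      by (auto simp: E_def c_def)
    then show "E \<inter> c i \<in> sets (knowledge (UNIV - {Marg i}))" using slot_event_knowledge[OF A B] by simp
    show "s i \<in> sets (knowledge {Marg i})"
      using measurable_sets[OF S_knowledge[of i] B[of k]] by (simp add: s_def vimage_def Int_def conj_commute)
  qed auto
  define E' where "E' = A \<inter> {\<omega> \<in> space ?M. \<forall>j\<in>{..<Suc k}. \<sigma> j \<omega> \<in> B j}"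
  have E'_c: "E' \<inter> c i = (E \<inter> c i) \<inter> s i" for i
    by (auto simp: E'_def E_def c_def s_def slot_duration_def less_Suc_eq)
  have [measurable]: "{\<omega> \<in> space ?M. \<forall>j\<in>{..<Suc k}. \<sigma> j \<omega> \<in> B j} \<in> events"
    by (intro sets.sets_Collect_finite_All) measurable
  have "E' \<in> events" unfolding E'_def by measurable
  have "(\<lambda>i. prob (E' \<inter> c i)) = (\<lambda>i. prob (E \<inter> c i) * prob (s 0))"
  proof
    fix i show "prob (E' \<inter> c i) = prob (E \<inter> c i) * prob (s 0)"
      using E'_c[of i] indep[of i] prob_S[OF B[of k], of i] by (simp add: s_def)
  qed
  with sum[OF \<open>E' \<in> events\<close>] have "(\<lambda>i. prob (E \<inter> c i) * prob (s 0)) sums prob E'" by simp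
  moreover have "(\<lambda>i. prob (E \<inter> c i) * prob (s 0)) sums (prob E * prob (s 0))"
    by (intro sums_mult2 sum) measurable
  ultimately have "prob E' = prob E * prob (s 0)" by (rule sums_unique2)
  then show ?case using Suc by (simp add: E'_def E_def s_def lessThan_Suc ac_simps)
qed

lemma prob_slot_duration:
  assumes B: "B \<in> sets borel"
  shows "prob {\<omega> \<in> space (prob_of Q). \<sigma> k \<omega> \<in> B} = prob {\<omega> \<in> space (prob_of Q). S 0 \<omega> \<in> B}"
proof -
  define C where "C j = (if j = k then B else UNIV)" for j :: nat
  have "prob (space (prob_of Q) \<inter> {\<omega> \<in> space (prob_of Q). \<forall>j\<in>{..<Suc k}. \<sigma> j \<omega> \<in> C j})
      = prob (space (prob_of Q)) * (\<Prod>j<Suc k. prob {\<omega> \<in> space (prob_of Q). S 0 \<omega> \<in> C j})"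
  proof (rule prob_slots)
    have "space (knowledge (range Gap)) \<in> sets (knowledge (range Gap))" by (rule sets.top)
    then show "space (prob_of Q) \<in> sets (knowledge (range Gap))" unfolding space_info .
  qed (use B in \<open>auto simp: C_def\<close>)
  moreover have "space (prob_of Q) \<inter> {\<omega> \<in> space (prob_of Q). \<forall>j\<in>{..<Suc k}. \<sigma> j \<omega> \<in> C j}
      = {\<omega> \<in> space (prob_of Q). \<sigma> k \<omega> \<in> B}"
    by (auto simp: C_def)
  moreover have "(\<Prod>j<k. prob {\<omega> \<in> space (prob_of Q). S 0 \<omega> \<in> C j}) = 1"
    by (intro prod.neutral) (auto simp: C_def prob_space)
  ultimately show ?thesis by (simp add: C_def prob_space)
qed

lemma indep_gap_slot_duration: "indep_vars (\<lambda>_. borel) (case_sum (gap Q) \<sigma>) UNIV"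
  unfolding indep_vars_def2
proof (intro conjI ballI indep_setsI)
  let ?M = "prob_of Q"
  fix i :: "nat + nat"
  show rv: "random_variable borel (case i of Inl x \<Rightarrow> gap Q x | Inr x \<Rightarrow> \<sigma> x)" by (cases i) auto
  then show "{(case i of Inl x \<Rightarrow> gap Q x | Inr x \<Rightarrow> \<sigma> x) -` A \<inter> space ?M |A. A \<in> sets borel} \<subseteq> events"
    by (auto intro: measurable_sets)
next
  let ?M = "prob_of Q"
  fix A and J :: "(nat + nat) set"
  assume J: "J \<noteq> {}" "finite J"
    and "\<forall>j\<in>J. A j \<in> {(case j of Inl x \<Rightarrow> gap Q x | Inr x \<Rightarrow> \<sigma> x) -` A \<inter> space ?M |A. A \<in> sets borel}"
  then obtain B where B: "\<And>j. j \<in> J \<Longrightarrow> B j \<in> sets borel"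
    and A: "\<And>j. j \<in> J \<Longrightarrow> A j = (case j of Inl x \<Rightarrow> gap Q x | Inr x \<Rightarrow> \<sigma> x) -` B j \<inter> space ?M"
    by simp metis
  define I where "I = Inl -` J"
  define K where "K = Inr -` J"
  have fin: "finite I" "finite K" using J by (auto simp: I_def K_def intro: finite_vimageI)
  have J_eq: "J = Inl ` I \<union> Inr ` K"
  proof (intro set_eqI iffI)
    fix x assume "x \<in> J" then show "x \<in> Inl ` I \<union> Inr ` K" by (cases x) (auto simp: I_def K_def)
  qed (auto simp: I_def K_def)
  obtain n where n: "K \<subseteq> {..<n}" using finite_nat_iff_bounded[THEN iffD1, OF fin(2)] by blast
  \<comment> \<open>Slots outside K get the trivial condition, so that an initial segment of slots
    is constrained, as in \<open>prob_slots\<close>.\<close>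
  define C where "C j = (if j \<in> K then B (Inr j) else UNIV)" for j
  \<comment> \<open>Intersecting with the space covers the case of an empty I.\<close>
  define A0 where "A0 = (\<Inter>i\<in>I. A (Inl i)) \<inter> space ?M"
  have gap_event: "A (Inl i) \<in> source_events Q (Gap i)" if "i \<in> I" for i
    using A[of "Inl i"] B[of "Inl i"] that by (auto simp: I_def)
  have A0: "A0 \<in> sets (knowledge (range Gap))"
  proof -
    have "A (Inl i) \<in> sets (knowledge (range Gap))" if "i \<in> I" for i
      unfolding sets_info using gap_event[OF that] by (intro sigma_sets.Basic) auto
    then have "(\<Inter>i\<in>I. A (Inl i)) \<inter> space (knowledge (range Gap)) \<in> sets (knowledge (range Gap))"
      using fin(1)
    proof (induction I rule: infinite_finite_induct)
      case empty
      show ?case unfolding image_empty Inter_empty Int_UNIV_left by (rule sets.top)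
    next
      case (insert x I)
      show ?case unfolding INT_insert Int_assoc by (rule sets.Int) (use insert in auto)
    qed simp
    then show ?thesis unfolding A0_def space_info .
  qed
  have prob_A0: "prob A0 = (\<Prod>i\<in>I. prob (A (Inl i)))"
  proof (cases "I = {}")
    case True
    then show ?thesis by (simp add: A0_def prob_space)
  next
    case False
    have "prob (\<Inter>j\<in>Gap ` I. A (Inl (case j of Gap i \<Rightarrow> i))) = (\<Prod>j\<in>Gap ` I. prob (A (Inl (case j of Gap i \<Rightarrow> i))))"
      using False fin gap_event by (intro indep_setsD[OF independent_sources]) auto
    moreover have "A0 = (\<Inter>i\<in>I. A (Inl i))" using False A by (auto simp: A0_def I_def)
    ultimately show ?thesis by (simp add: prod.reindex inj_on_def)
  qed
  have "(\<Inter>j\<in>J. A j) = A0 \<inter> {\<omega> \<in> space ?M. \<forall>j\<in>{..<n}. \<sigma> j \<omega> \<in> C j}"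
  proof -
    have "A (Inr j) = {\<omega> \<in> space ?M. \<sigma> j \<omega> \<in> C j}" if "j \<in> K" for j
      using A[of "Inr j"] that by (auto simp: K_def C_def)
    then have K: "x \<in> A (Inr j) \<longleftrightarrow> x \<in> space ?M \<and> \<sigma> j x \<in> C j" if "j \<in> K" for x j
      using that by blast
    have sp: "x \<in> space ?M" if "x \<in> (\<Inter>j\<in>J. A j)" for x using that J(1) A by blast
    show ?thesis
    proof (intro set_eqI iffI)
      fix x assume x: "x \<in> (\<Inter>j\<in>J. A j)"
      then have "\<sigma> j x \<in> C j" for j using K[of j x] J_eq by (cases "j \<in> K") (auto simp: C_def)
      then show "x \<in> A0 \<inter> {\<omega> \<in> space ?M. \<forall>j\<in>{..<n}. \<sigma> j \<omega> \<in> C j}"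
        using x sp[OF x] J_eq by (auto simp: A0_def)
    next
      fix x assume x: "x \<in> A0 \<inter> {\<omega> \<in> space ?M. \<forall>j\<in>{..<n}. \<sigma> j \<omega> \<in> C j}"
      show "x \<in> (\<Inter>j\<in>J. A j)"
      proof
        fix y assume "y \<in> J"
        then consider i where "y = Inl i" "i \<in> I" | j where "y = Inr j" "j \<in> K" unfolding J_eq by blast
        then show "x \<in> A y" using x n K by cases (auto simp: A0_def)
      qed
    qed
  qed
  then have "prob (\<Inter>j\<in>J. A j) = prob A0 * (\<Prod>j<n. prob {\<omega> \<in> space ?M. S 0 \<omega> \<in> C j})"
    using B prob_slots[OF A0, of C n] by (auto simp: C_def K_def)
  also have "(\<Prod>j<n. prob {\<omega> \<in> space ?M. S 0 \<omega> \<in> C j}) = (\<Prod>j\<in>K. prob {\<omega> \<in> space ?M. S 0 \<omega> \<in> C j})"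
    using n by (intro prod.mono_neutral_right) (auto simp: C_def prob_space)
  also have "\<dots> = (\<Prod>j\<in>K. prob (A (Inr j)))"
  proof (rule prod.cong)
    fix j assume j: "j \<in> K"
    then have "A (Inr j) = {\<omega> \<in> space ?M. \<sigma> j \<omega> \<in> B (Inr j)}" using A[of "Inr j"] by (auto simp: K_def)
    then show "prob {\<omega> \<in> space ?M. S 0 \<omega> \<in> C j} = prob (A (Inr j))"
      using prob_slot_duration[of "B (Inr j)" j] B[of "Inr j"] j by (simp add: C_def K_def)
  qed simp
  also have "prob A0 * \<dots> = (\<Prod>j\<in>J. prob (A j))"
    unfolding J_eq prob_A0 using fin by (subst prod.union_disjoint) (auto simp: prod.reindex inj_on_def)
  finally show "prob (\<Inter>j\<in>J. A j) = (\<Prod>j\<in>J. prob (A j))" .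
qed

lemma slot_duration_identical: "distr (prob_of Q) borel (\<sigma> k) = distr (prob_of Q) borel (S 0)"
proof (rule measure_eqI)
  fix B assume "B \<in> sets (distr (prob_of Q) borel (\<sigma> k))"
  then show "emeasure (distr (prob_of Q) borel (\<sigma> k)) B = emeasure (distr (prob_of Q) borel (S 0)) B"
    using prob_slot_duration[of B k]
    by (simp add: emeasure_distr emeasure_eq_measure vimage_def Int_def conj_commute)
qed simp

sublocale slots: single_server "prob_of Q" "rate Q" "gap Q" \<sigma>
  using rate_pos gap_exponential gap_pos S_nonneg indep_gap_slot_duration slot_duration_identical
  by unfold_locales (auto simp: slot_duration_def)

lemma indep_gap_S: "indep_vars (\<lambda>_. borel) (case_sum (gap Q) S) UNIV"
proof -
  let ?g = "\<lambda>i :: nat + nat. case i of Inl j \<Rightarrow> Gap j | Inr j \<Rightarrow> Marg j"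
  have "indep_sets (\<lambda>i. sigma_sets (space (prob_of Q)) (\<Union>j\<in>{?g i}. source_events Q j)) UNIV"
  proof (rule indep_sets_collect_sigma)
    show "disjoint_family_on (\<lambda>i. {?g i}) UNIV"
      by (auto simp: disjoint_family_on_def split: sum.splits)
  qed (auto intro: indep_sets_mono_index[OF _ independent_sources] stable_family)
  then have "indep_sets (\<lambda>i. sets (knowledge {?g i})) UNIV" by (simp add: sets_info)
  moreover have "case_sum (gap Q) S i \<in> borel_measurable (knowledge {?g i})" for i
    using gap_knowledge S_knowledge by (cases i) auto
  then have "{case_sum (gap Q) S i -` A \<inter> space (prob_of Q) |A. A \<in> sets borel} \<subseteq> sets (knowledge {?g i})" for i
    using measurable_sets[of "case_sum (gap Q) S i" "knowledge {?g i}" borel] by auto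
  ultimately have "indep_sets (\<lambda>i. {case_sum (gap Q) S i -` A \<inter> space (prob_of Q) |A. A \<in> sets borel}) UNIV"
    by (rule indep_sets_mono_sets)
  then show ?thesis
    unfolding indep_vars_def2 by (auto split: sum.split)
qed

sublocale arrivals: single_server "prob_of Q" "rate Q" "gap Q" S
  using rate_pos gap_exponential gap_pos S_nonneg indep_gap_S S_identical
  by unfold_locales auto

end

section \<open>The expected number of Poisson arrivals\<close>

lemma suminf_erlang_density:
  fixes l x :: real
  assumes "0 < l" "0 \<le> x"
  shows "(\<Sum>k. ennreal (erlang_density k l x)) = ennreal l"
proof -
  have "(\<lambda>k. l * exp (- l * x) * ((l * x) ^ k /\<^sub>R fact k)) sums (l * exp (- l * x) * exp (l * x))"
    by (intro sums_mult exp_converges)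
  moreover have "l * exp (- l * x) * ((l * x) ^ k /\<^sub>R fact k) = erlang_density k l x" for k
    using assms by (simp add: erlang_density_def field_simps power_mult_distrib)
  moreover have "l * exp (- l * x) * exp (l * x) = l" by (simp add: mult.assoc exp_add[symmetric])
  ultimately have "(\<lambda>k. erlang_density k l x) sums l" by (simp only:)
  then show ?thesis using assms by (subst suminf_ennreal_eq) auto
qed

context facility_model
begin

lemma arrival_measurable [measurable]: "arrival Q i \<in> borel_measurable (prob_of Q)"
  unfolding arrival_def[abs_def] by measurable

lemma arrival_erlang: "distributed (prob_of Q) lborel (arrival Q k) (erlang_density k (rate Q))"
proof -
  have "indep_sets (\<lambda>i. source_events Q (Gap i)) UNIV"
  proof -
    have "indep_sets (\<lambda>i. sigma_sets (space (prob_of Q)) (\<Union>j\<in>{Gap i}. source_events Q j)) UNIV"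
      by (rule indep_sets_collect_sigma)
        (auto intro: indep_sets_mono_index[OF _ independent_sources] Int_stable_vimage simp: disjoint_family_on_def)
    then show ?thesis by (rule indep_sets_mono_sets) (auto intro: sigma_sets.Basic)
  qed
  then have "indep_vars (\<lambda>_. borel) (gap Q) {..k}"
    unfolding indep_vars_def2 by (auto intro: indep_sets_mono_index)
  then have "distributed (prob_of Q) lborel (\<lambda>\<omega>. \<Sum>i\<in>{..k}. gap Q i \<omega>) (erlang_density (card {..k} - 1) (rate Q))"
    by (intro exponential_distributed_sum rate_pos gap_exponential) auto
  then show ?thesis by (simp add: arrival_def[abs_def])
qed

text \<open>The arrival epochs are Erlang, and their densities add up, by the exponential series, to
  the constant renewal density \<open>rate Q\<close> on the nonnegative half-line.\<close>

lemma suminf_arrivals: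
  assumes "0 \<le> t"
  shows "(\<Sum>k. emeasure (prob_of Q) {\<omega> \<in> space (prob_of Q). arrival Q k \<omega> \<le> t}) = ennreal (rate Q * t)"
proof -
  have "emeasure (prob_of Q) {\<omega> \<in> space (prob_of Q). arrival Q k \<omega> \<le> t}
      = (\<integral>\<^sup>+ x. ennreal (erlang_density k (rate Q) x) * indicator {0..t} x \<partial>lborel)" for k
  proof -
    have "emeasure (prob_of Q) (arrival Q k -` {..t} \<inter> space (prob_of Q))
        = (\<integral>\<^sup>+ x. ennreal (erlang_density k (rate Q) x) * indicator {..t} x \<partial>lborel)"
      using distributed_emeasure[OF arrival_erlang, of "{..t}" k] by simp
    moreover have "arrival Q k -` {..t} \<inter> space (prob_of Q) = {\<omega> \<in> space (prob_of Q). arrival Q k \<omega> \<le> t}" by auto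
    moreover have "(\<integral>\<^sup>+ x. ennreal (erlang_density k (rate Q) x) * indicator {..t} x \<partial>lborel)
        = (\<integral>\<^sup>+ x. ennreal (erlang_density k (rate Q) x) * indicator {0..t} x \<partial>lborel)"
      by (rule nn_integral_cong) (auto simp: indicator_def erlang_density_def)
    ultimately show ?thesis by simp
  qed
  then have "(\<Sum>k. emeasure (prob_of Q) {\<omega> \<in> space (prob_of Q). arrival Q k \<omega> \<le> t})
      = (\<integral>\<^sup>+ x. (\<Sum>k. ennreal (erlang_density k (rate Q) x) * indicator {0..t} x) \<partial>lborel)"
    by (simp only:) (rule nn_integral_suminf[symmetric], simp)
  also have "\<dots> = (\<integral>\<^sup>+ x. ennreal (rate Q) * indicator {0..t} x \<partial>lborel)"
    using suminf_erlang_density[OF rate_pos]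
    by (intro nn_integral_cong) (auto simp: ennreal_suminf_multc indicator_def)
  also have "\<dots> = ennreal (rate Q * t)"
    using assms rate_pos by (simp add: nn_integral_cmult_indicator ennreal_mult)
  finally show ?thesis .
qed

text \<open>The weight of the stopping index N(t), the number of arrivals up to t: customers are
  numbered from 0, so k < N(t) means that customer k arrives by t. That he does is known at arrival
  k.\<close>

definition arrived :: "real \<Rightarrow> nat \<Rightarrow> 'a \<Rightarrow> real" where
  "arrived t = clock (gap Q) (\<lambda>_ x. x \<le> t)"

lemma arrived_eq: "arrived t k \<omega> = (if arrival Q k \<omega> \<le> t then 1 else 0)"
  by (simp add: arrived_def clock_def arrival_def)

lemma arrived_measurable [measurable]: "arrived t k \<in> borel_measurable (prob_of Q)"
  unfolding arrived_eq[abs_def] by measurable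

lemma nn_integral_arrived:
  "(\<integral>\<^sup>+ \<omega>. ennreal (arrived t k \<omega>) \<partial>prob_of Q) = emeasure (prob_of Q) {\<omega> \<in> space (prob_of Q). arrival Q k \<omega> \<le> t}"
proof -
  have "(\<integral>\<^sup>+ \<omega>. ennreal (arrived t k \<omega>) \<partial>prob_of Q)
      = (\<integral>\<^sup>+ \<omega>. indicator {\<omega> \<in> space (prob_of Q). arrival Q k \<omega> \<le> t} \<omega> \<partial>prob_of Q)"
    by (rule nn_integral_cong) (auto simp: arrived_eq indicator_def)
  then show ?thesis by simp
qed

lemma suminf_arrived: "0 \<le> t \<Longrightarrow> (\<Sum>k. \<integral>\<^sup>+ \<omega>. ennreal (arrived t k \<omega>) \<partial>prob_of Q) = ennreal (rate Q * t)"
  unfolding nn_integral_arrived by (rule suminf_arrivals)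

text \<open>Turns finiteness of a random set into a measurable condition.\<close>

lemma finite_arrivals_iff: "finite {i. arrival Q i \<omega> \<le> t} \<longleftrightarrow> (\<Sum>k. ennreal (arrived t k \<omega>)) < top"
proof
  assume fin: "finite {i. arrival Q i \<omega> \<le> t}"
  have "(\<Sum>k. ennreal (arrived t k \<omega>)) = (\<Sum>k\<in>{i. arrival Q i \<omega> \<le> t}. ennreal (arrived t k \<omega>))"
    by (rule suminf_finite[OF fin]) (simp add: arrived_eq)
  also have "\<dots> < top" using fin by simp
  finally show "(\<Sum>k. ennreal (arrived t k \<omega>)) < top" .
next
  assume "(\<Sum>k. ennreal (arrived t k \<omega>)) < top"
  then have "summable (\<lambda>k. arrived t k \<omega>)"
    by (intro summable_suminf_not_top) (auto simp: arrived_eq)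
  from summable_LIMSEQ_zero[OF this] have "\<forall>\<^sub>F k in sequentially. arrived t k \<omega> < 1"
    by (rule order_tendstoD) simp
  then obtain n where "\<And>k. n \<le> k \<Longrightarrow> arrived t k \<omega> < 1" by (auto simp: eventually_sequentially)
  then have "i < n" if "arrival Q i \<omega> \<le> t" for i
    using that by (rule_tac ccontr) (force simp: arrived_eq not_less)
  then have "{i. arrival Q i \<omega> \<le> t} \<subseteq> {..<n}" by auto
  then show "finite {i. arrival Q i \<omega> \<le> t}" by (rule finite_subset) simp
qed

lemma AE_finite_arrivals: "0 \<le> t \<Longrightarrow> AE \<omega> in prob_of Q. finite {i. arrival Q i \<omega> \<le> t}"
proof -
  assume t: "0 \<le> t"
  have "(\<integral>\<^sup>+ \<omega>. (\<Sum>k. ennreal (arrived t k \<omega>)) \<partial>prob_of Q) = ennreal (rate Q * t)"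
    using suminf_arrived[OF t] by (simp add: nn_integral_suminf)
  then have "AE \<omega> in prob_of Q. (\<Sum>k. ennreal (arrived t k \<omega>)) \<noteq> \<infinity>"
    by (intro nn_integral_noteq_infinite) auto
  then show ?thesis
    unfolding finite_arrivals_iff by eventually_elim (simp add: less_top)
qed

end

section \<open>Waiting times compared with Lindley's recursion by slots\<close>

context service_durations
begin

lemma service_path_S: "\<omega> \<in> space (prob_of Q) \<Longrightarrow> service_path (\<lambda>j. arrival Q j \<omega>) (\<lambda>j. S j \<omega>)"
  by (intro service_path S_nonneg)

lemma slots_D:
  assumes "\<omega> \<in> space (prob_of Q)"
  shows "slots.D k \<omega> = slot_start Q S k \<omega> - arrival Q k \<omega>"
proof -
  interpret s: service_path "rule Q (seed Q \<omega>)" "\<lambda>j. arrival Q j \<omega>" "\<lambda>j. S j \<omega>"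
    using assms by (rule service_path_S)
  have "lindley (\<lambda>k. \<sigma> k \<omega>) (\<lambda>k. gap Q k \<omega>) n
      = lindley (\<lambda>j. S (cust (rule Q (seed Q \<omega>)) (\<lambda>j. arrival Q j \<omega>) (\<lambda>j. S j \<omega>) j) \<omega>) (\<lambda>j. arrival Q j \<omega> - arrival Q (j - 1) \<omega>) n" for n
    by (induction n) (simp_all add: arrival_diff slot_duration_def slot_customer_def)
  then show ?thesis
    unfolding slots.D_def slot_start_def by (simp only: s.start_lindley)
qed

lemma slots_empty:
  assumes "\<omega> \<in> space (prob_of Q)" "slots.empty m \<omega>"
  shows "free (rule Q (seed Q \<omega>)) (\<lambda>j. arrival Q j \<omega>) (\<lambda>j. S j \<omega>) m < arrival Q m \<omega>"
proof (cases m)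
  case 0
  then show ?thesis using gap_pos[OF assms(1), of 0] by (simp add: free_def arrival_def)
next
  case (Suc n)
  then show ?thesis
    using assms(2) arrival_diff[of n \<omega>] slots_D[OF assms(1), of n]
    by (simp add: slots.empty_def slots.load_def free_def slot_start_def slot_duration_def slot_customer_def)
qed

lemma weight_initial:
  assumes f: "slots.weight f" and \<omega>: "\<omega> \<in> space (prob_of Q)"
  obtains m where "m \<le> n" "\<And>k. k < n \<Longrightarrow> f k \<omega> = (if k < m then 1 else 0)"
proof -
  define m where "m = (LEAST m. m = n \<or> f m \<omega> = 0)"
  have m: "m = n \<or> f m \<omega> = 0" unfolding m_def by (rule LeastI[of _ n]) simp
  have "m \<le> n" unfolding m_def by (rule Least_le) simp
  moreover have "f k \<omega> = (if k < m then 1 else 0)" if "k < n" for k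
  proof (cases "k < m")
    case True
    then have "f k \<omega> \<noteq> 0" using not_less_Least[of k "\<lambda>m. m = n \<or> f m \<omega> = 0"] by (auto simp: m_def)
    then show ?thesis using True slots.weightD(2)[OF f \<omega>, of k] by auto
  next
    case False
    then have "f m \<omega> = 0" using m that by auto
    then have "f k \<omega> = 0"
      using slots.weight_antimono[OF f \<omega>, of m k] slots.weightD(4)[OF f \<omega>, of k] False by simp
    then show ?thesis using False by simp
  qed
  ultimately show thesis by (rule that)
qed

lemma waiting_ge:
  assumes f: "slots.weight f" and \<omega>: "\<omega> \<in> space (prob_of Q)"
  shows "(\<Sum>k<n. ennreal (f k \<omega> * slots.D k \<omega>)) \<le> (\<Sum>i<n. ennreal (f i \<omega>) * waiting_time Q S i \<omega>)"
proof -
  obtain m where m: "m \<le> n" "\<And>k. k < n \<Longrightarrow> f k \<omega> = (if k < m then 1 else 0)"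
    using weight_initial[OF f \<omega>, of n] by blast
  interpret s: service_path "rule Q (seed Q \<omega>)" "\<lambda>j. arrival Q j \<omega>" "\<lambda>j. S j \<omega>"
    using \<omega> by (rule service_path_S)
  have "(\<Sum>k<n. ennreal (f k \<omega> * slots.D k \<omega>)) = (\<Sum>k<m. ennreal (slots.D k \<omega>))"
    using m by (intro sum.mono_neutral_cong_right) auto
  also have "\<dots> \<le> (\<Sum>i<m. waiting_time Q S i \<omega>)"
    using s.sum_wait_ge[of m]
    by (simp add: slots_D[OF \<omega>] waiting_time_wait slot_start_def)
  also have "\<dots> = (\<Sum>i<n. ennreal (f i \<omega>) * waiting_time Q S i \<omega>)"
    using m by (intro sum.mono_neutral_cong_left) auto
  finally show ?thesis .
qed

text \<open>\<open>busy f\<close> equals 1 before the first index m at which f has stopped and the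
  arrival finds the system empty. The slots below m are what \<open>sum_wait_le\<close> compares
  with.\<close>

lemma waiting_le:
  assumes f: "slots.weight f" and \<omega>: "\<omega> \<in> space (prob_of Q)"
    and ex: "\<exists>m. f m \<omega> = 0 \<and> slots.empty m \<omega>"
  shows "(\<Sum>i<n. ennreal (f i \<omega>) * waiting_time Q S i \<omega>) \<le> (\<Sum>k. ennreal (slots.busy f k \<omega> * slots.D k \<omega>))"
proof -
  define m where "m = (LEAST m. f m \<omega> = 0 \<and> slots.empty m \<omega>)"
  have m: "f m \<omega> = 0 \<and> slots.empty m \<omega>" unfolding m_def by (rule LeastI_ex) (rule ex)
  interpret s: service_path "rule Q (seed Q \<omega>)" "\<lambda>j. arrival Q j \<omega>" "\<lambda>j. S j \<omega>"
    using \<omega> by (rule service_path_S)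
  have f0: "f i \<omega> = 0" if "m \<le> i" for i
    using slots.weight_antimono[OF f \<omega> that] slots.weightD(4)[OF f \<omega>, of i] m by simp
  have "(\<Sum>i<n. ennreal (f i \<omega>) * waiting_time Q S i \<omega>) = (\<Sum>i<min n m. ennreal (f i \<omega>) * waiting_time Q S i \<omega>)"
    using f0 by (intro sum.mono_neutral_right) auto
  also have "\<dots> \<le> (\<Sum>i<min n m. 1 * waiting_time Q S i \<omega>)"
    using slots.weightD(5)[OF f \<omega>] by (intro sum_mono mult_right_mono) auto
  also have "\<dots> \<le> (\<Sum>k<m. ennreal (slots.D k \<omega>))"
    using s.sum_wait_le[OF slots_empty[OF \<omega>], of m "min n m"] m
    by (simp add: slots_D[OF \<omega>] waiting_time_wait slot_start_def)
  also have "\<dots> = (\<Sum>k<m. ennreal (slots.busy f k \<omega> * slots.D k \<omega>))"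
  proof (rule sum.cong)
    fix k assume "k \<in> {..<m}"
    then have "slots.busy f k \<omega> = 1"
      using not_less_Least[of _ "\<lambda>m. f m \<omega> = 0 \<and> slots.empty m \<omega>"] unfolding slots.busy_def m_def
      by (meson lessThan_iff order_le_less_trans)
    then show "ennreal (slots.D k \<omega>) = ennreal (slots.busy f k \<omega> * slots.D k \<omega>)" by simp
  qed simp
  also have "\<dots> \<le> (\<Sum>k. ennreal (slots.busy f k \<omega> * slots.D k \<omega>))"
    by (rule sum_le_suminf) auto
  finally show ?thesis .
qed

text \<open>No \<open>WCost\<close> source is required in J, so waiting times will be independent of
  the waiting cost rates.\<close>

lemma waiting_time_knowledge:
  assumes "Seed \<in> J" "range Gap \<subseteq> J" "range Marg \<subseteq> J"
  shows "waiting_time Q S i \<in> borel_measurable (knowledge J)"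
proof -
  have c: "slot_customer Q S k \<in> measurable (knowledge J) (count_space UNIV)"
    and s: "slot_start Q S k \<in> borel_measurable (knowledge J)" for k
  proof -
    have "gap Q j \<in> borel_measurable (knowledge J)" "S j \<in> borel_measurable (knowledge J)" for j
      using gap_knowledge[of j J] measurable_info_mono[OF S_knowledge[of j], of J] assms by auto
    then have "slot_customer Q S k \<in> measurable (knowledge J) (count_space UNIV)
        \<and> slot_start Q S k \<in> borel_measurable (knowledge J)"
      by (intro slots_measurable space_info seed_knowledge assms S_nonneg)
    then show "slot_customer Q S k \<in> measurable (knowledge J) (count_space UNIV)"
      "slot_start Q S k \<in> borel_measurable (knowledge J)" by auto
  qed
  have a: "arrival Q i \<in> borel_measurable (knowledge J)"
    unfolding arrival_def[abs_def] using gap_knowledge[of _ J] assms(2) by (intro borel_measurable_sum) auto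
  \<comment> \<open>A countable infimum with default value infinity, which is visibly measurable; at
    most one k contributes.\<close>
  have eq: "waiting_time Q S i \<omega> = (INF k. if slot_customer Q S k \<omega> = i then ennreal (slot_start Q S k \<omega> - arrival Q i \<omega>) else \<infinity>)"
    if \<omega>: "\<omega> \<in> space (prob_of Q)" for \<omega>
  proof -
    interpret s: service_path "rule Q (seed Q \<omega>)" "\<lambda>j. arrival Q j \<omega>" "\<lambda>j. S j \<omega>"
      using \<omega> by (rule service_path_S)
    show ?thesis
    proof (cases "\<exists>k. slot_customer Q S k \<omega> = i")
      case True
      then obtain k where k: "slot_customer Q S k \<omega> = i" by blast
      have u: "slot_customer Q S j \<omega> = i \<longleftrightarrow> j = k" for j
        using k injD[OF s.cust_inj, of j k] by (auto simp: slot_customer_def)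
      have "waiting_time Q S i \<omega> = ennreal (slot_start Q S k \<omega> - arrival Q i \<omega>)"
        using s.wait_cust[of k] k by (simp add: waiting_time_wait slot_start_def slot_customer_def)
      moreover have "(INF j. if slot_customer Q S j \<omega> = i then ennreal (slot_start Q S j \<omega> - arrival Q i \<omega>) else \<infinity>)
          = ennreal (slot_start Q S k \<omega> - arrival Q i \<omega>)"
        unfolding u by (intro antisym INF_greatest INF_lower2[of k]) auto
      ultimately show ?thesis by simp
    next
      case False
      then have "waiting_time Q S i \<omega> = \<infinity>"
        using s.wait_unserved[of i] by (auto simp: waiting_time_wait slot_customer_def)
      with False show ?thesis by simp
    qed
  qed
  have "(\<lambda>\<omega>. INF k. if slot_customer Q S k \<omega> = i then ennreal (slot_start Q S k \<omega> - arrival Q i \<omega>) else \<infinity>)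
      \<in> borel_measurable (knowledge J)"
    using a c s by (intro borel_measurable_INF) (auto intro!: measurable_If)
  then show ?thesis using eq by (subst measurable_cong) auto
qed

lemma waiting_time_measurable [measurable]: "waiting_time Q S i \<in> borel_measurable (prob_of Q)"
  by (rule measurable_info_M[OF waiting_time_knowledge[of UNIV]]) auto

end

text \<open>u and v need not be the positive and negative parts of f, and v may have an infinite
  integral. The argument adds instead of subtracting: positive part plus v equals negative part plus
  u, an identity in \<open>ennreal\<close> that integrates termwise.\<close>

lemma expect_diff:
  assumes f: "f \<in> borel_measurable M" and u: "u \<in> borel_measurable M" and v: "v \<in> borel_measurable M"
    and eq: "AE \<omega> in M. f \<omega> = enn2ereal (u \<omega>) - enn2ereal (v \<omega>)"
    and fin: "(\<integral>\<^sup>+ \<omega>. u \<omega> \<partial>M) < \<infinity>"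
  shows "has_expect M f" "expect M f = enn2ereal (\<integral>\<^sup>+ \<omega>. u \<omega> \<partial>M) - enn2ereal (\<integral>\<^sup>+ \<omega>. v \<omega> \<partial>M)"
proof -
  note [measurable] = f u v
  let ?P = "\<integral>\<^sup>+ \<omega>. e2ennreal (f \<omega>) \<partial>M" and ?N = "\<integral>\<^sup>+ \<omega>. e2ennreal (- f \<omega>) \<partial>M"
  let ?U = "\<integral>\<^sup>+ \<omega>. u \<omega> \<partial>M" and ?V = "\<integral>\<^sup>+ \<omega>. v \<omega> \<partial>M"
  have fin_u: "AE \<omega> in M. u \<omega> \<noteq> \<infinity>" using fin by (intro nn_integral_noteq_infinite) auto
  have point: "e2ennreal (enn2ereal a - enn2ereal b) + b = e2ennreal (- (enn2ereal a - enn2ereal b)) + a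
      \<and> e2ennreal (enn2ereal a - enn2ereal b) \<le> a" if "a \<noteq> \<infinity>" for a b :: ennreal
  proof -
    obtain r where r: "a = ennreal r" "0 \<le> r" using \<open>a \<noteq> \<infinity>\<close> by (cases a) auto
    show ?thesis
    proof (cases b)
      case (real q)
      then show ?thesis
        using r by (cases "r \<le> q") (auto simp: ennreal_neg ennreal_plus[symmetric] simp del: ennreal_plus intro!: ennreal_leI)
    next
      case top
      then show ?thesis using r by (simp add: e2ennreal_neg)
    qed
  qed
  have "AE \<omega> in M. e2ennreal (f \<omega>) + v \<omega> = e2ennreal (- f \<omega>) + u \<omega>"
    using eq fin_u by eventually_elim (use point in auto)
  then have "(\<integral>\<^sup>+ \<omega>. e2ennreal (f \<omega>) + v \<omega> \<partial>M) = (\<integral>\<^sup>+ \<omega>. e2ennreal (- f \<omega>) + u \<omega> \<partial>M)"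
    by (rule nn_integral_cong_AE)
  then have sum: "?P + ?V = ?N + ?U" by (simp add: nn_integral_add)
  have "AE \<omega> in M. e2ennreal (f \<omega>) \<le> u \<omega>"
    using eq fin_u by eventually_elim (use point in auto)
  then have "?P \<le> ?U" by (rule nn_integral_mono_AE)
  then have P: "?P < \<infinity>" using fin by simp
  then show "has_expect M f" unfolding has_expect_def by simp
  have "enn2ereal ?P - enn2ereal ?N = enn2ereal ?U - enn2ereal ?V"
    using sum P fin
    by (cases ?P; cases ?N; cases ?U; cases ?V) (auto simp: enn2ereal_ennreal ennreal_plus[symmetric] simp del: ennreal_plus)
  then show "expect M f = enn2ereal ?U - enn2ereal ?V" unfolding expect_def .
qed

context service_durations
begin

lemma waiting_sum_ge:
  assumes f: "slots.weight f"
  shows "(\<Sum>k<n. \<integral>\<^sup>+ \<omega>. ennreal (f k \<omega> * slots.D k \<omega>) \<partial>prob_of Q)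
    \<le> (\<Sum>i<n. \<integral>\<^sup>+ \<omega>. ennreal (f i \<omega>) * waiting_time Q S i \<omega> \<partial>prob_of Q)"
proof -
  have [measurable]: "f k \<in> borel_measurable (prob_of Q)" for k using slots.weightD(6)[OF f] .
  have "(\<integral>\<^sup>+ \<omega>. (\<Sum>k<n. ennreal (f k \<omega> * slots.D k \<omega>)) \<partial>prob_of Q)
      \<le> (\<integral>\<^sup>+ \<omega>. (\<Sum>i<n. ennreal (f i \<omega>) * waiting_time Q S i \<omega>) \<partial>prob_of Q)"
    using waiting_ge[OF f] by (intro nn_integral_mono) auto
  then show ?thesis by (simp add: nn_integral_sum)
qed

lemma mean_waiting_finite:
  assumes "mean_waiting_time Q S < \<infinity>"
  shows "\<exists>N B. 0 \<le> B \<and>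
    (\<forall>n\<ge>N. (\<Sum>k<n. \<integral>\<^sup>+ \<omega>. ennreal (slots.D k \<omega>) \<partial>prob_of Q) \<le> ennreal (B * real n))"
proof -
  let ?a = "\<lambda>n. (\<Sum>i<n. \<integral>\<^sup>+ \<omega>. waiting_time Q S i \<omega> \<partial>prob_of Q) / of_nat n"
  obtain b where b: "limsup ?a < b" "b < \<infinity>"
    using assms dense unfolding mean_waiting_time_def by blast
  then obtain B where B: "b = ennreal B" "0 \<le> B" by (cases b) auto
  from Limsup_lessD[OF b(1)] obtain N where N: "\<And>n. N \<le> n \<Longrightarrow> ?a n < b"
    by (auto simp: eventually_sequentially)
  show ?thesis
  proof (intro exI[of _ "max 1 N"] exI[of _ B] conjI allI impI B(2))
    fix n assume n: "max 1 N \<le> n"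
    have w: "slots.weight (clock (gap Q) (\<lambda>k _. k < n))" by (rule slots.weight_clock[OF slots.clock_pred_less])
    have "(\<Sum>k<n. \<integral>\<^sup>+ \<omega>. ennreal (slots.D k \<omega>) \<partial>prob_of Q) \<le> (\<Sum>i<n. \<integral>\<^sup>+ \<omega>. waiting_time Q S i \<omega> \<partial>prob_of Q)"
      using waiting_sum_ge[OF w, of n] by (simp add: clock_def)
    also have "\<dots> = ?a n * of_nat n"
      using n by (subst ennreal_divide_times) (simp add: ennreal_divide_self of_nat_less_top)
    also have "\<dots> \<le> b * of_nat n" using N[of n] n by (intro mult_right_mono) auto
    also have "\<dots> = ennreal (B * real n)" using B by (simp add: ennreal_mult ennreal_of_nat_eq_real_of_nat)
    finally show "(\<Sum>k<n. \<integral>\<^sup>+ \<omega>. ennreal (slots.D k \<omega>) \<partial>prob_of Q) \<le> ennreal (B * real n)" .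
  qed
qed

text \<open>The mean waiting time dominates the averages of the slot recursion, so
  \<open>second_moment_finite\<close> applies to the durations by slot, which have the same law as
  \<open>S 0\<close>.\<close>

lemma finite_moments:
  assumes "mean_waiting_time Q S < \<infinity>"
  shows "integrable (prob_of Q) (\<lambda>\<omega>. (S 0 \<omega>)\<^sup>2)" "expectation (S 0) < 1 / rate Q"
proof -
  obtain B N where NB: "0 \<le> B"
    "\<And>n. N \<le> n \<Longrightarrow> (\<Sum>k<n. \<integral>\<^sup>+ \<omega>. ennreal (slots.D k \<omega>) \<partial>prob_of Q) \<le> ennreal (B * real n)"
    using mean_waiting_finite[OF assms] by auto
  note m = slots.second_moment_finite[OF NB(2) NB(1)]
  have "integrable (distr (prob_of Q) borel (\<sigma> 0)) (\<lambda>x. x\<^sup>2)" using m(1) by (simp add: integrable_distr_eq)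
  then show "integrable (prob_of Q) (\<lambda>\<omega>. (S 0 \<omega>)\<^sup>2)"
    unfolding slot_duration_identical by (simp add: integrable_distr_eq)
  have "expectation (\<sigma> 0) = integral\<^sup>L (distr (prob_of Q) borel (\<sigma> 0)) (\<lambda>x. x)" by (simp add: integral_distr)
  also have "\<dots> = expectation (S 0)" unfolding slot_duration_identical by (simp add: integral_distr)
  finally show "expectation (S 0) < 1 / rate Q" using m(3) by simp
qed

end

section \<open>Long-run averages for a load below 1\<close>

locale stable_durations = service_durations +
  assumes S_square_integrable: "integrable (prob_of Q) (\<lambda>\<omega>. (S 0 \<omega>)\<^sup>2)"
    and load: "expectation (S 0) < 1 / rate Q"
begin

sublocale arrivals: single_server_L2 "prob_of Q" "rate Q" "gap Q" S
  by unfold_locales (rule S_square_integrable)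

sublocale slots: single_server_L2 "prob_of Q" "rate Q" "gap Q" \<sigma>
proof unfold_locales
  have "integrable (distr (prob_of Q) borel (S 0)) (\<lambda>x. x\<^sup>2)" using S_square_integrable by (simp add: integrable_distr_eq)
  then show "integrable (prob_of Q) (\<lambda>\<omega>. (\<sigma> 0 \<omega>)\<^sup>2)"
    unfolding slot_duration_identical[of 0, symmetric] by (simp add: integrable_distr_eq)
qed

lemma slots_moments: "slots.m1 = expectation (S 0)" "slots.m2 = expectation (\<lambda>\<omega>. (S 0 \<omega>)\<^sup>2)"
proof -
  have "(\<integral>\<omega>. g (\<sigma> 0 \<omega>) \<partial>prob_of Q) = (\<integral>\<omega>. g (S 0 \<omega>) \<partial>prob_of Q)" if [measurable]: "g \<in> borel_measurable borel" for g :: "real \<Rightarrow> real"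
  proof -
    have "(\<integral>\<omega>. g (\<sigma> 0 \<omega>) \<partial>prob_of Q) = integral\<^sup>L (distr (prob_of Q) borel (\<sigma> 0)) g" by (simp add: integral_distr)
    also have "\<dots> = (\<integral>\<omega>. g (S 0 \<omega>) \<partial>prob_of Q)" unfolding slot_duration_identical by (simp add: integral_distr)
    finally show ?thesis .
  qed
  from this[of "\<lambda>x. x"] this[of "\<lambda>x. x\<^sup>2"]
  show "slots.m1 = expectation (S 0)" "slots.m2 = expectation (\<lambda>\<omega>. (S 0 \<omega>)\<^sup>2)"
    unfolding slots.m1_def slots.m2_def by auto
qed

lemma slots_load: "slots.m1 < 1 / rate Q"
  unfolding slots_moments by (rule load)

text \<open>\<open>workload\<close> lists durations by arrival, so this concerns the instance
  \<open>arrivals\<close>, not \<open>slots\<close>.\<close>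

lemma stable_queue: "stable_queue Q S"
proof -
  have "workload Q S n \<omega> = arrivals.D n \<omega>" for n \<omega>
    by (induction n) (simp_all add: arrivals.D_0 arrivals.D_Suc)
  then have "workload Q S = arrivals.D" by blast
  then show ?thesis
    using arrivals.stable load unfolding stable_queue_def arrivals.m1_def by simp
qed

lemma waiting_sum_le:
  assumes f: "slots.weight f" and e: "0 < e" and \<nu>: "\<And>n. slots.count f n \<le> \<nu>"
  shows "(\<Sum>i<n. \<integral>\<^sup>+ \<omega>. ennreal (f i \<omega>) * waiting_time Q S i \<omega> \<partial>prob_of Q)
    \<le> ennreal (slots.mean_delay * ((1 + e * slots.m2 / (1 / rate Q - slots.m1)) * \<nu>
        + (1 / e + 1 / rate Q) / (1 / rate Q - slots.m1)))"
proof -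
  have [measurable]: "f k \<in> borel_measurable (prob_of Q)" "slots.busy f k \<in> borel_measurable (prob_of Q)" for k
    using slots.weightD(6)[OF f] slots.weightD(6)[OF slots.weight_busy[OF f]] .
  have "(\<Sum>i<n. \<integral>\<^sup>+ \<omega>. ennreal (f i \<omega>) * waiting_time Q S i \<omega> \<partial>prob_of Q)
      = (\<integral>\<^sup>+ \<omega>. (\<Sum>i<n. ennreal (f i \<omega>) * waiting_time Q S i \<omega>) \<partial>prob_of Q)"
    by (simp add: nn_integral_sum)
  also have "\<dots> \<le> (\<integral>\<^sup>+ \<omega>. (\<Sum>k. ennreal (slots.busy f k \<omega> * slots.D k \<omega>)) \<partial>prob_of Q)"
  proof (rule nn_integral_mono_AE)
    show "AE \<omega> in prob_of Q. (\<Sum>i<n. ennreal (f i \<omega>) * waiting_time Q S i \<omega>) \<le> (\<Sum>k. ennreal (slots.busy f k \<omega> * slots.D k \<omega>))"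
      using slots.AE_empty[OF f slots_load \<nu>] AE_space by eventually_elim (rule waiting_le[OF f])
  qed
  also have "\<dots> = (\<Sum>k. \<integral>\<^sup>+ \<omega>. ennreal (slots.busy f k \<omega> * slots.D k \<omega>) \<partial>prob_of Q)"
    by (rule nn_integral_suminf) measurable
  also note slots.busy_total_le[OF f slots_load e \<nu>]
  finally show ?thesis .
qed

lemma mean_waiting_time_finite: "mean_waiting_time Q S < \<infinity>"
proof -
  \<comment> \<open>The bound of \<open>waiting_sum_le\<close> for e = 1 and stopping index n, whose
    additive term is absorbed by a multiple of n because n is at least 1.\<close>
  define c where "c = slots.mean_delay * ((1 + 1 * slots.m2 / (1 / rate Q - slots.m1))
        + (1 / 1 + 1 / rate Q) / (1 / rate Q - slots.m1))"
  have md: "0 \<le> slots.mean_delay" by (rule slots.mean_delay_nonneg[OF slots_load])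
  have c: "0 \<le> c" unfolding c_def using md slots_load slots.m2_nonneg rate_pos
    by (intro mult_nonneg_nonneg add_nonneg_nonneg divide_nonneg_nonneg) auto
  have "(\<Sum>i<n. \<integral>\<^sup>+ \<omega>. waiting_time Q S i \<omega> \<partial>prob_of Q) / of_nat n \<le> ennreal c" if n: "1 \<le> n" for n
  proof -
    let ?f = "clock (gap Q) (\<lambda>k _. k < n)"
    have w: "slots.weight ?f" by (rule slots.weight_clock[OF slots.clock_pred_less])
    have cnt: "slots.count ?f k \<le> real n" for k
    proof -
      have e: "(\<integral>\<omega>. ?f j \<omega> \<partial>prob_of Q) = (if j < n then 1 else 0)" for j by (simp add: clock_def prob_space)
      have "slots.count ?f k = (\<Sum>j\<in>{..<k} \<inter> {..<n}. 1)"
        unfolding slots.count_def e by (intro sum.mono_neutral_cong_right) auto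
      also have "\<dots> \<le> real n" using card_mono[of "{..<n}" "{..<k} \<inter> {..<n}"] by simp
      finally show ?thesis .
    qed
    have "(\<Sum>i<n. \<integral>\<^sup>+ \<omega>. waiting_time Q S i \<omega> \<partial>prob_of Q)
        = (\<Sum>i<n. \<integral>\<^sup>+ \<omega>. ennreal (?f i \<omega>) * waiting_time Q S i \<omega> \<partial>prob_of Q)"
      by (intro sum.cong) (simp_all add: clock_def)
    also have "\<dots> \<le> ennreal (slots.mean_delay * ((1 + 1 * slots.m2 / (1 / rate Q - slots.m1)) * real n
        + (1 / 1 + 1 / rate Q) / (1 / rate Q - slots.m1)))"
      by (rule waiting_sum_le[OF w _ cnt]) simp
    also have "\<dots> \<le> ennreal (c * real n)"
    proof (rule ennreal_leI)
      have "0 \<le> (1 / 1 + 1 / rate Q) / (1 / rate Q - slots.m1)" using rate_pos slots_load by simp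
      then have "(1 / 1 + 1 / rate Q) / (1 / rate Q - slots.m1) * 1 \<le> (1 / 1 + 1 / rate Q) / (1 / rate Q - slots.m1) * real n"
        using n by (intro mult_left_mono) auto
      then show "slots.mean_delay * ((1 + 1 * slots.m2 / (1 / rate Q - slots.m1)) * real n
        + (1 / 1 + 1 / rate Q) / (1 / rate Q - slots.m1)) \<le> c * real n"
        unfolding c_def mult.assoc by (intro mult_left_mono md) (simp add: distrib_right)
    qed
    also have "\<dots> = ennreal c * of_nat n" using c by (simp add: ennreal_mult ennreal_of_nat_eq_real_of_nat)
    finally have "(\<Sum>i<n. \<integral>\<^sup>+ \<omega>. waiting_time Q S i \<omega> \<partial>prob_of Q) / of_nat n \<le> ennreal c * of_nat n / of_nat n"
      by (intro divide_right_mono_ennreal)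
    also have "\<dots> = ennreal c" using n by (intro mult_divide_eq_ennreal) auto
    finally show ?thesis .
  qed
  then have "mean_waiting_time Q S \<le> ennreal c"
    unfolding mean_waiting_time_def by (intro Limsup_bounded eventually_sequentiallyI[of 1])
  then show ?thesis by (simp add: le_less_trans)
qed

definition total_wait :: "real \<Rightarrow> ennreal" where
  "total_wait t = (\<Sum>i. \<integral>\<^sup>+ \<omega>. ennreal (arrived t i \<omega>) * waiting_time Q S i \<omega> \<partial>prob_of Q)"

lemma weight_arrived: "slots.weight (arrived t)"
  unfolding arrived_def by (rule slots.weight_clock[OF slots.clock_pred_le])

lemma sums_arrived:
  assumes "0 \<le> t"
  shows "(\<lambda>k. \<integral>\<omega>. arrived t k \<omega> \<partial>prob_of Q) sums (rate Q * t)"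
proof -
  have nn: "0 \<le> (\<integral>\<omega>. arrived t k \<omega> \<partial>prob_of Q)" for k
    by (rule integral_nonneg_AE) (simp add: arrived_eq)
  have "(\<integral>\<^sup>+ \<omega>. ennreal (arrived t k \<omega>) \<partial>prob_of Q) = ennreal (\<integral>\<omega>. arrived t k \<omega> \<partial>prob_of Q)" for k
    by (intro nn_integral_eq_integral slots.weight_integrable weight_arrived) (simp add: arrived_eq)
  then have s: "(\<Sum>k. ennreal (\<integral>\<omega>. arrived t k \<omega> \<partial>prob_of Q)) = ennreal (rate Q * t)"
    using suminf_arrived[OF assms] by simp
  then have "summable (\<lambda>k. \<integral>\<omega>. arrived t k \<omega> \<partial>prob_of Q)"
    using nn by (intro summable_suminf_not_top) auto
  moreover from suminf_ennreal[OF nn] s this have "(\<Sum>k. \<integral>\<omega>. arrived t k \<omega> \<partial>prob_of Q) = rate Q * t"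
    using assms rate_pos nn by (simp add: suminf_ennreal2 suminf_nonneg)
  ultimately show ?thesis by (simp add: sums_iff)
qed

lemma count_arrived:
  assumes "0 \<le> t"
  shows "slots.count (arrived t) n \<le> rate Q * t" "(\<lambda>n. slots.count (arrived t) n) \<longlonglongrightarrow> rate Q * t"
proof -
  show lim: "(\<lambda>n. slots.count (arrived t) n) \<longlonglongrightarrow> rate Q * t"
    using sums_arrived[OF assms] unfolding slots.count_def sums_def .
  have "incseq (\<lambda>n. slots.count (arrived t) n)"
    unfolding slots.count_def by (intro incseq_SucI) (simp add: integral_nonneg_AE arrived_eq)
  then show "slots.count (arrived t) n \<le> rate Q * t" using lim by (rule incseq_le)
qed

lemma total_wait_le:
  assumes "0 \<le> t" "0 < e"
  shows "total_wait t \<le> ennreal (slots.mean_delay * ((1 + e * slots.m2 / (1 / rate Q - slots.m1)) * (rate Q * t)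
        + (1 / e + 1 / rate Q) / (1 / rate Q - slots.m1)))"
  unfolding total_wait_def
  by (intro suminf_le_const waiting_sum_le weight_arrived assms count_arrived(1)) simp

text \<open>\<open>total_ge\<close> has one constant for all clocks, so C does not depend on t; then
  n tends to infinity for fixed t.\<close>

lemma total_wait_ge:
  assumes "0 < e"
  shows "\<exists>C. \<forall>t\<ge>0. ennreal ((slots.mean_delay - e) * (rate Q * t) - C) \<le> total_wait t"
proof -
  obtain C where C: "\<And>P n. clock_pred P \<Longrightarrow>
    ennreal ((slots.mean_delay - e) * slots.count (clock (gap Q) P) n - C)
      \<le> (\<Sum>k<n. \<integral>\<^sup>+ \<omega>. ennreal (clock (gap Q) P k \<omega> * slots.D k \<omega>) \<partial>prob_of Q)"
    using slots.total_ge[OF slots_load assms] by blast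
  have "ennreal ((slots.mean_delay - e) * (rate Q * t) - C) \<le> total_wait t" if t: "0 \<le> t" for t
  proof (rule LIMSEQ_le_const2)
    show "(\<lambda>n. ennreal ((slots.mean_delay - e) * slots.count (arrived t) n - C))
        \<longlonglongrightarrow> ennreal ((slots.mean_delay - e) * (rate Q * t) - C)"
      by (intro tendsto_ennrealI tendsto_intros count_arrived(2)[OF t])
    have "ennreal ((slots.mean_delay - e) * slots.count (arrived t) n - C) \<le> total_wait t" for n
    proof -
      have "ennreal ((slots.mean_delay - e) * slots.count (arrived t) n - C)
          \<le> (\<Sum>k<n. \<integral>\<^sup>+ \<omega>. ennreal (arrived t k \<omega> * slots.D k \<omega>) \<partial>prob_of Q)"
        using C[OF slots.clock_pred_le] unfolding arrived_def .
      also have "\<dots> \<le> (\<Sum>i<n. \<integral>\<^sup>+ \<omega>. ennreal (arrived t i \<omega>) * waiting_time Q S i \<omega> \<partial>prob_of Q)"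
        by (rule waiting_sum_ge[OF weight_arrived])
      also have "\<dots> \<le> total_wait t" unfolding total_wait_def by (rule sum_le_suminf) auto
      finally show ?thesis .
    qed
    then show "\<exists>N. \<forall>n\<ge>N. ennreal ((slots.mean_delay - e) * slots.count (arrived t) n - C) \<le> total_wait t" by blast
  qed
  then show ?thesis by blast
qed

lemma total_wait_tendsto:
  "((\<lambda>t. enn2real (total_wait t) / t) \<longlongrightarrow> rate Q * slots.mean_delay) at_top"
proof (rule tendstoI)
  fix \<eta> :: real assume \<eta>: "0 < \<eta>"
  define \<delta> where "\<delta> = 1 / rate Q - slots.m1"
  have \<delta>: "0 < \<delta>" using slots_load by (simp add: \<delta>_def)
  have md: "0 \<le> slots.mean_delay" by (rule slots.mean_delay_nonneg[OF slots_load])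
  note r = rate_pos
  \<comment> \<open>The upper bound in \<open>total_wait_le\<close> is linear in t: K is the
    coefficient of e t, and c below is its part that does not grow with t.\<close>
  define K where "K = slots.mean_delay * (slots.m2 / \<delta>) * rate Q"
  have K: "0 \<le> K" using md slots.m2_nonneg \<delta> r by (simp add: K_def)
  define e where "e = \<eta> / (2 * (K + 1))"
  have e: "0 < e" using \<eta> K by (simp add: e_def)
  have eK: "e * K < \<eta> / 2 + 0 + \<eta> / 4"
  proof -
    have "e * K \<le> e * (K + 1)" using e by simp
    also have "\<dots> = \<eta> / 2" using K by (simp add: e_def field_simps)
    finally show ?thesis using \<eta> by simp
  qed
  define c where "c = slots.mean_delay * ((1 / e + 1 / rate Q) / \<delta>)"
  \<comment> \<open>Chosen so that the loss \<open>rate Q * e'\<close> in the slope of the lower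
    bound is \<eta> / 2.\<close>
  define e' where "e' = \<eta> / (2 * rate Q)"
  have e': "0 < e'" using \<eta> r by (simp add: e'_def)
  obtain C where C: "\<And>t. 0 \<le> t \<Longrightarrow> ennreal ((slots.mean_delay - e') * (rate Q * t) - C) \<le> total_wait t"
    using total_wait_ge[OF e'] by blast
  have "\<forall>\<^sub>F t in at_top. c / t < \<eta> / 4"
    by (rule order_tendstoD[OF tendsto_divide_0[OF tendsto_const filterlim_at_top_imp_at_infinity[OF filterlim_ident]]]) (use \<eta> in simp)
  moreover have "\<forall>\<^sub>F t in at_top. C / t < \<eta> / 4"
    by (rule order_tendstoD[OF tendsto_divide_0[OF tendsto_const filterlim_at_top_imp_at_infinity[OF filterlim_ident]]]) (use \<eta> in simp)
  ultimately show "\<forall>\<^sub>F t in at_top. dist (enn2real (total_wait t) / t) (rate Q * slots.mean_delay) < \<eta>"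
    using eventually_gt_at_top[of 0]
  proof eventually_elim
    case (elim t)
    then have t: "0 < t" by simp
    define z where "z = enn2real (total_wait t)"
    have up: "total_wait t \<le> ennreal (slots.mean_delay * ((1 + e * slots.m2 / \<delta>) * (rate Q * t) + (1 / e + 1 / rate Q) / \<delta>))"
      using total_wait_le[of t e] t e by (simp add: \<delta>_def)
    have "total_wait t < top" by (rule le_less_trans[OF up]) simp
    then have z: "total_wait t = ennreal z" unfolding z_def by simp
    have z0: "0 \<le> z" by (simp add: z_def)
    have "z \<le> slots.mean_delay * ((1 + e * slots.m2 / \<delta>) * (rate Q * t) + (1 / e + 1 / rate Q) / \<delta>)"
    proof -
      have "0 \<le> slots.mean_delay * ((1 + e * slots.m2 / \<delta>) * (rate Q * t) + (1 / e + 1 / rate Q) / \<delta>)"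
        using md slots.m2_nonneg \<delta> r e t by simp
      from ennreal_le_iff[OF this, of z] up show ?thesis unfolding z by simp
    qed
    also have "\<dots> = rate Q * slots.mean_delay * t + e * K * t + c" by (simp add: K_def c_def algebra_simps)
    finally have "z / t \<le> (rate Q * slots.mean_delay * t + e * K * t + c) / t" using t by (intro divide_right_mono) auto
    also have "\<dots> = rate Q * slots.mean_delay + e * K + c / t" using t by (simp add: field_simps)
    finally have a: "z / t < rate Q * slots.mean_delay + \<eta>" using eK elim(1) by linarith
    have "(slots.mean_delay - e') * (rate Q * t) - C \<le> z"
      using C[of t] t z0 unfolding z by (simp add: ennreal_le_iff)
    then have "((slots.mean_delay - e') * (rate Q * t) - C) / t \<le> z / t" using t by (intro divide_right_mono) auto
    moreover have "((slots.mean_delay - e') * (rate Q * t) - C) / t = rate Q * slots.mean_delay - rate Q * e' - C / t"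
      using t by (simp add: field_simps)
    moreover have "rate Q * e' = \<eta> / 2" using r by (simp add: e'_def)
    ultimately have b: "rate Q * slots.mean_delay - \<eta> < z / t" using elim(2) \<eta> by linarith
    show ?case using a b unfolding z_def[symmetric] dist_real_def by linarith
  qed
qed

end

lemma enn2ereal_diff_add:
  assumes "a \<noteq> \<infinity>" "c \<noteq> \<infinity>"
  shows "(enn2ereal a - enn2ereal b) + (enn2ereal c - enn2ereal d) = enn2ereal (a + c) - enn2ereal (b + d)"
  using assms
  by (cases a; cases b; cases c; cases d) (auto simp: ennreal_plus[symmetric] simp del: ennreal_plus)

lemma sum_enn2ereal_diff:
  assumes "finite I" "\<And>i. i \<in> I \<Longrightarrow> u i \<noteq> \<infinity>"
  shows "(\<Sum>i\<in>I. enn2ereal (u i) - enn2ereal (v i)) = enn2ereal (\<Sum>i\<in>I. u i) - enn2ereal (\<Sum>i\<in>I. v i)"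
  using assms
proof (induction I rule: finite_induct)
  case (insert x I)
  then have "(\<Sum>i\<in>I. u i) \<noteq> \<infinity>" by (auto simp: infinity_ennreal_def)
  then show ?case using insert by (simp add: enn2ereal_diff_add)
qed (simp add: zero_ennreal.rep_eq)

section \<open>Average welfare\<close>

context facility_model
begin

lemma mean_wcost_pos: "0 < mean_wcost Q"
proof -
  have "0 \<le> expectation (wcost Q 0)" using wcost_pos by (intro integral_nonneg_AE AE_I2) (simp add: less_imp_le)
  moreover have "expectation (wcost Q 0) \<noteq> 0"
  proof
    assume "expectation (wcost Q 0) = 0"
    then have "AE \<omega> in prob_of Q. wcost Q 0 \<omega> = 0"
      using integral_nonneg_eq_0_iff_AE[OF wcost_integrable[of 0]] wcost_pos by (auto simp: less_imp_le)
    then have "AE \<omega> in prob_of Q. False" using AE_space by eventually_elim (metis less_irrefl wcost_pos)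
    then show False by simp
  qed
  ultimately show ?thesis using wcost_mean[of 0] by simp
qed

lemma nn_integral_wcost: "(\<integral>\<^sup>+ \<omega>. ennreal (wcost Q i \<omega>) \<partial>prob_of Q) = ennreal (mean_wcost Q)"
  using nn_integral_eq_integral[OF wcost_integrable[of i]] wcost_pos wcost_mean[of i]
  by (simp add: less_imp_le)

lemma arrived_knowledge: "range Gap \<subseteq> J \<Longrightarrow> arrived t i \<in> borel_measurable (knowledge J)"
proof -
  assume J: "range Gap \<subseteq> J"
  have [measurable]: "arrival Q i \<in> borel_measurable (knowledge J)"
    unfolding arrival_def[abs_def] using gap_knowledge[of _ J] J by (intro borel_measurable_sum) auto
  show ?thesis unfolding arrived_eq[abs_def] by measurable
qed

end

context stable_durations
begin

definition gain :: "nat \<Rightarrow> 'a \<Rightarrow> real" where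
  "gain i \<omega> = integral {0..S i \<omega>} (\<lambda>s. net_marg Q i s \<omega>)"

text \<open>Welfare as a difference of nonnegative parts: \<open>ennreal\<close> cuts off negative
  arguments, so \<open>benefit\<close> is the positive part of the gain and always finite, while
  \<open>cost\<close> becomes infinite if the customer is never served. The subtraction in
  \<open>ereal\<close> is then never of the form infinity minus infinity.\<close>

definition benefit :: "nat \<Rightarrow> 'a \<Rightarrow> ennreal" where "benefit i \<omega> = ennreal (gain i \<omega>)"
definition cost :: "nat \<Rightarrow> 'a \<Rightarrow> ennreal" where
  "cost i \<omega> = ennreal (- gain i \<omega>) + ennreal (wcost Q i \<omega>) * waiting_time Q S i \<omega>"

lemma welfare_eq:
  assumes "\<omega> \<in> space (prob_of Q)"
  shows "welfare Q S i \<omega> = enn2ereal (benefit i \<omega>) - enn2ereal (cost i \<omega>)"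
proof (cases "waiting_time Q S i \<omega>")
  case (real w)
  have c: "0 < wcost Q i \<omega>" using wcost_pos[OF assms] .
  have "0 \<le> wcost Q i \<omega> * w" using c real by simp
  then have "\<not> 0 \<le> gain i \<omega> \<Longrightarrow> 0 \<le> wcost Q i \<omega> * w - gain i \<omega>" by simp
  then show ?thesis
    using real c
    by (cases "0 \<le> gain i \<omega>")
      (auto simp: welfare_def gain_def[symmetric] benefit_def cost_def ennreal_neg ennreal_mult[symmetric] zero_ennreal.rep_eq
        ennreal_plus[symmetric] simp del: ennreal_plus)
next
  case top
  have c: "0 < wcost Q i \<omega>" using wcost_pos[OF assms] .
  then have "cost i \<omega> = top" by (simp add: cost_def top ennreal_mult_top)
  moreover have "enn2ereal (benefit i \<omega>) \<noteq> \<infinity>" by (simp add: benefit_def)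
  ultimately show ?thesis using c
    by (cases "0 \<le> gain i \<omega>") (auto simp: welfare_def gain_def[symmetric] top benefit_def ennreal_neg zero_ennreal.rep_eq)
qed

lemma accumulated_welfare_eq:
  assumes \<omega>: "\<omega> \<in> space (prob_of Q)" and fin: "finite {i. arrival Q i \<omega> \<le> t}"
  shows "accumulated_welfare Q S t \<omega> = enn2ereal (\<Sum>i. ennreal (arrived t i \<omega>) * benefit i \<omega>)
    - enn2ereal (\<Sum>i. ennreal (arrived t i \<omega>) * cost i \<omega>)"
proof -
  have "accumulated_welfare Q S t \<omega> = enn2ereal (\<Sum>i | arrival Q i \<omega> \<le> t. benefit i \<omega>) - enn2ereal (\<Sum>i | arrival Q i \<omega> \<le> t. cost i \<omega>)"
    unfolding accumulated_welfare_def welfare_eq[OF \<omega>]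
    by (rule sum_enn2ereal_diff[OF fin]) (simp add: benefit_def)
  moreover have "(\<Sum>i. ennreal (arrived t i \<omega>) * g i \<omega>) = (\<Sum>i | arrival Q i \<omega> \<le> t. g i \<omega>)" for g :: "nat \<Rightarrow> 'a \<Rightarrow> ennreal"
  proof -
    have "(\<Sum>i. ennreal (arrived t i \<omega>) * g i \<omega>) = (\<Sum>i | arrival Q i \<omega> \<le> t. ennreal (arrived t i \<omega>) * g i \<omega>)"
      by (rule suminf_finite[OF fin]) (simp add: arrived_eq)
    also have "\<dots> = (\<Sum>i | arrival Q i \<omega> \<le> t. g i \<omega>)" by (intro sum.cong) (auto simp: arrived_eq)
    finally show ?thesis .
  qed
  ultimately show ?thesis by simp
qed

lemma nn_integral_distr_eq:
  assumes "distr (prob_of Q) borel f = distr (prob_of Q) borel g" "f \<in> borel_measurable (prob_of Q)"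
    "g \<in> borel_measurable (prob_of Q)" "h \<in> borel_measurable borel"
  shows "(\<integral>\<^sup>+ \<omega>. h (f \<omega> :: real) \<partial>prob_of Q) = (\<integral>\<^sup>+ \<omega>. h (g \<omega>) \<partial>prob_of Q)"
  using nn_integral_distr[OF assms(2), of h] nn_integral_distr[OF assms(3), of h] assms(1,4) by simp

context
  assumes gain_knowledge: "\<And>i. gain i \<in> borel_measurable (knowledge {Marg i})"
    and gain_identical: "\<And>i. distr (prob_of Q) borel (gain i) = distr (prob_of Q) borel (gain 0)"
    and benefit_finite: "(\<integral>\<^sup>+ \<omega>. benefit 0 \<omega> \<partial>prob_of Q) < \<infinity>"
begin

lemma gain_measurable [measurable]: "gain i \<in> borel_measurable (prob_of Q)"
  using gain_knowledge by (rule measurable_info_M)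

lemma benefit_measurable [measurable]: "benefit i \<in> borel_measurable (prob_of Q)"
  and cost_measurable [measurable]: "cost i \<in> borel_measurable (prob_of Q)"
  unfolding benefit_def[abs_def] cost_def[abs_def] by measurable

text \<open>Whether customer i arrives by t depends on the gaps only and is independent of his gain,
  so the expectations factor and the arrival probabilities sum to \<open>rate Q * t\<close>.\<close>

lemma suminf_arrived_gain:
  assumes t: "0 \<le> t" and h: "h \<in> borel_measurable borel"
  shows "(\<Sum>i. \<integral>\<^sup>+ \<omega>. ennreal (arrived t i \<omega>) * h (gain i \<omega>) \<partial>prob_of Q)
    = ennreal (rate Q * t) * (\<integral>\<^sup>+ \<omega>. h (gain 0 \<omega>) \<partial>prob_of Q)"
proof -
  have "(\<integral>\<^sup>+ \<omega>. ennreal (arrived t i \<omega>) * h (gain i \<omega>) \<partial>prob_of Q)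
      = (\<integral>\<^sup>+ \<omega>. ennreal (arrived t i \<omega>) \<partial>prob_of Q) * (\<integral>\<^sup>+ \<omega>. h (gain 0 \<omega>) \<partial>prob_of Q)" for i
  proof -
    have "(\<integral>\<^sup>+ \<omega>. ennreal (arrived t i \<omega>) * h (gain i \<omega>) \<partial>prob_of Q)
      = (\<integral>\<^sup>+ \<omega>. ennreal (arrived t i \<omega>) \<partial>prob_of Q) * (\<integral>\<^sup>+ \<omega>. h (gain i \<omega>) \<partial>prob_of Q)"
    proof (rule nn_integral_mult_info[of "range Gap" "{Marg i}"])
      show "(\<lambda>\<omega>. ennreal (arrived t i \<omega>)) \<in> borel_measurable (knowledge (range Gap))"
        using arrived_knowledge[of "range Gap" t i] by measurable
      show "(\<lambda>\<omega>. h (gain i \<omega>)) \<in> borel_measurable (knowledge {Marg i})"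
        using gain_knowledge[of i] h by measurable
    qed auto
    then show ?thesis using nn_integral_distr_eq[OF gain_identical[of i] gain_measurable gain_measurable h] by simp
  qed
  then show ?thesis using suminf_arrived[OF t] by simp
qed

text \<open>The waiting time of customer i does not involve \<open>WCost i\<close>, so his cost rate
  enters through its mean alone.\<close>

lemma suminf_arrived_waiting:
  "(\<Sum>i. \<integral>\<^sup>+ \<omega>. ennreal (arrived t i \<omega>) * (ennreal (wcost Q i \<omega>) * waiting_time Q S i \<omega>) \<partial>prob_of Q)
    = ennreal (mean_wcost Q) * total_wait t"
proof -
  have "(\<integral>\<^sup>+ \<omega>. ennreal (arrived t i \<omega>) * (ennreal (wcost Q i \<omega>) * waiting_time Q S i \<omega>) \<partial>prob_of Q)
      = ennreal (mean_wcost Q) * (\<integral>\<^sup>+ \<omega>. ennreal (arrived t i \<omega>) * waiting_time Q S i \<omega> \<partial>prob_of Q)" for i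
  proof -
    let ?J = "UNIV - {WCost i}"
    have "(\<integral>\<^sup>+ \<omega>. ennreal (wcost Q i \<omega>) * (ennreal (arrived t i \<omega>) * waiting_time Q S i \<omega>) \<partial>prob_of Q)
      = (\<integral>\<^sup>+ \<omega>. ennreal (wcost Q i \<omega>) \<partial>prob_of Q) * (\<integral>\<^sup>+ \<omega>. ennreal (arrived t i \<omega>) * waiting_time Q S i \<omega> \<partial>prob_of Q)"
    proof (rule nn_integral_mult_info[of "{WCost i}" ?J])
      show "(\<lambda>\<omega>. ennreal (wcost Q i \<omega>)) \<in> borel_measurable (knowledge {WCost i})"
        using wcost_knowledge[of i "{WCost i}"] by measurable
      have [measurable]: "arrived t i \<in> borel_measurable (knowledge ?J)" "waiting_time Q S i \<in> borel_measurable (knowledge ?J)"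
        by (auto intro!: arrived_knowledge waiting_time_knowledge)
      show "(\<lambda>\<omega>. ennreal (arrived t i \<omega>) * waiting_time Q S i \<omega>) \<in> borel_measurable (knowledge ?J)"
        by measurable
    qed auto
    then show ?thesis by (simp add: nn_integral_wcost ac_simps)
  qed
  then show ?thesis by (simp add: total_wait_def)
qed

lemma expect_accumulated_welfare:
  assumes t: "0 \<le> t"
  shows "has_expect (prob_of Q) (accumulated_welfare Q S t)"
    "expect (prob_of Q) (accumulated_welfare Q S t)
      = enn2ereal (ennreal (rate Q * t) * (\<integral>\<^sup>+ \<omega>. ennreal (gain 0 \<omega>) \<partial>prob_of Q))
       - enn2ereal (ennreal (rate Q * t) * (\<integral>\<^sup>+ \<omega>. ennreal (- gain 0 \<omega>) \<partial>prob_of Q) + ennreal (mean_wcost Q) * total_wait t)"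
proof -
  let ?U = "\<lambda>\<omega>. \<Sum>i. ennreal (arrived t i \<omega>) * benefit i \<omega>"
  let ?V = "\<lambda>\<omega>. \<Sum>i. ennreal (arrived t i \<omega>) * cost i \<omega>"
  have m: "accumulated_welfare Q S t \<in> borel_measurable (prob_of Q)"
  proof -
    \<comment> \<open>On the null event of infinitely many arrivals by t, the sum over an infinite
      index set takes its default value 0.\<close>
    have "accumulated_welfare Q S t \<omega> = (if (\<Sum>k. ennreal (arrived t k \<omega>)) < top then enn2ereal (?U \<omega>) - enn2ereal (?V \<omega>) else 0)"
      if "\<omega> \<in> space (prob_of Q)" for \<omega>
    proof (cases "finite {i. arrival Q i \<omega> \<le> t}")
      case True
      then show ?thesis using accumulated_welfare_eq[OF that True] finite_arrivals_iff by simp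
    next
      case False
      then show ?thesis using finite_arrivals_iff[of \<omega> t] by (simp add: accumulated_welfare_def)
    qed
    moreover have "(\<lambda>\<omega>. if (\<Sum>k. ennreal (arrived t k \<omega>)) < top then enn2ereal (?U \<omega>) - enn2ereal (?V \<omega>) else 0)
        \<in> borel_measurable (prob_of Q)"
      by measurable
    ultimately show ?thesis by (subst measurable_cong) auto
  qed
  have U: "(\<integral>\<^sup>+ \<omega>. ?U \<omega> \<partial>prob_of Q) = ennreal (rate Q * t) * (\<integral>\<^sup>+ \<omega>. ennreal (gain 0 \<omega>) \<partial>prob_of Q)"
    using suminf_arrived_gain[OF t, of ennreal] by (simp add: nn_integral_suminf benefit_def)
  have V: "(\<integral>\<^sup>+ \<omega>. ?V \<omega> \<partial>prob_of Q) = ennreal (rate Q * t) * (\<integral>\<^sup>+ \<omega>. ennreal (- gain 0 \<omega>) \<partial>prob_of Q) + ennreal (mean_wcost Q) * total_wait t"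
  proof -
    have "(\<integral>\<^sup>+ \<omega>. ?V \<omega> \<partial>prob_of Q) = (\<Sum>i. \<integral>\<^sup>+ \<omega>. ennreal (arrived t i \<omega>) * cost i \<omega> \<partial>prob_of Q)"
      by (rule nn_integral_suminf) measurable
    also have "\<dots> = (\<Sum>i. (\<integral>\<^sup>+ \<omega>. ennreal (arrived t i \<omega>) * ennreal (- gain i \<omega>) \<partial>prob_of Q)
        + (\<integral>\<^sup>+ \<omega>. ennreal (arrived t i \<omega>) * (ennreal (wcost Q i \<omega>) * waiting_time Q S i \<omega>) \<partial>prob_of Q))"
      by (simp add: cost_def distrib_left nn_integral_add)
    also have "\<dots> = (\<Sum>i. \<integral>\<^sup>+ \<omega>. ennreal (arrived t i \<omega>) * ennreal (- gain i \<omega>) \<partial>prob_of Q)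
        + (\<Sum>i. \<integral>\<^sup>+ \<omega>. ennreal (arrived t i \<omega>) * (ennreal (wcost Q i \<omega>) * waiting_time Q S i \<omega>) \<partial>prob_of Q)"
      by (rule suminf_add[symmetric]) auto
    finally show ?thesis using suminf_arrived_gain[OF t, of "\<lambda>x. ennreal (- x)"] by (simp add: suminf_arrived_waiting)
  qed
  have ae: "AE \<omega> in prob_of Q. accumulated_welfare Q S t \<omega> = enn2ereal (?U \<omega>) - enn2ereal (?V \<omega>)"
    using AE_finite_arrivals[OF t] AE_space by eventually_elim (rule accumulated_welfare_eq)
  have fin: "(\<integral>\<^sup>+ \<omega>. ?U \<omega> \<partial>prob_of Q) < \<infinity>"
    unfolding U using benefit_finite by (simp add: benefit_def ennreal_mult_less_top)
  show "has_expect (prob_of Q) (accumulated_welfare Q S t)"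
    by (rule expect_diff[OF m _ _ ae fin]) measurable
  have "expect (prob_of Q) (accumulated_welfare Q S t) = enn2ereal (\<integral>\<^sup>+ \<omega>. ?U \<omega> \<partial>prob_of Q) - enn2ereal (\<integral>\<^sup>+ \<omega>. ?V \<omega> \<partial>prob_of Q)"
    by (rule expect_diff[OF m _ _ ae fin]) measurable
  then show "expect (prob_of Q) (accumulated_welfare Q S t)
      = enn2ereal (ennreal (rate Q * t) * (\<integral>\<^sup>+ \<omega>. ennreal (gain 0 \<omega>) \<partial>prob_of Q))
       - enn2ereal (ennreal (rate Q * t) * (\<integral>\<^sup>+ \<omega>. ennreal (- gain 0 \<omega>) \<partial>prob_of Q) + ennreal (mean_wcost Q) * total_wait t)"
    unfolding U V .
qed

lemma total_wait_finite: "0 \<le> t \<Longrightarrow> total_wait t < top"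
  using total_wait_le[of t 1] by (rule le_less_trans) auto

lemma average_welfare_real:
  assumes int: "integrable (prob_of Q) (gain 0)"
  shows "has_average_welfare Q S (ereal (rate Q * (expectation (gain 0) - mean_wcost Q * slots.mean_delay)))"
  unfolding has_average_welfare_def
proof (intro conjI allI impI)
  show "has_expect (prob_of Q) (accumulated_welfare Q S t)" if "0 \<le> t" for t
    by (rule expect_accumulated_welfare[OF that])
  obtain r q where rq: "0 \<le> r" "0 \<le> q" "(\<integral>\<^sup>+ \<omega>. ennreal (gain 0 \<omega>) \<partial>prob_of Q) = ennreal r"
    "(\<integral>\<^sup>+ \<omega>. ennreal (- gain 0 \<omega>) \<partial>prob_of Q) = ennreal q" "expectation (gain 0) = r - q"
    using int by (rule integrableE)
  have eq: "expect (prob_of Q) (accumulated_welfare Q S t) / ereal t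
      = ereal (rate Q * expectation (gain 0) - mean_wcost Q * (enn2real (total_wait t) / t))" if t: "0 < t" for t
  proof -
    define z where "z = enn2real (total_wait t)"
    have z: "total_wait t = ennreal z" "0 \<le> z" using total_wait_finite[of t] t by (auto simp: z_def)
    have "expect (prob_of Q) (accumulated_welfare Q S t) = ereal (rate Q * t * r - (rate Q * t * q + mean_wcost Q * z))"
      using expect_accumulated_welfare(2)[of t] t rq z rate_pos mean_wcost_pos
      by (simp add: ennreal_mult[symmetric] ennreal_plus[symmetric] del: ennreal_plus)
    then have "expect (prob_of Q) (accumulated_welfare Q S t) / ereal t = ereal ((rate Q * t * r - (rate Q * t * q + mean_wcost Q * z)) / t)"
      using t by simp
    also have "(rate Q * t * r - (rate Q * t * q + mean_wcost Q * z)) / t = rate Q * expectation (gain 0) - mean_wcost Q * (z / t)"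
      using t by (simp add: rq field_simps)
    finally show ?thesis by (simp add: z_def)
  qed
  have lim: "((\<lambda>t. ereal (rate Q * expectation (gain 0) - mean_wcost Q * (enn2real (total_wait t) / t))) \<longlongrightarrow>
      ereal (rate Q * expectation (gain 0) - mean_wcost Q * (rate Q * slots.mean_delay))) at_top"
    by (intro tendsto_intros total_wait_tendsto)
  have "((\<lambda>t. expect (prob_of Q) (accumulated_welfare Q S t) / ereal t) \<longlongrightarrow>
      ereal (rate Q * expectation (gain 0) - mean_wcost Q * (rate Q * slots.mean_delay))) at_top"
    using lim
  proof (rule Lim_transform_eventually)
    show "\<forall>\<^sub>F t in at_top. ereal (rate Q * expectation (gain 0) - mean_wcost Q * (enn2real (total_wait t) / t))
        = expect (prob_of Q) (accumulated_welfare Q S t) / ereal t"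
      using eventually_gt_at_top[of 0] by eventually_elim (simp only: eq)
  qed
  then show "((\<lambda>t. expect (prob_of Q) (accumulated_welfare Q S t) / ereal t) \<longlongrightarrow>
      ereal (rate Q * (expectation (gain 0) - mean_wcost Q * slots.mean_delay))) at_top"
    by (simp add: algebra_simps)
qed

text \<open>A finite second moment of the durations does not bound the operating costs, as
  \<open>opcost Q\<close> may grow arbitrarily fast. A negative part with infinite expectation makes
  the expected welfare minus infinity at every positive time, and such a competitor is still
  comparable.\<close>

lemma average_welfare_infinite:
  assumes "\<not> integrable (prob_of Q) (gain 0)"
  shows "has_average_welfare Q S (- \<infinity>)"
  unfolding has_average_welfare_def
proof (intro conjI allI impI)
  show "has_expect (prob_of Q) (accumulated_welfare Q S t)" if "0 \<le> t" for t
    by (rule expect_accumulated_welfare[OF that])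
  have inf: "(\<integral>\<^sup>+ \<omega>. ennreal (- gain 0 \<omega>) \<partial>prob_of Q) = top"
    using assms benefit_finite unfolding real_integrable_def benefit_def by auto
  obtain r where r: "(\<integral>\<^sup>+ \<omega>. ennreal (gain 0 \<omega>) \<partial>prob_of Q) = ennreal r" "0 \<le> r"
    using benefit_finite unfolding benefit_def by (cases "\<integral>\<^sup>+ \<omega>. ennreal (gain 0 \<omega>) \<partial>prob_of Q") auto
  have "expect (prob_of Q) (accumulated_welfare Q S t) / ereal t = - \<infinity>" if t: "0 < t" for t
    using expect_accumulated_welfare(2)[of t] t rate_pos r
    by (simp add: inf ennreal_mult_top ennreal_mult[symmetric])
  then have "\<forall>\<^sub>F t in at_top. expect (prob_of Q) (accumulated_welfare Q S t) / ereal t = - \<infinity>"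
    using eventually_gt_at_top[of 0] by (rule eventually_mono[rotated])
  then show "((\<lambda>t. expect (prob_of Q) (accumulated_welfare Q S t) / ereal t) \<longlongrightarrow> - \<infinity>) at_top"
    by (rule tendsto_eventually)
qed

end

end

section \<open>Functionals of the sample path\<close>

text \<open>A dyadic point strictly to the right of u, thanks to the added 1; right-continuity then
  applies along n. It takes countably many values, which makes evaluation there jointly
  measurable.\<close>

definition grid :: "nat \<Rightarrow> real \<Rightarrow> real" where
  "grid n u = (real (nat \<lfloor>2 ^ n * u\<rfloor>) + 1) / 2 ^ n"

lemma grid_bounds:
  assumes "0 \<le> u"
  shows "u < grid n u" "grid n u \<le> u + 1 / 2 ^ n"
proof -
  have nn: "0 \<le> 2 ^ n * u" using assms by simp
  then have "real (nat \<lfloor>2 ^ n * u\<rfloor>) = of_int \<lfloor>2 ^ n * u\<rfloor>" by simp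
  moreover have "2 ^ n * u < of_int \<lfloor>2 ^ n * u\<rfloor> + 1" "of_int \<lfloor>2 ^ n * u\<rfloor> \<le> 2 ^ n * u" by linarith+
  ultimately have "2 ^ n * u < real (nat \<lfloor>2 ^ n * u\<rfloor>) + 1" "real (nat \<lfloor>2 ^ n * u\<rfloor>) \<le> 2 ^ n * u" by auto
  then show "u < grid n u" "grid n u \<le> u + 1 / 2 ^ n" unfolding grid_def by (auto simp: field_simps)
qed

lemma grid_tendsto: "0 \<le> u \<Longrightarrow> filterlim (\<lambda>n. grid n u) (at_right u) sequentially"
  unfolding filterlim_at
proof
  assume u: "0 \<le> u"
  show "(\<lambda>n. grid n u) \<longlonglongrightarrow> u"
  proof (rule tendsto_sandwich[of "\<lambda>_. u" _ _ "\<lambda>n. u + 1 / 2 ^ n"])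
    have "(\<lambda>n. (1 / 2 :: real) ^ n) \<longlonglongrightarrow> 0" by (rule LIMSEQ_realpow_zero) auto
    then have "(\<lambda>n. u + (1 / 2) ^ n) \<longlonglongrightarrow> u + 0" by (rule tendsto_add[OF tendsto_const])
    then show "(\<lambda>n. u + 1 / 2 ^ n) \<longlonglongrightarrow> u" by (simp add: power_one_over)
  qed (use grid_bounds[OF u] in \<open>auto intro!: always_eventually less_imp_le\<close>)
  show "\<forall>\<^sub>F n in sequentially. grid n u \<in> {u<..} \<and> grid n u \<noteq> u"
    using grid_bounds(1)[OF u] by (auto intro!: always_eventually simp: less_imp_neq)
    (metis less_irrefl)
qed

text \<open>On right-continuous paths this is \<open>p u\<close>; unlike \<open>p u\<close> it is jointly measurable in \<open>u\<close> and \<open>p\<close>.\<close>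

definition eval_path :: "real \<Rightarrow> (real \<Rightarrow> real) \<Rightarrow> real" where
  "eval_path u p = lim (\<lambda>n. p (grid n u))"

lemma eval_path_measurable:
  "(\<lambda>z. eval_path (fst z) (snd z)) \<in> borel_measurable (borel \<Otimes>\<^sub>M path_space)"
  unfolding eval_path_def
proof (rule borel_measurable_lim_metric)
  fix n
  define k where "k z = nat \<lfloor>2 ^ n * fst z\<rfloor>" for z :: "real \<times> (real \<Rightarrow> real)"
  have k: "k \<in> measurable (borel \<Otimes>\<^sub>M path_space) (count_space UNIV)" unfolding k_def by measurable
  have "(\<lambda>z :: real \<times> (real \<Rightarrow> real). snd z ((real j + 1) / 2 ^ n)) \<in> borel_measurable (borel \<Otimes>\<^sub>M path_space)" for j
    by (rule measurable_compose[OF measurable_snd measurable_component_singleton]) simp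
  from measurable_compose_countable[OF this k]
  show "(\<lambda>z. snd z (grid n (fst z))) \<in> borel_measurable (borel \<Otimes>\<^sub>M path_space)"
    by (simp add: grid_def k_def)
qed

lemma eval_path_measurable' [measurable (raw)]:
  assumes "f \<in> borel_measurable N" "g \<in> measurable N path_space"
  shows "(\<lambda>x. eval_path (f x) (g x)) \<in> borel_measurable N"
  using measurable_compose[OF measurable_Pair[OF assms] eval_path_measurable] by simp

definition path_integral :: "real \<Rightarrow> (real \<Rightarrow> real) \<Rightarrow> real" where
  "path_integral s p = (\<integral>u. indicator {0..s} u * eval_path u p \<partial>lborel)"

lemma path_integral_measurable:
  "(\<lambda>z. path_integral (fst z) (snd z)) \<in> borel_measurable (borel \<Otimes>\<^sub>M path_space)"
  unfolding path_integral_def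
proof (rule lborel.borel_measurable_lebesgue_integral)
  have [measurable]: "(\<lambda>w. fst (fst w)) \<in> borel_measurable (((borel :: real measure) \<Otimes>\<^sub>M path_space) \<Otimes>\<^sub>M lborel)"
    "(\<lambda>w. snd w) \<in> borel_measurable (((borel :: real measure) \<Otimes>\<^sub>M path_space) \<Otimes>\<^sub>M lborel)"
    "(\<lambda>w. snd (fst w)) \<in> measurable (((borel :: real measure) \<Otimes>\<^sub>M path_space) \<Otimes>\<^sub>M lborel) path_space"
    by measurable
  have "(\<lambda>w. (if 0 \<le> snd w \<and> snd w \<le> fst (fst w) then 1 else 0) * eval_path (snd w) (snd (fst w)))
      \<in> borel_measurable ((borel \<Otimes>\<^sub>M path_space) \<Otimes>\<^sub>M lborel)"
    by measurable
  then show "(\<lambda>(z, u). indicator {0..fst z} u * eval_path u (snd z)) \<in> borel_measurable ((borel \<Otimes>\<^sub>M path_space) \<Otimes>\<^sub>M lborel)"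
    by (simp add: indicator_def case_prod_beta)
qed

text \<open>The time that the path spends above the boundary b. For a nonincreasing path and the
  boundary of the threshold duration this is the threshold itself (\<open>tau_level_length\<close>),
  in a form whose measurability in the path follows from Fubini.\<close>

definition level_length :: "(real \<Rightarrow> real) \<Rightarrow> (real \<Rightarrow> real) \<Rightarrow> real" where
  "level_length b p = enn2real (\<integral>\<^sup>+ u. (if 0 \<le> u \<and> b u < eval_path u p then 1 else 0) \<partial>lborel)"

lemma level_length_measurable:
  assumes [measurable]: "b \<in> borel_measurable borel"
  shows "level_length b \<in> borel_measurable path_space"
proof -
  have "(\<lambda>(p, u). if 0 \<le> u \<and> b u < eval_path u p then 1 else 0 :: ennreal) \<in> borel_measurable (path_space \<Otimes>\<^sub>M lborel)"
    by measurable
  from lborel.borel_measurable_nn_integral[OF this] show ?thesis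
    unfolding level_length_def[abs_def] by measurable
qed

lemma integrable_on_antimono_on:
  fixes f :: "real \<Rightarrow> real"
  assumes "antimono_on {0..} f" "0 \<le> a"
  shows "f integrable_on {a..b}"
proof -
  have "mono_on {a..b} (\<lambda>x. - f x)" using assms by (auto simp: monotone_on_def)
  then have "(\<lambda>x. - f x) integrable_on {a..b}" by (rule integrable_on_mono_on)
  then show ?thesis by (simp add: integrable_neg_iff)
qed

context facility_model
begin

lemma marg_measurable_path: "sample_path Q i \<in> measurable (knowledge {Marg i}) path_space"
  unfolding sample_path_def[abs_def]
  by (rule measurable_restrict) (use marg_knowledge in auto)

lemma sample_path_measurable [measurable]: "sample_path Q i \<in> measurable (prob_of Q) path_space"
  using marg_measurable_path by (rule measurable_info_M)

lemma eval_sample_path: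
  assumes "\<omega> \<in> space (prob_of Q)" "0 \<le> u"
  shows "eval_path u (sample_path Q i \<omega>) = marg Q i u \<omega>"
proof -
  have "((\<lambda>s. marg Q i s \<omega>) \<longlongrightarrow> marg Q i u \<omega>) (at_right u)"
    using marg_right_continuous[OF assms, of i] by (simp add: continuous_within)
  then have "(\<lambda>n. marg Q i (grid n u) \<omega>) \<longlonglongrightarrow> marg Q i u \<omega>"
    by (rule filterlim_compose[OF _ grid_tendsto[OF assms(2)]])
  moreover have "sample_path Q i \<omega> (grid n u) = marg Q i (grid n u) \<omega>" for n
    using grid_bounds(1)[OF assms(2), of n] assms(2) by (simp add: sample_path_def)
  ultimately show ?thesis by (simp add: eval_path_def limI)
qed

lemma marg_integrable_on: "\<omega> \<in> space (prob_of Q) \<Longrightarrow> 0 \<le> a \<Longrightarrow> (\<lambda>u. marg Q i u \<omega>) integrable_on {a..b}"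
  by (rule integrable_on_antimono_on[OF marg_antimono])

lemma path_integral_sample_path:
  assumes \<omega>: "\<omega> \<in> space (prob_of Q)" and s: "0 \<le> s"
  shows "path_integral s (sample_path Q i \<omega>) = integral {0..s} (\<lambda>u. marg Q i u \<omega>)"
proof -
  have eq: "indicator {0..s} u * eval_path u (sample_path Q i \<omega>) = indicator {0..s} u * marg Q i u \<omega>" for u
    using eval_sample_path[OF \<omega>, of u i] by (auto simp: indicator_def)
  have bound: "norm (marg Q i u \<omega>) \<le> max \<bar>marg Q i 0 \<omega>\<bar> \<bar>marg Q i s \<omega>\<bar>" if "u \<in> {0..s}" for u
    using monotone_onD[OF marg_antimono[OF \<omega>, of i], of 0 u] monotone_onD[OF marg_antimono[OF \<omega>, of i], of u s] that s by auto
  have m: "(\<lambda>u. indicator {0..s} u * marg Q i u \<omega>) \<in> borel_measurable lborel"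
  proof -
    have [measurable]: "(\<lambda>_. sample_path Q i \<omega>) \<in> measurable lborel path_space"
      using measurable_space[OF sample_path_measurable \<omega>] by simp
    show ?thesis unfolding eq[symmetric] by measurable
  qed
  have "integrable lborel (\<lambda>u. indicator {0..s} u * marg Q i u \<omega>)"
  proof (rule integrableI_bounded_set[where A="{0..s}" and B="max \<bar>marg Q i 0 \<omega>\<bar> \<bar>marg Q i s \<omega>\<bar>"])
    show "AE u in lborel. u \<in> {0..s} \<longrightarrow> norm (indicator {0..s} u * marg Q i u \<omega>) \<le> max \<bar>marg Q i 0 \<omega>\<bar> \<bar>marg Q i s \<omega>\<bar>"
      using bound by (intro AE_I2) (auto simp: indicator_def)
  qed (use m s in \<open>auto simp: indicator_def\<close>)
  then have "set_integrable lborel {0..s} (\<lambda>u. marg Q i u \<omega>)" by (simp add: set_integrable_def)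
  from set_borel_integral_eq_integral(2)[OF this] show ?thesis
    unfolding path_integral_def eq by (simp add: set_lebesgue_integral_def)
qed

lemma opcost_integrable_on: "0 \<le> a \<Longrightarrow> opcost Q integrable_on {a..b}"
  using opcost_mono by (intro integrable_on_mono_on mono_on_subset[OF opcost_mono]) auto

text \<open>With \<open>max 0 s\<close> the function is monotone on the whole line, hence
  Borel.\<close>

definition opcost_integral :: "real \<Rightarrow> real" where
  "opcost_integral s = integral {0..max 0 s} (opcost Q)"

lemma opcost_integral_measurable [measurable]: "opcost_integral \<in> borel_measurable borel"
proof (rule borel_measurable_mono, rule monoI)
  fix a b :: real assume "a \<le> b"
  then show "opcost_integral a \<le> opcost_integral b"
    unfolding opcost_integral_def
    using opcost_integrable_on opcost_nonneg by (intro integral_subset_le) auto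
qed

lemma opcost_measurable: "(\<lambda>u. opcost Q (max 0 u)) \<in> borel_measurable borel"
  using opcost_mono by (intro borel_measurable_mono monoI) (auto simp: mono_on_def)

lemma integral_net_marg:
  assumes "\<omega> \<in> space (prob_of Q)" "0 \<le> s"
  shows "integral {0..s} (\<lambda>u. net_marg Q i u \<omega>) = path_integral s (sample_path Q i \<omega>) - opcost_integral s"
  unfolding net_marg_def path_integral_sample_path[OF assms] opcost_integral_def
  using assms marg_integrable_on[OF assms(1)] opcost_integrable_on
  by (subst Henstock_Kurzweil_Integration.integral_diff) auto

lemma net_marg_antimono:
  assumes "\<omega> \<in> space (prob_of Q)"
  shows "antimono_on {0..} (\<lambda>s. net_marg Q i s \<omega>)"
  unfolding net_marg_def
proof (rule monotone_onI)
  fix s t :: real assume "s \<in> {0..}" "t \<in> {0..}" "s \<le> t"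
  then have "marg Q i t \<omega> \<le> marg Q i s \<omega>" "opcost Q s \<le> opcost Q t"
    using monotone_onD[OF marg_antimono[OF assms, of i], of s t] mono_onD[OF opcost_mono, of s t] by auto
  then show "marg Q i t \<omega> - opcost Q t \<le> marg Q i s \<omega> - opcost Q s" by simp
qed

lemma net_marg_right_continuous:
  assumes "\<omega> \<in> space (prob_of Q)" "0 \<le> s"
  shows "continuous (at_right s) (\<lambda>u. net_marg Q i u \<omega>)"
  unfolding net_marg_def using assms
  by (intro continuous_diff marg_right_continuous opcost_right_continuous)

lemma net_marg_0: "net_marg Q i 0 \<omega> = marg Q i 0 \<omega>"
  by (simp add: net_marg_def opcost_0)

lemma natural_filtration_knowledge:
  assumes "A \<in> sets (natural_filtration (prob_of Q) (marg Q i) t)"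
  shows "A \<in> sets (knowledge {Marg i})"
proof -
  have "{marg Q i s -` B \<inter> space (prob_of Q) | s B. 0 \<le> s \<and> s \<le> t \<and> B \<in> sets borel} \<subseteq> sets (knowledge {Marg i})"
    using measurable_sets[OF marg_knowledge[of i "{Marg i}"]] by auto
  from sets.sigma_sets_subset[OF this] assms show ?thesis
    unfolding natural_filtration_def by (subst (asm) sets_measure_of) auto
qed

lemma stopping_time_knowledge:
  fixes S :: "'a \<Rightarrow> real"
  assumes "stopping_time (natural_filtration (prob_of Q) (marg Q i)) S"
  shows "S \<in> borel_measurable (knowledge {Marg i})"
proof (rule borel_measurable_iff_le[THEN iffD2], rule allI)
  fix t
  have sp: "space (natural_filtration (prob_of Q) (marg Q i) t) = space (prob_of Q)"
    by (simp add: natural_filtration_def space_measure_of_conv)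
  have "{\<omega> \<in> space (natural_filtration (prob_of Q) (marg Q i) t). S \<omega> \<le> t} \<in> sets (natural_filtration (prob_of Q) (marg Q i) t)"
    using assms unfolding stopping_time_def pred_def by blast
  then show "{\<omega> \<in> space (knowledge {Marg i}). S \<omega> \<le> t} \<in> sets (knowledge {Marg i})"
    unfolding sp space_info by (rule natural_filtration_knowledge)
qed

lemma profile_durations:
  assumes S: "service_profile Q p S"
  shows "service_durations Q S"
proof unfold_locales
  have adm: "admissible_duration Q p i (S i)" for i
    using S unfolding service_profile_def unique_individual_solution_def individual_solution_def by blast
  show "0 \<le> S i \<omega>" if "\<omega> \<in> space (prob_of Q)" for i \<omega>
    using adm[of i] that unfolding admissible_duration_def by blast
  show k: "S i \<in> borel_measurable (knowledge {Marg i})" for i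
    using adm[of i] unfolding admissible_duration_def by (intro stopping_time_knowledge) blast
  have [measurable]: "S i \<in> borel_measurable (prob_of Q)" for i using k by (rule measurable_info_M)
  have "distr (distr (prob_of Q) (borel \<Otimes>\<^sub>M path_space) (\<lambda>\<omega>. (S i \<omega>, sample_path Q i \<omega>))) borel fst = distr (prob_of Q) borel (S i)" for i
    by (subst distr_distr) (auto simp: comp_def)
  note proj = this
  have same: "distr (prob_of Q) (borel \<Otimes>\<^sub>M path_space) (\<lambda>\<omega>. (S i \<omega>, sample_path Q i \<omega>))
      = distr (prob_of Q) (borel \<Otimes>\<^sub>M path_space) (\<lambda>\<omega>. (S 0 \<omega>, sample_path Q 0 \<omega>))" for i
    using S unfolding service_profile_def by blast
  show "distr (prob_of Q) borel (S i) = distr (prob_of Q) borel (S 0)" for i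
    using proj[of i] proj[of 0] same[of i] by simp
qed

text \<open>The gain is a measurable function of duration and path together. Its law is the same for
  all customers because \<open>service_profile\<close> identifies the joint laws.\<close>

lemma gain_profile:
  assumes S: "service_profile Q p S"
  defines "gain \<equiv> \<lambda>i \<omega>. integral {0..S i \<omega>} (\<lambda>s. net_marg Q i s \<omega>)"
  shows "gain i \<in> borel_measurable (knowledge {Marg i})"
    and "distr (prob_of Q) borel (gain i) = distr (prob_of Q) borel (gain 0)"
proof -
  interpret service_durations Q S by (rule profile_durations[OF S])
  define \<phi> where "\<phi> z = path_integral (fst z) (snd z) - opcost_integral (fst z)" for z
  have \<phi>: "\<phi> \<in> borel_measurable (borel \<Otimes>\<^sub>M path_space)"
    unfolding \<phi>_def using path_integral_measurable by measurable
  have eq: "gain i \<omega> = \<phi> (S i \<omega>, sample_path Q i \<omega>)" if "\<omega> \<in> space (prob_of Q)" for i \<omega>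
    unfolding gain_def \<phi>_def using integral_net_marg[OF that S_nonneg[OF that]] by simp
  have "(\<lambda>\<omega>. \<phi> (S i \<omega>, sample_path Q i \<omega>)) \<in> borel_measurable (knowledge {Marg i})"
    by (rule measurable_compose[OF measurable_Pair[OF S_knowledge marg_measurable_path] \<phi>])
  then show "gain i \<in> borel_measurable (knowledge {Marg i})"
    using eq by (subst measurable_cong) auto
  have "distr (prob_of Q) borel (gain i) = distr (distr (prob_of Q) (borel \<Otimes>\<^sub>M path_space) (\<lambda>\<omega>. (S i \<omega>, sample_path Q i \<omega>))) borel \<phi>" for i
    using \<phi> eq by (subst distr_distr) (auto simp: comp_def intro!: distr_cong)
  note proj = this[of i] this[of 0]
  have "distr (prob_of Q) (borel \<Otimes>\<^sub>M path_space) (\<lambda>\<omega>. (S i \<omega>, sample_path Q i \<omega>))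
      = distr (prob_of Q) (borel \<Otimes>\<^sub>M path_space) (\<lambda>\<omega>. (S 0 \<omega>, sample_path Q 0 \<omega>))"
    using S unfolding service_profile_def by blast
  then show "distr (prob_of Q) borel (gain i) = distr (prob_of Q) borel (gain 0)"
    unfolding proj by simp
qed

end

section \<open>Thresholds of decreasing paths\<close>

definition threshold :: "(real \<Rightarrow> real) \<Rightarrow> real \<Rightarrow> real \<Rightarrow> real" where
  "threshold v c x = Inf {s. 0 \<le> s \<and> v s - c * s \<le> x}"

locale decreasing_path =
  fixes v :: "real \<Rightarrow> real"
  assumes antimono: "antimono_on {0..} v"
    and right_continuous: "\<And>s. 0 \<le> s \<Longrightarrow> continuous (at_right s) v"
begin

lemma le: "0 \<le> s \<Longrightarrow> s \<le> t \<Longrightarrow> v t \<le> v s"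
  using monotone_onD[OF antimono, of s t] by simp

lemma integrable: "0 \<le> a \<Longrightarrow> v integrable_on {a..b}"
  by (rule integrable_on_antimono_on[OF antimono])

context
  fixes c :: real assumes c: "0 < c"
begin

lemma sub_decreasing: "0 \<le> s \<Longrightarrow> s \<le> t \<Longrightarrow> v t - c * t + c * (t - s) \<le> v s - c * s"
  using le[of s t] by (simp add: algebra_simps)

text \<open>Since v stays below v 0, the slope c alone brings \<open>v s - c * s\<close> down to x
  by this time.\<close>

lemma threshold_nonempty: "max 0 ((v 0 - x) / c) \<in> {s. 0 \<le> s \<and> v s - c * s \<le> x}"
proof -
  let ?s = "max 0 ((v 0 - x) / c)"
  have "(v 0 - x) / c \<le> ?s" by simp
  then have "c * ((v 0 - x) / c) \<le> c * ?s" using c by (intro mult_left_mono) auto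
  then have "v 0 - x \<le> c * ?s" using c by simp
  moreover have "v ?s \<le> v 0" using le[of 0 ?s] by simp
  ultimately have "v ?s - c * ?s \<le> x" by linarith
  then show ?thesis by simp
qed

text \<open>Right-continuity puts the infimum into the set. The event on the left is thus described
  by v s alone, which will make \<open>tau\<close> a stopping time.\<close>

lemma threshold_le_iff:
  assumes s: "0 \<le> s"
  shows "threshold v c x \<le> s \<longleftrightarrow> v s - c * s \<le> x"
proof
  let ?A = "{s. 0 \<le> s \<and> v s - c * s \<le> x}"
  have bdd: "bdd_below ?A" by (rule bdd_belowI[of _ 0]) auto
  assume "v s - c * s \<le> x"
  then show "threshold v c x \<le> s" unfolding threshold_def using s bdd by (intro cInf_lower) auto
next
  let ?A = "{s. 0 \<le> s \<and> v s - c * s \<le> x}"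
  assume le_s: "threshold v c x \<le> s"
  have above: "v t - c * t \<le> x" if t: "s < t" for t
  proof -
    have "Inf ?A < t" using le_s t by (simp add: threshold_def)
    then obtain a where a: "a \<in> ?A" "a < t" using cInf_lessD[of ?A t] threshold_nonempty[of x] by blast
    have "0 \<le> c * (t - a)" using a c by simp
    then show ?thesis using sub_decreasing[of a t] a by simp
  qed
  have "((\<lambda>t. v t - c * t) \<longlongrightarrow> v s - c * s) (at_right s)"
    using right_continuous[OF s] by (intro tendsto_intros) (auto simp: continuous_within)
  then show "v s - c * s \<le> x"
    by (rule tendsto_upperbound) (use above in \<open>auto simp: eventually_at_filter\<close>)
qed

lemma threshold_nonneg: "0 \<le> threshold v c x"
  unfolding threshold_def using threshold_nonempty[of x] by (intro cInf_greatest) blast+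

lemma threshold_at: "v (threshold v c x) - c * threshold v c x \<le> x"
  using threshold_le_iff[OF threshold_nonneg, of x x] by simp

lemma threshold_bound: "threshold v c x \<le> max 0 ((v 0 - x) / c)"
  using threshold_le_iff[of "max 0 ((v 0 - x) / c)" x] threshold_nonempty[of x] by simp

lemma threshold_pos: "x < v 0 \<Longrightarrow> 0 < threshold v c x"
  using threshold_le_iff[of 0 x] by (simp add: not_le[symmetric])

text \<open>v s dominates the values at later times t just before the threshold, where v exceeds x +
  c t; then t tends to the threshold. Together with \<open>after_threshold\<close> this says that v
  crosses the constant level x + c \<open>threshold v c x\<close> there, possibly by a jump.\<close>

lemma before_threshold:
  assumes "0 \<le> s" "s < threshold v c x"
  shows "x + c * threshold v c x \<le> v s"
proof (rule field_le_epsilon)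
  fix e :: real assume e: "0 < e"
  define t where "t = max s (threshold v c x - e / c)"
  have t: "s \<le> t" "t < threshold v c x" "threshold v c x - e / c \<le> t" using assms e c by (auto simp: t_def)
  have "x < v t - c * t" using threshold_le_iff[of t x] t assms by simp
  moreover have "c * (threshold v c x - e / c) \<le> c * t" using t c by (intro mult_left_mono) auto
  moreover have "v t \<le> v s" using le t assms by simp
  ultimately show "x + c * threshold v c x \<le> v s + e" using c by (simp add: right_diff_distrib)
qed

lemma after_threshold:
  assumes "threshold v c x \<le> s"
  shows "v s \<le> x + c * threshold v c x"
  using le[OF threshold_nonneg assms] threshold_at[of x] by simp

lemma threshold_antimono: "x \<le> y \<Longrightarrow> threshold v c y \<le> threshold v c x"
  using threshold_le_iff[OF threshold_nonneg, of y x] threshold_at[of x] by simp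

lemma threshold_lipschitz:
  assumes "x \<le> y"
  shows "threshold v c x - threshold v c y \<le> (y - x) / c"
proof -
  let ?s = "threshold v c y + (y - x) / c"
  have d: "0 \<le> (y - x) / c" using assms c by simp
  have "v ?s - c * ?s + c * (?s - threshold v c y) \<le> v (threshold v c y) - c * threshold v c y"
    by (rule sub_decreasing) (use threshold_nonneg d in auto)
  moreover have "c * (?s - threshold v c y) = y - x" using c by simp
  ultimately have "v ?s - c * ?s \<le> x" using threshold_at[of y] by linarith
  then have "threshold v c x \<le> ?s" using threshold_le_iff[of ?s x] threshold_nonneg[of y] d by simp
  then show ?thesis by simp
qed

text \<open>With the boundary frozen at its level at the threshold, v lies above it before and below
  it afterwards. This linearised comparison serves both the individual problem and the maximization
  of welfare.\<close>

lemma integral_le_threshold: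
  fixes x :: real
  assumes S: "0 \<le> S"
  defines "t \<equiv> threshold v c x"
  shows "integral {0..S} v - (x + c * t) * S \<le> integral {0..t} v - (x + c * t) * t"
proof (cases "S \<le> t")
  case True
  have "integral {0..S} v + integral {S..t} v = integral {0..t} v"
    using S True integrable[of 0] by (intro Henstock_Kurzweil_Integration.integral_combine) auto
  moreover have "(x + c * t) * (t - S) \<le> integral {S..t} v"
  proof -
    \<comment> \<open>\<open>before_threshold\<close> excludes the end point, where v may already
      have jumped below the level; one point does not change the integral.\<close>
    define w where "w s = (if s = t then x + c * t else v s)" for s
    have eq: "integral {S..t} v = integral {S..t} w"
      by (rule integral_spike[of "{t}"]) (auto simp: w_def)
    have int: "w integrable_on {S..t}"
      by (rule integrable_spike[OF integrable[OF S], of "{t}"]) (auto simp: w_def)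
    have "integral {S..t} (\<lambda>_. x + c * t) \<le> integral {S..t} w"
      using int before_threshold[of _ x] S by (intro integral_le) (auto simp: w_def t_def)
    then show ?thesis using True by (simp add: eq mult.commute)
  qed
  ultimately show ?thesis by (simp add: algebra_simps)
next
  case False
  have t: "0 \<le> t" unfolding t_def by (rule threshold_nonneg)
  have "integral {0..t} v + integral {t..S} v = integral {0..S} v"
    using t False integrable[of 0] by (intro Henstock_Kurzweil_Integration.integral_combine) auto
  moreover have "integral {t..S} v \<le> (x + c * t) * (S - t)"
  proof -
    have "integral {t..S} v \<le> integral {t..S} (\<lambda>_. x + c * t)"
      using integrable[OF t] after_threshold[of x] by (intro integral_le) (auto simp: t_def)
    then show ?thesis using False by (simp add: mult.commute)
  qed
  ultimately show ?thesis by (simp add: algebra_simps)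
qed

lemma utility_le_threshold:
  fixes x :: real
  assumes S: "0 \<le> S"
  defines "t \<equiv> threshold v c x"
  shows "integral {0..S} v - x * S - c / 2 * S\<^sup>2 + c / 2 * (S - t)\<^sup>2 \<le> integral {0..t} v - x * t - c / 2 * t\<^sup>2"
  using integral_le_threshold[OF S, of x] unfolding t_def[symmetric]
  by (simp add: power2_eq_square algebra_simps)

lemma integral_ge_threshold:
  fixes x :: real
  defines "t \<equiv> threshold v c x"
  shows "(x + c * t) * t \<le> integral {0..t} v"
  using integral_le_threshold[of 0 x] by (simp add: t_def)

lemma integral_threshold_bounds:
  fixes x :: real
  assumes "0 \<le> x" "0 \<le> v 0"
  defines "t \<equiv> threshold v c x"
  shows "t \<le> v 0 / c" "0 \<le> integral {0..t} v" "integral {0..t} v \<le> v 0 * t"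
proof -
  have t: "0 \<le> t" unfolding t_def by (rule threshold_nonneg)
  have "max 0 ((v 0 - x) / c) \<le> v 0 / c" using assms c by (simp add: divide_right_mono)
  then show "t \<le> v 0 / c" unfolding t_def by (rule order_trans[OF threshold_bound])
  have "0 \<le> (x + c * t) * t" using assms(1) c t by simp
  then show "0 \<le> integral {0..t} v" using integral_ge_threshold[of x] by (simp add: t_def)
  have "integral {0..t} v \<le> integral {0..t} (\<lambda>_. v 0)"
    using integrable[of 0] le[of 0] by (intro integral_le) auto
  then show "integral {0..t} v \<le> v 0 * t" using t by (simp add: mult.commute)
qed

end

lemma threshold_antimono_slope:
  assumes "0 < c" "c \<le> c'"
  shows "threshold v c' x \<le> threshold v c x"
proof -
  have c': "0 < c'" using assms by simp
  let ?t = "threshold v c x"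
  have "c * ?t \<le> c' * ?t" using assms threshold_nonneg[OF assms(1)] by (intro mult_right_mono) auto
  then have "v ?t - c' * ?t \<le> x" using threshold_at[OF assms(1), of x] by simp
  then show ?thesis using threshold_le_iff[OF c' threshold_nonneg[OF assms(1)]] by simp
qed

text \<open>Stretching the threshold of c' by c' / c leaves the product of slope and time unchanged
  and can only lower v, so the threshold of c has been reached by then.\<close>

lemma threshold_slope_le:
  assumes "0 < c" "c \<le> c'"
  shows "c * threshold v c x \<le> c' * threshold v c' x"
proof -
  have c': "0 < c'" using assms by simp
  let ?t = "threshold v c' x" and ?s = "c' / c * threshold v c' x"
  have t: "0 \<le> ?t" by (rule threshold_nonneg[OF c'])
  have "1 * ?t \<le> ?s" using assms t by (intro mult_right_mono) auto
  then have "v ?s \<le> v ?t" using t by (intro le) auto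
  moreover have "c * ?s = c' * ?t" using assms by simp
  ultimately have "v ?s - c * ?s \<le> x" using threshold_at[OF c', of x] by simp
  then have "threshold v c x \<le> ?s" using threshold_le_iff[OF assms(1), of ?s x] t assms by simp
  then have "c * threshold v c x \<le> c * ?s" using assms(1) by (intro mult_left_mono) auto
  then show ?thesis using assms by simp
qed

end

section \<open>Individual optimization\<close>

lemma expect_real:
  assumes "integrable M f"
  shows "has_expect M (\<lambda>\<omega>. ereal (f \<omega>))" "expect M (\<lambda>\<omega>. ereal (f \<omega>)) = ereal (integral\<^sup>L M f)"
proof -
  have [measurable]: "f \<in> borel_measurable M" using assms by simp
  obtain r q where rq: "0 \<le> r" "0 \<le> q" "(\<integral>\<^sup>+ \<omega>. ennreal (f \<omega>) \<partial>M) = ennreal r"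
    "(\<integral>\<^sup>+ \<omega>. ennreal (- f \<omega>) \<partial>M) = ennreal q" "integral\<^sup>L M f = r - q"
    using assms by (rule integrableE)
  show "has_expect M (\<lambda>\<omega>. ereal (f \<omega>))" unfolding has_expect_def by (simp add: rq)
  show "expect M (\<lambda>\<omega>. ereal (f \<omega>)) = ereal (integral\<^sup>L M f)" unfolding expect_def using rq by simp
qed

text \<open>The expectation of f may be minus infinity. Equality with a finite value forces
  integrability, and then g - f is nonnegative with integral 0.\<close>

lemma expect_le_real:
  fixes f g :: "'a \<Rightarrow> real"
  assumes g: "integrable M g" and f: "has_expect M (\<lambda>\<omega>. ereal (f \<omega>))"
    and le: "\<And>\<omega>. \<omega> \<in> space M \<Longrightarrow> f \<omega> \<le> g \<omega>"
  shows "expect M (\<lambda>\<omega>. ereal (f \<omega>)) \<le> ereal (integral\<^sup>L M g)"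
    and "expect M (\<lambda>\<omega>. ereal (f \<omega>)) = ereal (integral\<^sup>L M g) \<Longrightarrow> AE \<omega> in M. f \<omega> = g \<omega>"
proof -
  have "(\<lambda>\<omega>. real_of_ereal (ereal (f \<omega>))) \<in> borel_measurable M"
    using f unfolding has_expect_def by (intro borel_measurable_real_of_ereal) blast
  then have [measurable]: "f \<in> borel_measurable M" by simp
  have "(\<integral>\<^sup>+ \<omega>. ennreal (f \<omega>) \<partial>M) \<le> (\<integral>\<^sup>+ \<omega>. ennreal (g \<omega>) \<partial>M)"
    using le by (intro nn_integral_mono ennreal_leI) auto
  also have "\<dots> < top" using g unfolding real_integrable_def by (simp add: less_top)
  finally have pos: "(\<integral>\<^sup>+ \<omega>. ennreal (f \<omega>) \<partial>M) < top" .
  have "expect M (\<lambda>\<omega>. ereal (f \<omega>)) \<le> ereal (integral\<^sup>L M g) \<and>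
    (expect M (\<lambda>\<omega>. ereal (f \<omega>)) = ereal (integral\<^sup>L M g) \<longrightarrow> (AE \<omega> in M. f \<omega> = g \<omega>))"
  proof (cases "integrable M f")
    case True
    have "integral\<^sup>L M f \<le> integral\<^sup>L M g" using True g le by (intro integral_mono_AE) auto
    moreover have "AE \<omega> in M. f \<omega> = g \<omega>" if "integral\<^sup>L M f = integral\<^sup>L M g"
    proof -
      have "integral\<^sup>L M (\<lambda>\<omega>. g \<omega> - f \<omega>) = 0" using that True g by simp
      then have "AE \<omega> in M. g \<omega> - f \<omega> = 0"
        using True g le by (subst integral_nonneg_eq_0_iff_AE[symmetric]) auto
      then show ?thesis by eventually_elim simp
    qed
    ultimately show ?thesis using expect_real(2)[OF True] by simp
  next
    case False
    then have "(\<integral>\<^sup>+ \<omega>. ennreal (- f \<omega>) \<partial>M) = top"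
      using pos unfolding real_integrable_def by auto
    moreover obtain r where "(\<integral>\<^sup>+ \<omega>. ennreal (f \<omega>) \<partial>M) = ennreal r" "0 \<le> r"
      using pos by (cases "\<integral>\<^sup>+ \<omega>. ennreal (f \<omega>) \<partial>M") auto
    ultimately have "expect M (\<lambda>\<omega>. ereal (f \<omega>)) = - \<infinity>" unfolding expect_def by simp
    then show ?thesis by simp
  qed
  then show "expect M (\<lambda>\<omega>. ereal (f \<omega>)) \<le> ereal (integral\<^sup>L M g)"
    "expect M (\<lambda>\<omega>. ereal (f \<omega>)) = ereal (integral\<^sup>L M g) \<Longrightarrow> AE \<omega> in M. f \<omega> = g \<omega>" by auto
qed

context facility_model
begin

lemma net_marg_decreasing: "\<omega> \<in> space (prob_of Q) \<Longrightarrow> decreasing_path (\<lambda>s. net_marg Q i s \<omega>)"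
  by (intro decreasing_path.intro net_marg_antimono net_marg_right_continuous)

lemma space_natural_filtration [simp]:
  "space (natural_filtration (prob_of Q) Y t) = space (prob_of Q)"
  by (simp add: natural_filtration_def space_measure_of_conv)

lemma integral_net_marg_measurable:
  assumes "T \<in> borel_measurable (prob_of Q)" "\<And>\<omega>. \<omega> \<in> space (prob_of Q) \<Longrightarrow> 0 \<le> T \<omega>"
  shows "(\<lambda>\<omega>. integral {0..T \<omega>} (\<lambda>s. net_marg Q i s \<omega>)) \<in> borel_measurable (prob_of Q)"
proof -
  note [measurable] = assms(1)
  have "(\<lambda>\<omega>. path_integral (T \<omega>) (sample_path Q i \<omega>)) \<in> borel_measurable (prob_of Q)"
    using measurable_compose[OF measurable_Pair[OF assms(1) sample_path_measurable] path_integral_measurable] by simp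
  then have "(\<lambda>\<omega>. path_integral (T \<omega>) (sample_path Q i \<omega>) - opcost_integral (T \<omega>)) \<in> borel_measurable (prob_of Q)"
    by measurable
  then show ?thesis using integral_net_marg assms(2) by (subst measurable_cong) auto
qed

lemma marg0_integrable: "integrable (prob_of Q) (marg Q i 0)"
  by (rule square_integrable_imp_integrable[OF marg_measurable[OF order_refl] marg_square_integrable])

text \<open>The threshold duration with its slope as a free parameter. For c = \<gamma> \<lambda> /
  (1 - \<lambda> \<alpha>) it is \<open>threshold_duration Q \<alpha> x\<close>.\<close>

definition tau :: "real \<Rightarrow> real \<Rightarrow> nat \<Rightarrow> 'a \<Rightarrow> real" where
  "tau c x i \<omega> = threshold (\<lambda>s. net_marg Q i s \<omega>) c x"

context
  fixes c x :: real
  assumes c: "0 < c" and x: "0 \<le> x"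
begin

lemma tau_nonneg: "\<omega> \<in> space (prob_of Q) \<Longrightarrow> 0 \<le> tau c x i \<omega>"
  unfolding tau_def by (rule decreasing_path.threshold_nonneg[OF net_marg_decreasing c])

lemma tau_le_iff:
  assumes "\<omega> \<in> space (prob_of Q)" "0 \<le> t"
  shows "tau c x i \<omega> \<le> t \<longleftrightarrow> marg Q i t \<omega> \<le> x + c * t + opcost Q t"
  unfolding tau_def using decreasing_path.threshold_le_iff[OF net_marg_decreasing[OF assms(1)] c assms(2), of i x]
  by (auto simp: net_marg_def)

lemma tau_stopping_time: "stopping_time (natural_filtration (prob_of Q) (marg Q i)) (tau c x i)"
  unfolding stopping_time_def
proof
  fix t :: real
  let ?F = "natural_filtration (prob_of Q) (marg Q i) t"
  have "{\<omega> \<in> space (prob_of Q). tau c x i \<omega> \<le> t} \<in> sets ?F"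
  proof (cases "0 \<le> t")
    case True
    have "{\<omega> \<in> space (prob_of Q). tau c x i \<omega> \<le> t} = marg Q i t -` {..x + c * t + opcost Q t} \<inter> space (prob_of Q)"
      using tau_le_iff[OF _ True] by auto
    moreover have "marg Q i t -` {..x + c * t + opcost Q t} \<inter> space (prob_of Q) \<in> sets ?F"
    proof -
      have "marg Q i t -` {..x + c * t + opcost Q t} \<inter> space (prob_of Q)
          \<in> {marg Q i s -` B \<inter> space (prob_of Q) | s B. 0 \<le> s \<and> s \<le> t \<and> B \<in> sets borel}"
        using True by (intro CollectI exI[of _ t] exI[of _ "{..x + c * t + opcost Q t}"]) auto
      then show ?thesis
        unfolding natural_filtration_def by (subst sets_measure_of) (auto intro: sigma_sets.Basic)
    qed
    ultimately show ?thesis by simp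
  next
    case False
    then have "{\<omega> \<in> space (prob_of Q). tau c x i \<omega> \<le> t} = {}" using tau_nonneg[of _ i] by fastforce
    then show ?thesis by (simp only: sets.empty_sets)
  qed
  then show "Measurable.pred ?F (\<lambda>\<omega>. tau c x i \<omega> \<le> t)" by (simp only: pred_def space_natural_filtration)
qed

lemma tau_knowledge: "tau c x i \<in> borel_measurable (knowledge {Marg i})"
  by (rule stopping_time_knowledge[OF tau_stopping_time])

lemma tau_measurable: "tau c x i \<in> borel_measurable (prob_of Q)"
  by (rule measurable_info_M[OF tau_knowledge])

lemma tau_level_length:
  assumes "\<omega> \<in> space (prob_of Q)"
  shows "tau c x i \<omega> = level_length (\<lambda>u. x + c * u + opcost Q (max 0 u)) (sample_path Q i \<omega>)"
proof -
  have "(if 0 \<le> u \<and> x + c * u + opcost Q (max 0 u) < eval_path u (sample_path Q i \<omega>) then 1 else 0)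
      = (indicator {0..<tau c x i \<omega>} u :: ennreal)" for u
    using eval_sample_path[OF assms, of u i] tau_le_iff[OF assms, of u i]
    by (cases "0 \<le> u") (auto simp: indicator_def not_le[symmetric])
  then have "(\<integral>\<^sup>+ u. (if 0 \<le> u \<and> x + c * u + opcost Q (max 0 u) < eval_path u (sample_path Q i \<omega>) then 1 else 0) \<partial>lborel)
      = emeasure lborel {0..<tau c x i \<omega>}" by simp
  also have "\<dots> = ennreal (tau c x i \<omega>)" using tau_nonneg[OF assms, of i] by simp
  finally show ?thesis unfolding level_length_def using tau_nonneg[OF assms, of i] by simp
qed

lemma tau_identical:
  "distr (prob_of Q) (borel \<Otimes>\<^sub>M path_space) (\<lambda>\<omega>. (tau c x i \<omega>, sample_path Q i \<omega>))
    = distr (prob_of Q) (borel \<Otimes>\<^sub>M path_space) (\<lambda>\<omega>. (tau c x 0 \<omega>, sample_path Q 0 \<omega>))"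
proof -
  let ?b = "\<lambda>u. x + c * u + opcost Q (max 0 u)"
  have b: "?b \<in> borel_measurable borel" using opcost_measurable by measurable
  have lm: "(\<lambda>p. (level_length ?b p, p)) \<in> measurable path_space (borel \<Otimes>\<^sub>M path_space)"
    using level_length_measurable[OF b] by measurable
  have "distr (prob_of Q) (borel \<Otimes>\<^sub>M path_space) (\<lambda>\<omega>. (tau c x i \<omega>, sample_path Q i \<omega>))
      = distr (distr (prob_of Q) path_space (sample_path Q i)) (borel \<Otimes>\<^sub>M path_space) (\<lambda>p. (level_length ?b p, p))" for i
  proof -
    have "distr (prob_of Q) (borel \<Otimes>\<^sub>M path_space) (\<lambda>\<omega>. (tau c x i \<omega>, sample_path Q i \<omega>))
        = distr (prob_of Q) (borel \<Otimes>\<^sub>M path_space) (\<lambda>\<omega>. (level_length ?b (sample_path Q i \<omega>), sample_path Q i \<omega>))"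
      by (rule distr_cong) (simp_all only: tau_level_length)
    also have "\<dots> = distr (distr (prob_of Q) path_space (sample_path Q i)) (borel \<Otimes>\<^sub>M path_space) (\<lambda>p. (level_length ?b p, p))"
      by (rule distr_distr[OF lm sample_path_measurable, symmetric, unfolded comp_def])
    finally show ?thesis .
  qed
  from this[of i] this[of 0] show ?thesis using marg_identical[of i] by simp
qed

lemma tau_bounds:
  assumes "\<omega> \<in> space (prob_of Q)"
  shows "tau c x i \<omega> \<le> marg Q i 0 \<omega> / c"
    "0 \<le> integral {0..tau c x i \<omega>} (\<lambda>s. net_marg Q i s \<omega>)"
    "integral {0..tau c x i \<omega>} (\<lambda>s. net_marg Q i s \<omega>) \<le> (marg Q i 0 \<omega>)\<^sup>2 / c"
    "(x + c * tau c x i \<omega>) * tau c x i \<omega> \<le> integral {0..tau c x i \<omega>} (\<lambda>s. net_marg Q i s \<omega>)"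
proof -
  interpret d: decreasing_path "\<lambda>s. net_marg Q i s \<omega>" by (rule net_marg_decreasing[OF assms])
  have p: "0 \<le> net_marg Q i 0 \<omega>" using marg_pos[OF assms, of i] by (simp add: net_marg_0)
  note b = d.integral_threshold_bounds[OF c x p]
  show 1: "tau c x i \<omega> \<le> marg Q i 0 \<omega> / c" "0 \<le> integral {0..tau c x i \<omega>} (\<lambda>s. net_marg Q i s \<omega>)"
    using b by (simp_all add: tau_def net_marg_0)
  have "integral {0..tau c x i \<omega>} (\<lambda>s. net_marg Q i s \<omega>) \<le> marg Q i 0 \<omega> * tau c x i \<omega>"
    using b by (simp add: tau_def net_marg_0)
  also have "\<dots> \<le> marg Q i 0 \<omega> * (marg Q i 0 \<omega> / c)"
    using 1(1) p by (intro mult_left_mono) (auto simp: net_marg_0)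
  finally show "integral {0..tau c x i \<omega>} (\<lambda>s. net_marg Q i s \<omega>) \<le> (marg Q i 0 \<omega>)\<^sup>2 / c"
    by (simp add: power2_eq_square)
  show "(x + c * tau c x i \<omega>) * tau c x i \<omega> \<le> integral {0..tau c x i \<omega>} (\<lambda>s. net_marg Q i s \<omega>)"
    using d.integral_ge_threshold[OF c, of x] by (simp add: tau_def)
qed

lemma tau_square_le:
  assumes "\<omega> \<in> space (prob_of Q)"
  shows "(tau c x i \<omega>)\<^sup>2 \<le> (marg Q i 0 \<omega>)\<^sup>2 / c\<^sup>2"
  using power_mono[OF tau_bounds(1)[OF assms, of i] tau_nonneg[OF assms], of 2] by (simp add: power_divide)

lemma tau_square_integrable: "integrable (prob_of Q) (\<lambda>\<omega>. (tau c x i \<omega>)\<^sup>2)"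
proof (rule Bochner_Integration.integrable_bound)
  show "integrable (prob_of Q) (\<lambda>\<omega>. (marg Q i 0 \<omega>)\<^sup>2 / c\<^sup>2)" using marg_square_integrable[of i] by simp
  show "(\<lambda>\<omega>. (tau c x i \<omega>)\<^sup>2) \<in> borel_measurable (prob_of Q)" using tau_measurable by measurable
  show "AE \<omega> in prob_of Q. norm ((tau c x i \<omega>)\<^sup>2) \<le> norm ((marg Q i 0 \<omega>)\<^sup>2 / c\<^sup>2)"
    using tau_square_le by (intro AE_I2) simp
qed

lemma tau_integrable: "integrable (prob_of Q) (tau c x i)"
  by (rule square_integrable_imp_integrable[OF tau_measurable tau_square_integrable])

lemma tau_gain_integrable: "integrable (prob_of Q) (\<lambda>\<omega>. integral {0..tau c x i \<omega>} (\<lambda>s. net_marg Q i s \<omega>))"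
proof (rule Bochner_Integration.integrable_bound)
  show "integrable (prob_of Q) (\<lambda>\<omega>. (marg Q i 0 \<omega>)\<^sup>2 / c)" using marg_square_integrable[of i] by simp
  show "(\<lambda>\<omega>. integral {0..tau c x i \<omega>} (\<lambda>s. net_marg Q i s \<omega>)) \<in> borel_measurable (prob_of Q)"
    by (rule integral_net_marg_measurable[OF tau_measurable tau_nonneg])
  show "AE \<omega> in prob_of Q. norm (integral {0..tau c x i \<omega>} (\<lambda>s. net_marg Q i s \<omega>)) \<le> norm ((marg Q i 0 \<omega>)\<^sup>2 / c)"
    using tau_bounds(2,3) c by (intro AE_I2) simp
qed

definition pay :: "real \<Rightarrow> real \<Rightarrow> real" where
  "pay \<pi> s = \<pi> + s * x + s\<^sup>2 * (c / 2) + integral {0..s} (opcost Q)"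

definition utility :: "real \<Rightarrow> nat \<Rightarrow> ('a \<Rightarrow> real) \<Rightarrow> 'a \<Rightarrow> real" where
  "utility \<pi> i T \<omega> = integral {0..T \<omega>} (\<lambda>s. net_marg Q i s \<omega>) - x * T \<omega> - c / 2 * (T \<omega>)\<^sup>2 - \<pi>"

lemma service_utility_eq:
  assumes "\<omega> \<in> space (prob_of Q)" "0 \<le> T \<omega>"
  shows "service_utility Q (pay \<pi>) i T \<omega> = ereal (utility \<pi> i T \<omega>)"
proof -
  have "integral {0..T \<omega>} (\<lambda>s. net_marg Q i s \<omega>) = integral {0..T \<omega>} (\<lambda>s. marg Q i s \<omega>) - integral {0..T \<omega>} (opcost Q)"
    unfolding net_marg_def
    using marg_integrable_on[OF assms(1)] opcost_integrable_on
    by (intro Henstock_Kurzweil_Integration.integral_diff) auto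
  then show ?thesis by (simp add: service_utility_def utility_def pay_def algebra_simps)
qed

lemma expect_cong:
  assumes "\<And>\<omega>. \<omega> \<in> space M \<Longrightarrow> f \<omega> = g \<omega>"
  shows "expect M f = expect M g" "has_expect M f = has_expect M g"
proof -
  have 1: "(\<integral>\<^sup>+ \<omega>. e2ennreal (f \<omega>) \<partial>M) = (\<integral>\<^sup>+ \<omega>. e2ennreal (g \<omega>) \<partial>M)"
    "(\<integral>\<^sup>+ \<omega>. e2ennreal (- f \<omega>) \<partial>M) = (\<integral>\<^sup>+ \<omega>. e2ennreal (- g \<omega>) \<partial>M)"
    using assms by (auto intro!: nn_integral_cong)
  show "expect M f = expect M g" "has_expect M f = has_expect M g"
    unfolding expect_def has_expect_def 1 using measurable_cong[of M f g borel] assms by auto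
qed

lemma utility_tau_integrable: "integrable (prob_of Q) (utility \<pi> i (tau c x i))"
  unfolding utility_def[abs_def] using tau_gain_integrable tau_integrable tau_square_integrable by simp

lemma utility_le_tau:
  assumes "\<omega> \<in> space (prob_of Q)" "0 \<le> T \<omega>"
  shows "utility \<pi> i T \<omega> + c / 2 * (T \<omega> - tau c x i \<omega>)\<^sup>2 \<le> utility \<pi> i (tau c x i) \<omega>"
  using decreasing_path.utility_le_threshold[OF net_marg_decreasing[OF assms(1)] c assms(2), of i x]
  by (simp add: utility_def tau_def)

lemma objective_tau:
  "objective Q (pay \<pi>) i (tau c x i) = ereal (integral\<^sup>L (prob_of Q) (utility \<pi> i (tau c x i)))"
  "admissible_duration Q (pay \<pi>) i (tau c x i)"
proof -
  have eq: "service_utility Q (pay \<pi>) i (tau c x i) \<omega> = ereal (utility \<pi> i (tau c x i) \<omega>)" if "\<omega> \<in> space (prob_of Q)" for \<omega>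
    by (rule service_utility_eq[where T="tau c x i", OF that tau_nonneg[OF that]])
  note ec = expect_cong[where f="service_utility Q (pay \<pi>) i (tau c x i)"
      and g="\<lambda>\<omega>. ereal (utility \<pi> i (tau c x i) \<omega>)" and M="prob_of Q", OF eq]
  show "objective Q (pay \<pi>) i (tau c x i) = ereal (integral\<^sup>L (prob_of Q) (utility \<pi> i (tau c x i)))"
    using ec(1) expect_real(2)[OF utility_tau_integrable] by simp
  have "has_expect (prob_of Q) (service_utility Q (pay \<pi>) i (tau c x i))"
    using ec(2) expect_real(1)[OF utility_tau_integrable] by simp
  then show "admissible_duration Q (pay \<pi>) i (tau c x i)"
    unfolding admissible_duration_def using tau_nonneg tau_stopping_time by blast
qed

lemma objective_le_tau:
  assumes "admissible_duration Q (pay \<pi>) i T"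
  shows "objective Q (pay \<pi>) i T \<le> objective Q (pay \<pi>) i (tau c x i)"
    "objective Q (pay \<pi>) i T = objective Q (pay \<pi>) i (tau c x i) \<Longrightarrow> AE \<omega> in prob_of Q. T \<omega> = tau c x i \<omega>"
proof -
  have T: "0 \<le> T \<omega>" if "\<omega> \<in> space (prob_of Q)" for \<omega> using assms that unfolding admissible_duration_def by blast
  have eq: "service_utility Q (pay \<pi>) i T \<omega> = ereal (utility \<pi> i T \<omega>)" if "\<omega> \<in> space (prob_of Q)" for \<omega>
    by (rule service_utility_eq[where T=T, OF that T[OF that]])
  note ec = expect_cong[where f="service_utility Q (pay \<pi>) i T"
      and g="\<lambda>\<omega>. ereal (utility \<pi> i T \<omega>)" and M="prob_of Q", OF eq]
  have he: "has_expect (prob_of Q) (\<lambda>\<omega>. ereal (utility \<pi> i T \<omega>))"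
    using assms ec(2) unfolding admissible_duration_def by simp
  have le: "utility \<pi> i T \<omega> \<le> utility \<pi> i (tau c x i) \<omega>" if "\<omega> \<in> space (prob_of Q)" for \<omega>
  proof -
    have "0 \<le> c / 2 * (T \<omega> - tau c x i \<omega>)\<^sup>2" using c by simp
    then show ?thesis using utility_le_tau[of \<omega> T \<pi> i] that T[OF that] by linarith
  qed
  have e: "expect (prob_of Q) (\<lambda>\<omega>. ereal (utility \<pi> i T \<omega>)) \<le> ereal (integral\<^sup>L (prob_of Q) (utility \<pi> i (tau c x i)))"
    "expect (prob_of Q) (\<lambda>\<omega>. ereal (utility \<pi> i T \<omega>)) = ereal (integral\<^sup>L (prob_of Q) (utility \<pi> i (tau c x i)))
      \<Longrightarrow> AE \<omega> in prob_of Q. utility \<pi> i T \<omega> = utility \<pi> i (tau c x i) \<omega>"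
    using expect_le_real[OF utility_tau_integrable he] le by blast+
  show "objective Q (pay \<pi>) i T \<le> objective Q (pay \<pi>) i (tau c x i)"
    using e(1) ec(1) by (simp add: objective_tau)
  assume "objective Q (pay \<pi>) i T = objective Q (pay \<pi>) i (tau c x i)"
  then have "AE \<omega> in prob_of Q. utility \<pi> i T \<omega> = utility \<pi> i (tau c x i) \<omega>"
    using e(2) ec(1) by (simp add: objective_tau)
  then show "AE \<omega> in prob_of Q. T \<omega> = tau c x i \<omega>"
    using AE_space
  proof eventually_elim
    case (elim \<omega>)
    have "c / 2 * (T \<omega> - tau c x i \<omega>)\<^sup>2 \<le> 0" using utility_le_tau[of \<omega> T \<pi> i] elim T by simp
    then have "(T \<omega> - tau c x i \<omega>)\<^sup>2 \<le> 0" using c by (simp add: mult_le_0_iff)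
    then show ?case by simp
  qed
qed

text \<open>An admissible duration of equal value agrees with \<open>tau\<close> almost everywhere
  by the quadratic gap, so it cannot be smaller with positive probability; the same argument gives
  uniqueness.\<close>

lemma tau_unique_solution: "unique_individual_solution Q (pay \<pi>) i (tau c x i)"
proof -
  have "individual_solution Q (pay \<pi>) i (tau c x i)"
    unfolding individual_solution_def
  proof (intro conjI allI impI notI)
    show "admissible_duration Q (pay \<pi>) i (tau c x i)" by (rule objective_tau)
    show "objective Q (pay \<pi>) i S' \<le> objective Q (pay \<pi>) i (tau c x i)" if "admissible_duration Q (pay \<pi>) i S'" for S'
      by (rule objective_le_tau[OF that])
    assume "\<exists>S'. admissible_duration Q (pay \<pi>) i S' \<and> objective Q (pay \<pi>) i S' = objective Q (pay \<pi>) i (tau c x i) \<and>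
        (AE \<omega> in prob_of Q. S' \<omega> \<le> tau c x i \<omega>) \<and>
        0 < measure (prob_of Q) {\<omega> \<in> space (prob_of Q). S' \<omega> < tau c x i \<omega>}"
    then obtain S' where S': "admissible_duration Q (pay \<pi>) i S'" "objective Q (pay \<pi>) i S' = objective Q (pay \<pi>) i (tau c x i)"
      "0 < measure (prob_of Q) {\<omega> \<in> space (prob_of Q). S' \<omega> < tau c x i \<omega>}" by blast
    have "AE \<omega> in prob_of Q. \<not> S' \<omega> < tau c x i \<omega>"
      using objective_le_tau(2)[OF S'(1,2)] by eventually_elim simp
    then have "measure (prob_of Q) {\<omega> \<in> space (prob_of Q). S' \<omega> < tau c x i \<omega>} = 0"
      unfolding measure_def by (simp add: emeasure_eq_0_AE)
    then show False using S'(3) by simp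
  qed
  moreover have "AE \<omega> in prob_of Q. S' \<omega> = tau c x i \<omega>" if "individual_solution Q (pay \<pi>) i S'" for S'
  proof -
    have a: "admissible_duration Q (pay \<pi>) i S'" and "objective Q (pay \<pi>) i (tau c x i) \<le> objective Q (pay \<pi>) i S'"
      using that objective_tau(2)[of \<pi> i] unfolding individual_solution_def by blast+
    then show ?thesis using objective_le_tau[OF a] by (meson antisym)
  qed
  ultimately show ?thesis unfolding unique_individual_solution_def by blast
qed

lemma tau_profile: "service_profile Q (pay \<pi>) (tau c x)"
  unfolding service_profile_def using tau_unique_solution tau_identical by blast

lemma tau_profile_unique:
  assumes "service_profile Q (pay \<pi>) S"
  shows "AE \<omega> in prob_of Q. S i \<omega> = tau c x i \<omega>"
  using assms tau_unique_solution[of \<pi> i] unfolding service_profile_def unique_individual_solution_def by blast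

end

end

section \<open>The fixed point equations\<close>

lemma continuous_on_lipschitz_real:
  fixes f :: "real \<Rightarrow> real"
  assumes "\<And>x y. x \<in> S \<Longrightarrow> y \<in> S \<Longrightarrow> x \<le> y \<Longrightarrow> \<bar>f x - f y\<bar> \<le> L * (y - x)" "0 \<le> L"
  shows "continuous_on S f"
proof -
  have "L-lipschitz_on S f"
  proof (rule lipschitz_onI)
    fix x y assume "x \<in> S" "y \<in> S"
    then show "dist (f x) (f y) \<le> L * dist x y"
      using assms(1)[of x y] assms(1)[of y x] by (cases "x \<le> y") (auto simp: dist_real_def abs_minus_commute)
  qed (rule assms)
  then show ?thesis by (rule lipschitz_on_continuous_on)
qed

context facility_model
begin

definition mean_tau :: "real \<Rightarrow> real \<Rightarrow> real" where "mean_tau c x = expectation (tau c x 0)"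
definition square_tau :: "real \<Rightarrow> real \<Rightarrow> real" where "square_tau c x = expectation (\<lambda>\<omega>. (tau c x 0 \<omega>)\<^sup>2)"
definition mean_value :: real where "mean_value = expectation (marg Q 0 0)"
definition square_value :: real where "square_value = expectation (\<lambda>\<omega>. (marg Q 0 0 \<omega>)\<^sup>2)"

lemma mean_value_nonneg: "0 \<le> mean_value" "0 \<le> square_value"
proof -
  show "0 \<le> mean_value" unfolding mean_value_def using marg_pos by (intro integral_nonneg_AE AE_I2) (simp add: less_imp_le)
  show "0 \<le> square_value" unfolding square_value_def by (rule integral_nonneg_AE) simp
qed

lemma tau_antimono:
  assumes "0 < c" "0 \<le> x" "x \<le> y" "\<omega> \<in> space (prob_of Q)"
  shows "tau c y i \<omega> \<le> tau c x i \<omega>" "tau c x i \<omega> - tau c y i \<omega> \<le> (y - x) / c"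
  unfolding tau_def
  using decreasing_path.threshold_antimono[OF net_marg_decreasing[OF assms(4)] assms(1,3)]
    decreasing_path.threshold_lipschitz[OF net_marg_decreasing[OF assms(4)] assms(1,3)] by auto

lemma tau_slope:
  assumes "0 < c" "c \<le> c'" "\<omega> \<in> space (prob_of Q)"
  shows "tau c' x i \<omega> \<le> tau c x i \<omega>" "c * tau c x i \<omega> \<le> c' * tau c' x i \<omega>"
  unfolding tau_def
  using decreasing_path.threshold_antimono_slope[OF net_marg_decreasing[OF assms(3)] assms(1,2)]
    decreasing_path.threshold_slope_le[OF net_marg_decreasing[OF assms(3)] assms(1,2)] by auto

lemma tau_moments_nonneg:
  assumes "0 < c" "0 \<le> x"
  shows "0 \<le> mean_tau c x" "0 \<le> square_tau c x"
  unfolding mean_tau_def square_tau_def using tau_nonneg[OF assms] by (auto intro!: integral_nonneg_AE AE_I2)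

lemma mean_tau_le:
  assumes "0 < c" "0 \<le> x"
  shows "mean_tau c x \<le> mean_value / c"
proof -
  have "mean_tau c x \<le> expectation (\<lambda>\<omega>. marg Q 0 0 \<omega> / c)"
    unfolding mean_tau_def using tau_integrable[OF assms] marg0_integrable tau_bounds(1)[OF assms] assms
    by (intro integral_mono_AE AE_I2) auto
  then show ?thesis by (simp add: mean_value_def)
qed

lemma square_tau_le:
  assumes "0 < c" "0 \<le> x"
  shows "c\<^sup>2 * square_tau c x \<le> square_value"
proof -
  have "square_tau c x \<le> expectation (\<lambda>\<omega>. (marg Q 0 0 \<omega>)\<^sup>2 / c\<^sup>2)"
    unfolding square_tau_def using tau_square_integrable[OF assms] marg_square_integrable tau_square_le[OF assms]
    by (intro integral_mono_AE AE_I2) auto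
  then have "square_tau c x \<le> square_value / c\<^sup>2" by (simp add: square_value_def)
  then show ?thesis using assms by (simp add: field_simps)
qed

lemma mean_tau_antimono:
  assumes "0 < c" "0 \<le> x" "x \<le> y"
  shows "mean_tau c y \<le> mean_tau c x" "mean_tau c x - mean_tau c y \<le> (y - x) / c"
proof -
  have y: "0 \<le> y" using assms by simp
  note i = tau_integrable[OF assms(1,2), of 0] tau_integrable[OF assms(1) y, of 0]
  show "mean_tau c y \<le> mean_tau c x"
    unfolding mean_tau_def using i tau_antimono[OF assms] by (intro integral_mono_AE AE_I2) auto
  have "expectation (\<lambda>\<omega>. tau c x 0 \<omega> - tau c y 0 \<omega>) \<le> expectation (\<lambda>\<omega>. (y - x) / c)"
    using i tau_antimono[OF assms] by (intro integral_mono_AE AE_I2) auto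
  then show "mean_tau c x - mean_tau c y \<le> (y - x) / c" using i by (simp add: mean_tau_def prob_space)
qed

lemma square_tau_antimono:
  assumes "0 < c" "0 \<le> x" "x \<le> y"
  shows "square_tau c y \<le> square_tau c x" "square_tau c x - square_tau c y \<le> (y - x) * (2 * mean_value / c\<^sup>2)"
proof -
  have y: "0 \<le> y" using assms by simp
  note i = tau_square_integrable[OF assms(1,2), of 0] tau_square_integrable[OF assms(1) y, of 0]
  show "square_tau c y \<le> square_tau c x"
    unfolding square_tau_def using i tau_antimono[OF assms] tau_nonneg[OF assms(1) y]
    by (intro integral_mono_AE AE_I2 power_mono) auto
  have "expectation (\<lambda>\<omega>. (tau c x 0 \<omega>)\<^sup>2 - (tau c y 0 \<omega>)\<^sup>2) \<le> expectation (\<lambda>\<omega>. (y - x) * (2 / c\<^sup>2) * marg Q 0 0 \<omega>)"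
  proof (intro integral_mono_AE AE_I2)
    fix \<omega> assume \<omega>: "\<omega> \<in> space (prob_of Q)"
    have "(tau c x 0 \<omega>)\<^sup>2 - (tau c y 0 \<omega>)\<^sup>2 = (tau c x 0 \<omega> - tau c y 0 \<omega>) * (tau c x 0 \<omega> + tau c y 0 \<omega>)"
      by (simp add: power2_eq_square algebra_simps)
    also have "\<dots> \<le> ((y - x) / c) * (marg Q 0 0 \<omega> / c + marg Q 0 0 \<omega> / c)"
      using tau_antimono[OF assms \<omega>] tau_bounds(1)[OF assms(1,2) \<omega>] tau_bounds(1)[OF assms(1) y \<omega>]
        tau_nonneg[OF assms(1,2) \<omega>] tau_nonneg[OF assms(1) y \<omega>] assms
      by (intro mult_mono add_mono) auto
    also have "\<dots> = (y - x) * (2 / c\<^sup>2) * marg Q 0 0 \<omega>" using assms(1) by (simp add: power2_eq_square field_simps)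
    finally show "(tau c x 0 \<omega>)\<^sup>2 - (tau c y 0 \<omega>)\<^sup>2 \<le> (y - x) * (2 / c\<^sup>2) * marg Q 0 0 \<omega>" .
  qed (use i marg0_integrable in auto)
  then show "square_tau c x - square_tau c y \<le> (y - x) * (2 * mean_value / c\<^sup>2)"   proof -
    have "expectation (\<lambda>\<omega>. (y - x) * (2 / c\<^sup>2) * marg Q 0 0 \<omega>) = (y - x) * (2 / c\<^sup>2) * mean_value"
      unfolding mean_value_def by (rule Bochner_Integration.integral_mult_right_zero)
    also have "\<dots> = (y - x) * (2 * mean_value / c\<^sup>2)" by simp
    finally have e: "expectation (\<lambda>\<omega>. (y - x) * (2 / c\<^sup>2) * marg Q 0 0 \<omega>) = (y - x) * (2 * mean_value / c\<^sup>2)" .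
    assume "expectation (\<lambda>\<omega>. (tau c x 0 \<omega>)\<^sup>2 - (tau c y 0 \<omega>)\<^sup>2) \<le> expectation (\<lambda>\<omega>. (y - x) * (2 / c\<^sup>2) * marg Q 0 0 \<omega>)"
    then show ?thesis unfolding e using i by (simp only: square_tau_def Bochner_Integration.integral_diff)
  qed
qed

text \<open>\<open>tau\<close> decreases in the slope while the product of slope and
  \<open>tau\<close> increases, so the moments change at most by powers of c' / c.\<close>

lemma tau_moments_slope:
  assumes "0 < c" "c \<le> c'" "0 \<le> x"
  shows "mean_tau c' x \<le> mean_tau c x" "mean_tau c x \<le> c' / c * mean_tau c' x" "square_tau c' x \<le> square_tau c x" "c\<^sup>2 * square_tau c x \<le> c'\<^sup>2 * square_tau c' x"
proof -
  have c': "0 < c'" using assms by simp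
  note i = tau_integrable[OF assms(1,3), of 0] tau_integrable[OF c' assms(3), of 0]
    tau_square_integrable[OF assms(1,3), of 0] tau_square_integrable[OF c' assms(3), of 0]
  note s = tau_slope[OF assms(1,2), of _ x 0] and n = tau_nonneg[OF c' assms(3), of _ 0] tau_nonneg[OF assms(1,3), of _ 0]
  show "mean_tau c' x \<le> mean_tau c x" unfolding mean_tau_def using i s by (intro integral_mono_AE AE_I2) auto
  show "square_tau c' x \<le> square_tau c x" unfolding square_tau_def using i s n by (intro integral_mono_AE AE_I2 power_mono) auto
  have "expectation (tau c x 0) \<le> expectation (\<lambda>\<omega>. c' / c * tau c' x 0 \<omega>)"
    using i s assms(1) by (intro integral_mono_AE AE_I2) (auto simp: field_simps)
  then show "mean_tau c x \<le> c' / c * mean_tau c' x" by (simp add: mean_tau_def)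
  have "expectation (\<lambda>\<omega>. (c * tau c x 0 \<omega>)\<^sup>2) \<le> expectation (\<lambda>\<omega>. (c' * tau c' x 0 \<omega>)\<^sup>2)"
    using i s n assms(1) by (intro integral_mono_AE AE_I2 power_mono) (auto simp: power_mult_distrib)
  then show "c\<^sup>2 * square_tau c x \<le> c'\<^sup>2 * square_tau c' x" by (simp add: square_tau_def power_mult_distrib)
qed

text \<open>Excludes x = 0 as a fixed point: the initial marginal utility is positive, so
  \<open>tau c 0\<close> is positive everywhere.\<close>

lemma square_tau_0_pos:
  assumes "0 < c"
  shows "0 < square_tau c 0"
proof -
  have "tau c 0 0 \<omega> > 0" if "\<omega> \<in> space (prob_of Q)" for \<omega>
    unfolding tau_def using decreasing_path.threshold_pos[OF net_marg_decreasing[OF that] assms, of 0 0] marg_pos[OF that, of 0]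
    by (simp add: net_marg_0)
  moreover have "square_tau c 0 \<noteq> 0"
  proof
    assume "square_tau c 0 = 0"
    then have "AE \<omega> in prob_of Q. (tau c 0 0 \<omega>)\<^sup>2 = 0"
      unfolding square_tau_def using integral_nonneg_eq_0_iff_AE[OF tau_square_integrable[OF assms order_refl, of 0]] by simp
    then have "AE \<omega> in prob_of Q. False" using AE_space by eventually_elim (use calculation in force)
    then show False by simp
  qed
  ultimately show ?thesis using tau_moments_nonneg(2)[OF assms, of 0] by simp
qed

text \<open>The right-hand side of the equation for \<open>x\<^sup>*\<close>, when \<open>\<gamma> \<lambda> / (1 - \<lambda> \<alpha>)\<close> is replaced by \<open>c\<close>.\<close>

definition price_map :: "real \<Rightarrow> real \<Rightarrow> real" where "price_map c x = c\<^sup>2 * square_tau c x / (2 * mean_wcost Q)"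

lemma price_map_antimono: "0 < c \<Longrightarrow> 0 \<le> x \<Longrightarrow> x \<le> y \<Longrightarrow> price_map c y \<le> price_map c x"
  unfolding price_map_def using square_tau_antimono(1) mean_wcost_pos by (intro divide_right_mono mult_left_mono) auto

lemma price_map_mono: "0 < c \<Longrightarrow> c \<le> c' \<Longrightarrow> 0 \<le> x \<Longrightarrow> price_map c x \<le> price_map c' x"
  unfolding price_map_def using tau_moments_slope(4) mean_wcost_pos by (intro divide_right_mono) auto

lemma price_map_slope: "0 < c \<Longrightarrow> c \<le> c' \<Longrightarrow> 0 \<le> x \<Longrightarrow> price_map c' x \<le> (c' / c)\<^sup>2 * price_map c x"
proof -
  assume a: "0 < c" "c \<le> c'" "0 \<le> x"
  then have "price_map c' x \<le> c'\<^sup>2 * square_tau c x / (2 * mean_wcost Q)"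
    unfolding price_map_def using tau_moments_slope(3)[OF a] mean_wcost_pos by (intro divide_right_mono mult_left_mono) auto
  also have "\<dots> = (c' / c)\<^sup>2 * price_map c x" using a unfolding price_map_def by (simp add: power_divide)
  finally show ?thesis .
qed

lemma fixed_x:
  assumes c: "0 < c"
  shows "\<exists>x>0. price_map c x = x"
proof -
  note g = mean_wcost_pos
  \<comment> \<open>An upper bound for \<open>price_map\<close> at every slope and every x, because
    c \<open>tau\<close> is at most the initial marginal utility.\<close>
  define K where "K = square_value / (2 * mean_wcost Q)"
  have K: "0 \<le> K" using mean_value_nonneg g by (simp add: K_def)
  have "\<exists>x\<ge>0. x \<le> K \<and> x - price_map c x = 0"
  proof (rule IVT')
    show "0 - price_map c 0 \<le> 0" unfolding price_map_def using tau_moments_nonneg(2)[OF c, of 0] g by simp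
    have "price_map c K \<le> K" unfolding price_map_def K_def using square_tau_le[OF c, of K] K g by (intro divide_right_mono) (auto simp: K_def)
    then show "0 \<le> K - price_map c K" by simp
    define L where "L = 1 + c\<^sup>2 / (2 * mean_wcost Q) * (2 * mean_value / c\<^sup>2)"
    show "continuous_on {0..K} (\<lambda>x. x - price_map c x)"
    proof (rule continuous_on_lipschitz_real[where L=L])
      fix x y assume xy: "x \<in> {0..K}" "y \<in> {0..K}" "x \<le> y"
      then have x: "0 \<le> x" by simp
      have "price_map c x - price_map c y = c\<^sup>2 / (2 * mean_wcost Q) * (square_tau c x - square_tau c y)"
        unfolding price_map_def by (simp add: diff_divide_distrib right_diff_distrib)
      also have "\<dots> \<le> c\<^sup>2 / (2 * mean_wcost Q) * ((y - x) * (2 * mean_value / c\<^sup>2))"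
        using square_tau_antimono(2)[OF c x xy(3)] g by (intro mult_left_mono) auto
      finally have "price_map c x - price_map c y \<le> c\<^sup>2 / (2 * mean_wcost Q) * (2 * mean_value / c\<^sup>2) * (y - x)" by (simp only: ac_simps)
      moreover have "0 \<le> price_map c x - price_map c y" using price_map_antimono[OF c x xy(3)] by simp
      moreover have "\<bar>(x - price_map c x) - (y - price_map c y)\<bar> \<le> (y - x) + (price_map c x - price_map c y)" using xy(3) calculation(2) by simp
      ultimately show "\<bar>(x - price_map c x) - (y - price_map c y)\<bar> \<le> L * (y - x)" unfolding L_def by (simp add: distrib_right)
    next
      show "0 \<le> L" unfolding L_def using mean_value_nonneg g by (intro add_nonneg_nonneg mult_nonneg_nonneg divide_nonneg_nonneg) auto
    qed
  qed (rule K)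
  then obtain x where x: "0 \<le> x" "price_map c x = x" by auto
  moreover have "x \<noteq> 0"
  proof
    assume "x = 0"
    then have "price_map c 0 = 0" using x by simp
    then show False using square_tau_0_pos[OF c] c g by (simp add: price_map_def)
  qed
  ultimately show ?thesis by (intro exI[of _ x]) auto
qed

text \<open>The fixed point is unique, since \<open>price_map c\<close> is nonincreasing; its
  dependence on c is studied through the fixed point equation.\<close>

definition base_price :: "real \<Rightarrow> real" where "base_price c = (SOME x. 0 < x \<and> price_map c x = x)"

lemma base_price:
  assumes "0 < c"
  shows "0 < base_price c" "price_map c (base_price c) = base_price c"
  using someI_ex[of "\<lambda>x. 0 < x \<and> price_map c x = x"] fixed_x[OF assms] unfolding base_price_def by auto

lemma base_price_mono:
  assumes "0 < c" "c \<le> c'"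
  shows "base_price c \<le> base_price c'"
proof (rule ccontr)
  assume n: "\<not> ?thesis"
  have c': "0 < c'" using assms by simp
  have "base_price c = price_map c (base_price c)" using base_price(2)[OF assms(1)] by simp
  also have "\<dots> \<le> price_map c' (base_price c)" using price_map_mono[OF assms] base_price(1)[OF assms(1)] by simp
  also have "\<dots> \<le> price_map c' (base_price c')" using price_map_antimono[OF c', of "base_price c'" "base_price c"] base_price(1)[OF c'] n by simp
  also have "\<dots> = base_price c'" by (rule base_price(2)[OF c'])
  finally show False using n by simp
qed

text \<open>As c grows, \<open>price_map\<close> at a fixed argument grows at most like c^2, and
  moving the argument up from \<open>base_price c\<close> to \<open>base_price c'\<close> only
  lowers it. This yields a Lipschitz bound for \<open>base_price\<close> on compact intervals of
  slopes.\<close>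

lemma base_price_slope:
  assumes "0 < c" "c \<le> c'"
  shows "base_price c' \<le> (c' / c)\<^sup>2 * base_price c"
proof -
  have c': "0 < c'" using assms by simp
  have "base_price c' = price_map c' (base_price c')" using base_price(2)[OF c'] by simp
  also have "\<dots> \<le> price_map c' (base_price c)" using price_map_antimono[OF c', of "base_price c" "base_price c'"] base_price(1)[OF assms(1)] base_price_mono[OF assms] by simp
  also have "\<dots> \<le> (c' / c)\<^sup>2 * price_map c (base_price c)" using price_map_slope[OF assms] base_price(1)[OF assms(1)] by simp
  also have "\<dots> = (c' / c)\<^sup>2 * base_price c" by (simp add: base_price(2)[OF assms(1)])
  finally show ?thesis .
qed

lemma fixed_point:
  "\<exists>c x. 0 < x \<and> 0 < c \<and> price_map c x = x \<and> mean_wcost Q * rate Q / c + rate Q * mean_tau c x = 1"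
proof -
  note g = mean_wcost_pos and r = rate_pos
  define b where "b = mean_wcost Q * rate Q"
  have b: "0 < b" using g r by (simp add: b_def)
  \<comment> \<open>The end points of the interval for c: at c = b the first term of h is already 1,
    and at c = K both terms together are at most 1, because \<open>mean_tau\<close> is at most
    \<open>mean_value / c\<close>.\<close>
  define K where "K = b + rate Q * mean_value"
  have K: "b \<le> K" "0 < K" using b r mean_value_nonneg by (auto simp: K_def add_pos_nonneg)
  define h where "h c = b / c + rate Q * mean_tau c (base_price c)" for c
  have "\<exists>c\<ge>b. c \<le> K \<and> h c = 1"
  proof (rule IVT2')
    have "0 \<le> mean_tau b (base_price b)" using tau_moments_nonneg(1)[OF b] base_price(1)[OF b] by simp
    then show "1 \<le> h b" using b r by (simp add: h_def)
    have "mean_tau K (base_price K) \<le> mean_value / K" using mean_tau_le[OF K(2)] base_price(1)[OF K(2)] by simp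
    then have "rate Q * mean_tau K (base_price K) \<le> rate Q * (mean_value / K)" using r by (intro mult_left_mono) auto
    then have "h K \<le> b / K + rate Q * mean_value / K" by (simp add: h_def)
    also have "\<dots> = 1" using K(2) unfolding K_def by (simp add: add_divide_distrib[symmetric])
    finally show "h K \<le> 1" .
    \<comment> \<open>The change is split into a change of the base price at a fixed slope and a
      change of the slope at a fixed price; both are Lipschitz because c stays above b.\<close>
    have "continuous_on {b..K} (\<lambda>c. mean_tau c (base_price c))"
    proof (rule continuous_on_lipschitz_real)
      fix c c' assume cc: "c \<in> {b..K}" "c' \<in> {b..K}" "c \<le> c'"
      have c: "0 < c" "0 < c'" "b \<le> c" "b \<le> c'" "c' \<le> K" using cc b by auto
      have X0: "0 \<le> base_price c" "0 \<le> base_price c'" using base_price(1) c by (auto intro: less_imp_le)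
      have XK: "base_price c \<le> base_price K" using base_price_mono[OF c(1), of K] cc by simp
      have 0: "mean_tau c' (base_price c') \<le> mean_tau c (base_price c)"
        using mean_tau_antimono(1)[OF c(2) X0(1) base_price_mono[OF c(1) cc(3)]] tau_moments_slope(1)[OF c(1) cc(3) X0(1)] by simp
      have "base_price c' - base_price c \<le> ((c' / c)\<^sup>2 - 1) * base_price c" using base_price_slope[OF c(1) cc(3)] by (simp add: left_diff_distrib)
      also have "(c' / c)\<^sup>2 - 1 = (c' - c) * ((c' + c) / c\<^sup>2)" using c by (simp add: power2_eq_square field_simps)
      also have "(c' - c) * ((c' + c) / c\<^sup>2) * base_price c \<le> (c' - c) * ((K + K) / b\<^sup>2) * base_price K"
        using cc c b X0 XK by (intro mult_mono mult_left_mono frac_le power_mono add_mono) auto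
      finally have XX: "base_price c' - base_price c \<le> (c' - c) * ((K + K) / b\<^sup>2) * base_price K" .
      have "mean_tau c (base_price c) - mean_tau c (base_price c') \<le> (base_price c' - base_price c) / c" by (rule mean_tau_antimono(2)[OF c(1) X0(1) base_price_mono[OF c(1) cc(3)]])
      also have "\<dots> \<le> (base_price c' - base_price c) / b" using base_price_mono[OF c(1) cc(3)] c b by (intro divide_left_mono) auto
      also have "\<dots> \<le> (c' - c) * ((K + K) / b\<^sup>2) * base_price K / b" using XX b by (intro divide_right_mono) auto
      finally have 1: "mean_tau c (base_price c) - mean_tau c (base_price c') \<le> (c' - c) * ((K + K) / b\<^sup>2) * base_price K / b" .
      have "mean_tau c (base_price c') - mean_tau c' (base_price c') \<le> (c' / c - 1) * mean_tau c' (base_price c')"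
        using tau_moments_slope(2)[OF c(1) cc(3) X0(2)] by (simp add: left_diff_distrib)
      also have "\<dots> \<le> (c' - c) / b * (mean_value / b)"
      proof (rule mult_mono)
        have "c' / c - 1 = (c' - c) / c" using c by (simp add: diff_divide_distrib)
        also have "\<dots> \<le> (c' - c) / b" using cc c b by (intro divide_left_mono) auto
        finally show "c' / c - 1 \<le> (c' - c) / b" .
        have "mean_tau c' (base_price c') \<le> mean_value / c'" by (rule mean_tau_le[OF c(2) X0(2)])
        also have "\<dots> \<le> mean_value / b" using c b mean_value_nonneg by (intro divide_left_mono) auto
        finally show "mean_tau c' (base_price c') \<le> mean_value / b" .
        show "0 \<le> (c' - c) / b" using cc b by simp
        show "0 \<le> mean_tau c' (base_price c')" by (rule tau_moments_nonneg(1)[OF c(2) X0(2)])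
      qed
      finally have 2: "mean_tau c (base_price c') - mean_tau c' (base_price c') \<le> (c' - c) / b * (mean_value / b)" .
      have "\<bar>mean_tau c (base_price c) - mean_tau c' (base_price c')\<bar> = mean_tau c (base_price c) - mean_tau c' (base_price c')" using 0 by simp
      also have "\<dots> \<le> (c' - c) * ((K + K) / b\<^sup>2) * base_price K / b + (c' - c) / b * (mean_value / b)" using 1 2 by linarith
      also have "\<dots> = ((K + K) / b\<^sup>2 * base_price K / b + mean_value / b / b) * (c' - c)" by (simp add: algebra_simps)
      finally show "\<bar>mean_tau c (base_price c) - mean_tau c' (base_price c')\<bar> \<le> ((K + K) / b\<^sup>2 * base_price K / b + mean_value / b / b) * (c' - c)" .
    next
      show "0 \<le> (K + K) / b\<^sup>2 * base_price K / b + mean_value / b / b" using K b mean_value_nonneg base_price(1)[OF K(2)] by simp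
    qed
    then show "continuous_on {b..K} h"
      unfolding h_def using b by (intro continuous_intros) auto
  qed (rule K(1))
  then obtain c where c: "b \<le> c" "h c = 1" by blast
  then have "0 < c" using b by simp
  then show ?thesis using base_price[of c] c by (intro exI[of _ c] exI[of _ "base_price c"]) (auto simp: h_def b_def)
qed

end

section \<open>Optimality\<close>

text \<open>
  Up to a positive factor this is \<open>0 \<le> E (S / sqrt u - S\<^sup>* sqrt u / u0)\<^sup>2\<close> with \<open>A = E (S S\<^sup>*)\<close>, \<open>B = E S\<^sup>2\<close>,
  \<open>B0 = E (S\<^sup>*)\<^sup>2\<close>: the tangent inequality of the convex function \<open>(s, u) \<mapsto> s\<^sup>2 / u\<close>.
\<close>

lemma quadratic_over_linear:
  fixes u u0 A B B0 k :: real
  assumes "0 < u" "0 < u0" "0 \<le> k" and sq: "0 \<le> B * u0\<^sup>2 - 2 * A * u * u0 + B0 * u\<^sup>2"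
  shows "k * B0 / (2 * u0\<^sup>2) * (u0 - u) + k / u0 * (A - B0) - k * B / (2 * u) \<le> - (k * B0 / (2 * u0))"
proof -
  have "0 \<le> k / (2 * u * u0\<^sup>2) * (B * u0\<^sup>2 - 2 * A * u * u0 + B0 * u\<^sup>2)"
    using assms by (intro mult_nonneg_nonneg) auto
  also have "\<dots> = - (k * B0 / (2 * u0)) - (k * B0 / (2 * u0\<^sup>2) * (u0 - u) + k / u0 * (A - B0) - k * B / (2 * u))"
    using assms(1,2) by (simp add: field_simps power2_eq_square)
  finally show ?thesis by simp
qed

context facility_model
begin

text \<open>In the waiting term k E S^2 / (2 u) with k = \<gamma> \<lambda> and u = 1 - \<lambda> E
  S, a small increase of S is charged x through u and c S through E S^2, both evaluated at
  \<open>tau\<close>. So x + c \<open>tau\<close> is the marginal social cost of service time.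
  \<open>integral_le_threshold\<close> shows that \<open>tau\<close> maximizes the linearised
  welfare, and \<open>quadratic_over_linear\<close> passes from the linearisation to
  \<open>phi\<close>.\<close>

lemma phi_le_tau:
  assumes c: "0 < c" and x: "0 \<le> x"
    and load: "rate Q * mean_tau c x < 1" and c_eq: "c * (1 - rate Q * mean_tau c x) = mean_wcost Q * rate Q"
    and x_eq: "x = mean_wcost Q * ((rate Q)\<^sup>2 * square_tau c x / (2 * (1 - rate Q * mean_tau c x)\<^sup>2))"
    and T_nonneg: "\<And>\<omega>. \<omega> \<in> space (prob_of Q) \<Longrightarrow> 0 \<le> T \<omega>"
    and T_int: "integrable (prob_of Q) (\<lambda>\<omega>. (T \<omega>)\<^sup>2)" and T_meas: "T \<in> borel_measurable (prob_of Q)"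
    and T_load: "rate Q * expectation T < 1"
    and gain: "integrable (prob_of Q) (\<lambda>\<omega>. integral {0..T \<omega>} (\<lambda>s. net_marg Q 0 s \<omega>))"
  shows "phi Q (net_marg Q 0) T \<le> phi Q (net_marg Q 0) (tau c x 0)"
proof -
  let ?t = "tau c x 0"
  let ?J = "\<lambda>T \<omega>. integral {0..T \<omega>} (\<lambda>s. net_marg Q 0 s \<omega>)"
  note g = mean_wcost_pos and r = rate_pos
  define u where "u = 1 - rate Q * expectation T"
  define u0 where "u0 = 1 - rate Q * mean_tau c x"
  have u: "0 < u" "0 < u0" using load T_load by (auto simp: u_def u0_def)
  define k where "k = mean_wcost Q * rate Q"
  have k: "0 \<le> k" using g r by (simp add: k_def)
  have ck: "c = k / u0" using c_eq u by (simp add: k_def u0_def field_simps)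
  have T1: "integrable (prob_of Q) T" by (rule square_integrable_imp_integrable[OF T_meas T_int])
  note t = tau_integrable[OF c x, of 0] tau_square_integrable[OF c x, of 0] tau_measurable[OF c x, of 0]
  have tT: "integrable (prob_of Q) (\<lambda>\<omega>. ?t \<omega> * T \<omega>)"
  proof (rule Bochner_Integration.integrable_bound)
    show "integrable (prob_of Q) (\<lambda>\<omega>. (?t \<omega>)\<^sup>2 + (T \<omega>)\<^sup>2)" using t T_int by simp
    show "(\<lambda>\<omega>. ?t \<omega> * T \<omega>) \<in> borel_measurable (prob_of Q)" using t(3) T_meas by measurable
    show "AE \<omega> in prob_of Q. norm (?t \<omega> * T \<omega>) \<le> norm ((?t \<omega>)\<^sup>2 + (T \<omega>)\<^sup>2)"
    proof (rule AE_I2)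
      fix \<omega> assume \<omega>: "\<omega> \<in> space (prob_of Q)"
      have "2 * (?t \<omega> * T \<omega>) \<le> (?t \<omega>)\<^sup>2 + (T \<omega>)\<^sup>2"
        using zero_le_power2[of "?t \<omega> - T \<omega>"] by (simp add: power2_diff)
      moreover have "0 \<le> ?t \<omega> * T \<omega>" using T_nonneg[OF \<omega>] tau_nonneg[OF c x \<omega>] by simp
      ultimately show "norm (?t \<omega> * T \<omega>) \<le> norm ((?t \<omega>)\<^sup>2 + (T \<omega>)\<^sup>2)" by simp
    qed
  qed
  have "expectation (?J T) \<le> expectation (\<lambda>\<omega>. ?J ?t \<omega> + x * (T \<omega> - ?t \<omega>) + c * (?t \<omega> * T \<omega> - (?t \<omega>)\<^sup>2))"
  proof (rule integral_mono_AE)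
    show "AE \<omega> in prob_of Q. ?J T \<omega> \<le> ?J ?t \<omega> + x * (T \<omega> - ?t \<omega>) + c * (?t \<omega> * T \<omega> - (?t \<omega>)\<^sup>2)"
    proof (rule AE_I2)
      fix \<omega> assume \<omega>: "\<omega> \<in> space (prob_of Q)"
      show "?J T \<omega> \<le> ?J ?t \<omega> + x * (T \<omega> - ?t \<omega>) + c * (?t \<omega> * T \<omega> - (?t \<omega>)\<^sup>2)"
        using decreasing_path.integral_le_threshold[OF net_marg_decreasing[OF \<omega>] c T_nonneg[OF \<omega>], of 0 x]
        by (simp add: tau_def power2_eq_square algebra_simps)
    qed
  qed (use gain tau_gain_integrable[OF c x, of 0] T1 t tT in auto)
  also have "\<dots> = expectation (?J ?t) + x * (expectation T - mean_tau c x)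
      + c * (expectation (\<lambda>\<omega>. ?t \<omega> * T \<omega>) - square_tau c x)"
    using tau_gain_integrable[OF c x, of 0] T1 t tT by (simp add: mean_tau_def square_tau_def)
  finally have J: "expectation (?J T) \<le> expectation (?J ?t) + x * (expectation T - mean_tau c x)
      + c * (expectation (\<lambda>\<omega>. ?t \<omega> * T \<omega>) - square_tau c x)" .
  have "0 \<le> expectation (\<lambda>\<omega>. (u0 * T \<omega> - u * ?t \<omega>)\<^sup>2)" by (rule integral_nonneg_AE) simp
  also have "(\<lambda>\<omega>. (u0 * T \<omega> - u * ?t \<omega>)\<^sup>2) = (\<lambda>\<omega>. u0\<^sup>2 * (T \<omega>)\<^sup>2 - 2 * u * u0 * (?t \<omega> * T \<omega>) + u\<^sup>2 * (?t \<omega>)\<^sup>2)"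
    by (auto simp: power2_eq_square algebra_simps)
  also have "expectation \<dots> = u0\<^sup>2 * expectation (\<lambda>\<omega>. (T \<omega>)\<^sup>2) - 2 * u * u0 * expectation (\<lambda>\<omega>. ?t \<omega> * T \<omega>) + u\<^sup>2 * square_tau c x"
    using T_int tT t by (simp add: square_tau_def)
  finally have sq: "0 \<le> expectation (\<lambda>\<omega>. (T \<omega>)\<^sup>2) * u0\<^sup>2 - 2 * expectation (\<lambda>\<omega>. ?t \<omega> * T \<omega>) * u * u0 + square_tau c x * u\<^sup>2"
    by (simp add: ac_simps)
  have xu: "x * (expectation T - mean_tau c x) = k * square_tau c x / (2 * u0\<^sup>2) * (u0 - u)"
  proof -
    define B0 where "B0 = square_tau c x"
    have x': "x = mean_wcost Q * ((rate Q)\<^sup>2 * B0 / (2 * u0\<^sup>2))"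
      using x_eq unfolding B0_def u0_def .
    have d: "expectation T - mean_tau c x = (u0 - u) / rate Q" using r by (simp add: u_def u0_def field_simps)
    have "x * (expectation T - mean_tau c x) = mean_wcost Q * ((rate Q)\<^sup>2 * B0 / (2 * u0\<^sup>2)) * ((u0 - u) / rate Q)"
      unfolding d by (subst x') (rule refl)
    also have "\<dots> = k * B0 / (2 * u0\<^sup>2) * (u0 - u)" using r u by (simp add: k_def power2_eq_square)
    finally show ?thesis by (simp only: B0_def)
  qed
  have "phi Q (net_marg Q 0) T = expectation (?J T) - k * expectation (\<lambda>\<omega>. (T \<omega>)\<^sup>2) / (2 * u)"
    by (simp add: phi_def k_def u_def)
  also have "\<dots> \<le> expectation (?J ?t) + (k * square_tau c x / (2 * u0\<^sup>2) * (u0 - u)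
      + k / u0 * (expectation (\<lambda>\<omega>. ?t \<omega> * T \<omega>) - square_tau c x) - k * expectation (\<lambda>\<omega>. (T \<omega>)\<^sup>2) / (2 * u))"
    using J unfolding xu ck[symmetric] by simp
  also have "\<dots> \<le> expectation (?J ?t) + - (k * square_tau c x / (2 * u0))"
    by (intro add_left_mono quadratic_over_linear u k sq)
  also have "\<dots> = phi Q (net_marg Q 0) ?t"
    by (simp add: phi_def k_def u0_def mean_tau_def square_tau_def)
  finally show ?thesis .
qed

text \<open>The expected gain is at least x E \<open>tau\<close> + c E \<open>tau\<close>^2 by
  \<open>tau_bounds\<close>, whereas the waiting term is only c E \<open>tau\<close>^2 / 2.\<close>

lemma phi_tau_pos:
  assumes c: "0 < c" and x: "0 < x" and pos: "0 < mean_tau c x"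
    and c_eq: "c * (1 - rate Q * mean_tau c x) = mean_wcost Q * rate Q" and load: "rate Q * mean_tau c x < 1"
  shows "0 < phi Q (net_marg Q 0) (tau c x 0)"
proof -
  let ?t = "tau c x 0"
  have x0: "0 \<le> x" using x by simp
  note t = tau_integrable[OF c x0, of 0] tau_square_integrable[OF c x0, of 0]
  have "expectation (\<lambda>\<omega>. x * ?t \<omega> + c * (?t \<omega>)\<^sup>2) \<le> expectation (\<lambda>\<omega>. integral {0..?t \<omega>} (\<lambda>s. net_marg Q 0 s \<omega>))"
    using t tau_gain_integrable[OF c x0, of 0] tau_bounds(4)[OF c x0, of _ 0]
    by (intro integral_mono_AE AE_I2) (auto simp: algebra_simps power2_eq_square)
  then have "x * mean_tau c x + c * square_tau c x \<le> expectation (\<lambda>\<omega>. integral {0..?t \<omega>} (\<lambda>s. net_marg Q 0 s \<omega>))"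
    using t by (simp add: mean_tau_def square_tau_def)
  moreover have "mean_wcost Q * rate Q * square_tau c x / (2 * (1 - rate Q * mean_tau c x)) = c * square_tau c x / 2"
    using load unfolding c_eq[symmetric] by (simp add: field_simps)
  moreover have "0 < x * mean_tau c x" "0 \<le> c * square_tau c x" using x pos c tau_moments_nonneg(2)[OF c x0] by auto
  ultimately show ?thesis by (simp add: phi_def mean_tau_def square_tau_def)
qed

text \<open>Gives the positive part of the gain an integrable bound for every square integrable
  duration.\<close>

lemma gain_le:
  assumes \<omega>: "\<omega> \<in> space (prob_of Q)" and s: "0 \<le> s"
  shows "integral {0..s} (\<lambda>u. net_marg Q i u \<omega>) \<le> (marg Q i 0 \<omega>)\<^sup>2 + s\<^sup>2"
proof -
  interpret d: decreasing_path "\<lambda>u. net_marg Q i u \<omega>" by (rule net_marg_decreasing[OF \<omega>])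
  have "integral {0..s} (\<lambda>u. net_marg Q i u \<omega>) \<le> integral {0..s} (\<lambda>_. net_marg Q i 0 \<omega>)"
    using d.integrable[of 0] d.le[of 0] by (intro integral_le) auto
  also have "\<dots> = marg Q i 0 \<omega> * s" using s by (simp add: net_marg_0 mult.commute)
  also have "\<dots> \<le> (marg Q i 0 \<omega>)\<^sup>2 + s\<^sup>2"
  proof -
    have "0 \<le> marg Q i 0 \<omega> * s" using marg_pos[OF \<omega>, of i] s by simp
    moreover have "2 * (marg Q i 0 \<omega> * s) \<le> (marg Q i 0 \<omega>)\<^sup>2 + s\<^sup>2"
      using zero_le_power2[of "marg Q i 0 \<omega> - s"] by (simp add: power2_diff)
    ultimately show ?thesis by linarith
  qed
  finally show ?thesis .
qed

lemma average_welfare_profile: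
  assumes profile: "service_profile Q p S" and int: "integrable (prob_of Q) (\<lambda>\<omega>. (S 0 \<omega>)\<^sup>2)"
    and load: "expectation (S 0) < 1 / rate Q"
  shows "stable_queue Q S" "mean_waiting_time Q S < \<infinity>"
    "integrable (prob_of Q) (\<lambda>\<omega>. integral {0..S 0 \<omega>} (\<lambda>s. net_marg Q 0 s \<omega>)) \<Longrightarrow>
      has_average_welfare Q S (ereal (rate Q * phi Q (net_marg Q 0) (S 0)))"
    "\<not> integrable (prob_of Q) (\<lambda>\<omega>. integral {0..S 0 \<omega>} (\<lambda>s. net_marg Q 0 s \<omega>)) \<Longrightarrow>
      has_average_welfare Q S (- \<infinity>)"
proof -
  interpret service_durations Q S by (rule profile_durations[OF profile])
  interpret stable_durations Q S by unfold_locales (rule int, rule load)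
  show "stable_queue Q S" by (rule stable_queue)
  show "mean_waiting_time Q S < \<infinity>" by (rule mean_waiting_time_finite)
  have gk: "gain i \<in> borel_measurable (knowledge {Marg i})" and gi: "distr (prob_of Q) borel (gain i) = distr (prob_of Q) borel (gain 0)" for i
    using gain_profile[OF profile, of i] unfolding gain_def[abs_def] .
  have gf: "(\<integral>\<^sup>+ \<omega>. benefit 0 \<omega> \<partial>prob_of Q) < \<infinity>"
  proof -
    have i: "integrable (prob_of Q) (\<lambda>\<omega>. (marg Q 0 0 \<omega>)\<^sup>2 + (S 0 \<omega>)\<^sup>2)" using marg_square_integrable int by simp
    have "(\<integral>\<^sup>+ \<omega>. benefit 0 \<omega> \<partial>prob_of Q) \<le> (\<integral>\<^sup>+ \<omega>. ennreal ((marg Q 0 0 \<omega>)\<^sup>2 + (S 0 \<omega>)\<^sup>2) \<partial>prob_of Q)"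
      unfolding benefit_def gain_def using gain_le S_nonneg by (intro nn_integral_mono ennreal_leI) auto
    also have "\<dots> < \<infinity>" using i unfolding real_integrable_def by (simp add: less_top)
    finally show ?thesis .
  qed
  have g0: "gain 0 = (\<lambda>\<omega>. integral {0..S 0 \<omega>} (\<lambda>s. net_marg Q 0 s \<omega>))" by (simp add: gain_def[abs_def])
  have ph: "expectation (gain 0) - mean_wcost Q * slots.mean_delay = phi Q (net_marg Q 0) (S 0)"
  proof -
    have "mean_wcost Q * slots.mean_delay = mean_wcost Q * rate Q * slots.m2 / (2 * (1 - rate Q * slots.m1))"
    proof -
      have "1 / rate Q - slots.m1 = (1 - rate Q * slots.m1) / rate Q" using rate_pos by (simp add: field_simps)
      then show ?thesis unfolding slots.mean_delay_def by simp
    qed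
    then show ?thesis unfolding phi_def g0 slots_moments by simp
  qed
  show "integrable (prob_of Q) (\<lambda>\<omega>. integral {0..S 0 \<omega>} (\<lambda>s. net_marg Q 0 s \<omega>)) \<Longrightarrow>
      has_average_welfare Q S (ereal (rate Q * phi Q (net_marg Q 0) (S 0)))"
    using average_welfare_real[OF gk gi gf] unfolding g0[symmetric] ph .
  show "\<not> integrable (prob_of Q) (\<lambda>\<omega>. integral {0..S 0 \<omega>} (\<lambda>s. net_marg Q 0 s \<omega>)) \<Longrightarrow>
      has_average_welfare Q S (- \<infinity>)"
    using average_welfare_infinite[OF gk gi gf] unfolding g0[symmetric] .
qed

lemma optimal_solution:
  "\<exists>x \<alpha>. 0 < x \<and>
    0 < \<alpha> \<and> \<alpha> \<le> (\<integral>\<omega>. net_marg Q 0 0 \<omega> \<partial>prob_of Q) / (mean_wcost Q * rate Q) \<and> \<alpha> < 1 / rate Q \<and>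
    (\<forall>\<pi>. optimal_price Q (quadratic_price Q \<pi> \<alpha> x)) \<and>
    (\<forall>\<pi>. service_profile Q (quadratic_price Q \<pi> \<alpha> x) (threshold_duration Q \<alpha> x) \<and>
      (\<forall>S. service_profile Q (quadratic_price Q \<pi> \<alpha> x) S \<longrightarrow>
        (\<forall>i. AE \<omega> in prob_of Q. S i \<omega> = threshold_duration Q \<alpha> x i \<omega>))) \<and>
    integrable (prob_of Q) (threshold_duration Q \<alpha> x 0) \<and>
    integrable (prob_of Q) (\<lambda>\<omega>. (threshold_duration Q \<alpha> x 0 \<omega>)\<^sup>2) \<and>
    (\<integral>\<omega>. threshold_duration Q \<alpha> x 0 \<omega> \<partial>prob_of Q) = \<alpha> \<and>
    0 < phi Q (net_marg Q 0) (threshold_duration Q \<alpha> x 0) \<and>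
    x = mean_wcost Q * ((rate Q)\<^sup>2 * (\<integral>\<omega>. (threshold_duration Q \<alpha> x 0 \<omega>)\<^sup>2 \<partial>prob_of Q)
          / (2 * (1 - rate Q * (\<integral>\<omega>. threshold_duration Q \<alpha> x 0 \<omega> \<partial>prob_of Q))\<^sup>2))"
proof -
  note g = mean_wcost_pos and r = rate_pos
  obtain c x where c: "0 < c" and x: "0 < x" and Fx: "price_map c x = x"
    and eq: "mean_wcost Q * rate Q / c + rate Q * mean_tau c x = 1"
    using fixed_point by blast
  have x0: "0 \<le> x" using x by simp
  define \<alpha> where "\<alpha> = mean_tau c x"
  have c_eq: "c * (1 - rate Q * \<alpha>) = mean_wcost Q * rate Q"
    using eq c by (simp add: \<alpha>_def field_simps)
  have "0 < c * (1 - rate Q * \<alpha>)" using c_eq g r by simp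
  then have load: "rate Q * \<alpha> < 1" using c by (simp add: zero_less_mult_iff)
  have c_def: "c = mean_wcost Q * rate Q / (1 - rate Q * \<alpha>)" using c_eq load by (simp add: field_simps)
  have x_eq: "x = mean_wcost Q * ((rate Q)\<^sup>2 * square_tau c x / (2 * (1 - rate Q * \<alpha>)\<^sup>2))"
  proof -
    have "x = c\<^sup>2 * square_tau c x / (2 * mean_wcost Q)" using Fx by (simp add: price_map_def)
    also have "\<dots> = (mean_wcost Q * rate Q / (1 - rate Q * \<alpha>))\<^sup>2 * square_tau c x / (2 * mean_wcost Q)" by (simp only: c_def[symmetric])
    also have "\<dots> = mean_wcost Q * ((rate Q)\<^sup>2 * square_tau c x / (2 * (1 - rate Q * \<alpha>)\<^sup>2))"
    proof -
      have "(a * b / w)\<^sup>2 * B / (2 * a) = a * (b\<^sup>2 * B / (2 * w\<^sup>2))" if "0 < a" for a b w B :: real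
        using that by (simp add: power2_eq_square ac_simps)
      then show ?thesis using g .
    qed
    finally show ?thesis .
  qed
  \<comment> \<open>If \<open>mean_tau\<close> vanished, so would \<open>tau\<close> almost surely
    and with it \<open>square_tau\<close>; the equation for x would then give x = 0.\<close>
  have pos: "0 < \<alpha>"
  proof -
    have "\<alpha> \<noteq> 0"
    proof
      assume "\<alpha> = 0"
      then have "AE \<omega> in prob_of Q. tau c x 0 \<omega> = 0"
        using integral_nonneg_eq_0_iff_AE[OF tau_integrable[OF c x0, of 0]] tau_nonneg[OF c x0]
        by (simp add: \<alpha>_def mean_tau_def)
      then have "square_tau c x = 0" unfolding square_tau_def by (intro integral_eq_zero_AE) auto
      then show False using x_eq x by simp
    qed
    then show ?thesis using tau_moments_nonneg(1)[OF c x0] by (simp add: \<alpha>_def)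
  qed
  have thr: "threshold_duration Q \<alpha> x = tau c x"
    by (auto simp: fun_eq_iff threshold_duration_def tau_def threshold_def c_def)
  have price: "quadratic_price Q \<pi> \<alpha> x = pay c x \<pi>" for \<pi>
  proof -
    have "c / 2 = mean_wcost Q * rate Q / (2 * (1 - rate Q * \<alpha>))" by (simp add: c_def)
    then show ?thesis by (simp only: fun_eq_iff quadratic_price_def pay_def[OF c x0] simp_thms)
  qed
  have load': "\<alpha> < 1 / rate Q" using load r by (simp add: field_simps)
  have bound: "\<alpha> \<le> mean_value / (mean_wcost Q * rate Q)"
  proof -
    have "\<alpha> \<le> mean_value / c" unfolding \<alpha>_def by (rule mean_tau_le[OF c x0])
    also have "\<dots> \<le> mean_value / (mean_wcost Q * rate Q)"
    proof (rule divide_left_mono)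
      have "0 \<le> c * (rate Q * \<alpha>)" using c r pos by simp
      then show "mean_wcost Q * rate Q \<le> c" using c_eq by (simp add: algebra_simps)
    qed (use g r c mean_value_nonneg in auto)
    finally show ?thesis .
  qed
  have tint: "integrable (prob_of Q) (\<lambda>\<omega>. (tau c x 0 \<omega>)\<^sup>2)" by (rule tau_square_integrable[OF c x0])
  have tload: "expectation (tau c x 0) < 1 / rate Q" using load' by (simp add: \<alpha>_def mean_tau_def)
  have optimal: "optimal_price Q (pay c x \<pi>)" for \<pi>
    unfolding optimal_price_def
  proof (rule exI[of _ "tau c x"], rule exI[of _ "ereal (rate Q * phi Q (net_marg Q 0) (tau c x 0))"], intro conjI allI impI)
    note w = average_welfare_profile[OF tau_profile[OF c x0, of \<pi>] tint tload]
    show "feasible_price Q (pay c x \<pi>) (tau c x)"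
      unfolding feasible_price_def using tau_profile[OF c x0] w(1,2) by blast
    show "has_average_welfare Q (tau c x) (ereal (rate Q * phi Q (net_marg Q 0) (tau c x 0)))"
      by (rule w(3)[OF tau_gain_integrable[OF c x0]])
    fix p S assume feasible: "feasible_price Q p S"
    then have profile: "service_profile Q p S" and fin: "mean_waiting_time Q S < \<infinity>"
      unfolding feasible_price_def by auto
    interpret service_durations Q S by (rule profile_durations[OF profile])
    \<comment> \<open>Feasibility of the competing price does not mention moments; they are
      extracted from its finite mean waiting time.\<close>
    note m = finite_moments[OF fin]
    note w' = average_welfare_profile[OF profile m]
    show "\<exists>L'. has_average_welfare Q S L' \<and> L' \<le> ereal (rate Q * phi Q (net_marg Q 0) (tau c x 0))"
    proof (cases "integrable (prob_of Q) (\<lambda>\<omega>. integral {0..S 0 \<omega>} (\<lambda>s. net_marg Q 0 s \<omega>))")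
      case True
      have "rate Q * expectation (S 0) < 1" using m(2) r by (simp add: field_simps)
      then have "phi Q (net_marg Q 0) (S 0) \<le> phi Q (net_marg Q 0) (tau c x 0)"
        using m(1) True S_nonneg load c_eq x_eq by (intro phi_le_tau c x0) (auto simp: \<alpha>_def)
      then show ?thesis using w'(3)[OF True] r by (intro exI conjI) (auto intro: mult_left_mono)
    next
      case False
      then show ?thesis using w'(4) by (intro exI conjI) auto
    qed
  qed
  show ?thesis
  proof (rule exI[of _ x], rule exI[of _ \<alpha>], intro conjI allI impI)
    show "\<alpha> \<le> (\<integral>\<omega>. net_marg Q 0 0 \<omega> \<partial>prob_of Q) / (mean_wcost Q * rate Q)"
      using bound by (simp add: net_marg_0 mean_value_def)
    show "0 < phi Q (net_marg Q 0) (threshold_duration Q \<alpha> x 0)"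
      unfolding thr using phi_tau_pos[OF c x] pos c_eq load by (simp add: \<alpha>_def)
    show "optimal_price Q (quadratic_price Q \<pi> \<alpha> x)" for \<pi> unfolding price by (rule optimal)
    show "service_profile Q (quadratic_price Q \<pi> \<alpha> x) (threshold_duration Q \<alpha> x)" for \<pi>
      unfolding price thr by (rule tau_profile[OF c x0])
    show "AE \<omega> in prob_of Q. S i \<omega> = threshold_duration Q \<alpha> x i \<omega>"
      if "service_profile Q (quadratic_price Q \<pi> \<alpha> x) S" for \<pi> S i
      using tau_profile_unique[OF c x0 that[unfolded price]] unfolding thr .
    show "x = mean_wcost Q * ((rate Q)\<^sup>2 * (\<integral>\<omega>. (threshold_duration Q \<alpha> x 0 \<omega>)\<^sup>2 \<partial>prob_of Q)
          / (2 * (1 - rate Q * (\<integral>\<omega>. threshold_duration Q \<alpha> x 0 \<omega> \<partial>prob_of Q))\<^sup>2))"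
      unfolding thr using x_eq by (simp only: \<alpha>_def mean_tau_def square_tau_def)
  qed (use x pos load' tint tau_integrable[OF c x0, of 0] \<alpha>_def[unfolded mean_tau_def, symmetric] in \<open>simp_all add: thr\<close>)
qed

end

theorem theorem1:
  fixes Q :: "('a, 'r) facility"
  assumes "facility_model Q"
  shows "\<exists>x \<alpha>. 0 < x \<and>
    0 < \<alpha> \<and> \<alpha> \<le> (\<integral>\<omega>. net_marg Q 0 0 \<omega> \<partial>prob_of Q) / (mean_wcost Q * rate Q) \<and> \<alpha> < 1 / rate Q \<and>
    (\<forall>\<pi>. optimal_price Q (quadratic_price Q \<pi> \<alpha> x)) \<and>
    (\<forall>\<pi>. service_profile Q (quadratic_price Q \<pi> \<alpha> x) (threshold_duration Q \<alpha> x) \<and>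
      (\<forall>S. service_profile Q (quadratic_price Q \<pi> \<alpha> x) S \<longrightarrow>
        (\<forall>i. AE \<omega> in prob_of Q. S i \<omega> = threshold_duration Q \<alpha> x i \<omega>))) \<and>
    integrable (prob_of Q) (threshold_duration Q \<alpha> x 0) \<and>
    integrable (prob_of Q) (\<lambda>\<omega>. (threshold_duration Q \<alpha> x 0 \<omega>)\<^sup>2) \<and>
    (\<integral>\<omega>. threshold_duration Q \<alpha> x 0 \<omega> \<partial>prob_of Q) = \<alpha> \<and>
    0 < phi Q (net_marg Q 0) (threshold_duration Q \<alpha> x 0) \<and>
    x = mean_wcost Q * ((rate Q)\<^sup>2 * (\<integral>\<omega>. (threshold_duration Q \<alpha> x 0 \<omega>)\<^sup>2 \<partial>prob_of Q)
          / (2 * (1 - rate Q * (\<integral>\<omega>. threshold_duration Q \<alpha> x 0 \<omega> \<partial>prob_of Q))\<^sup>2))"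
proof -
  interpret facility_model Q by (rule assms)
  show ?thesis by (rule optimal_solution)
qed

end
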